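(* The problem of deciding, given a formula $A$, whether the labelled sequent $\vdash 1:A$ is derivable in $\mathbf{GA_l}$ belongs to co-NP.
   Context: Formulas are built from propositional variables and $t$ using $+,\to,\Rightarrow$ (binary) and $\lnot$. Labels are generated from the unit label $1$ and atomic labels $x_1,x_2,\ldots$ by concatenation $xy$. A labelled formula is $x:A$; a labelled sequent $\Gamma\vdash\Delta$ is a pair of finite multisets of labelled formulas. A labelling function $f$ maps labels to $\{0,1\}$ with $f(1)=1$, $f(xy)=f(x)f(y)$; $f(\Gamma)=\{A : x:A\in\Gamma, f(x)=1\}$ (multiset). Calculus $\mathbf{GA_l}$ (premise(s) / conclusion): $(t,l)$ $\Gamma\vdash\Delta/\Gamma,x:t\vdash\Delta$; $(t,r)$ $\Gamma\vdash\Delta/\Gamma\vdash x:t,\Delta$; $(\lnot,l)$ $\Gamma\vdash x:A,\Delta/\Gamma,x:\lnot A\vdash\Delta$; $(\lnot,r)$ $\Gamma,x:A\vdash\Delta/\Gamma\vdash x:\lnot A,\Delta$; $(+,l)$ $\Gamma,x:A,x:B\vdash\Delta/\Gamma,x:A+B\vdash\Delta$; $(+,r)$ $\Gamma\vdash\Delta,x:A,x:B/\Gamma\vdash\Delta,x:A+B$; $(\to,l)$ $\Gamma,x:B\vdash\Delta,x:A/\Gamma,x:A\to B\vdash\Delta$; $(\to,r)$ $\Gamma,x:A\vdash\Delta,x:B/\Gamma\vdash\Delta,x:A\to B$; $(\Rightarrow,l)$ $\Gamma,xy:B\vdash\Delta,xy:A/\Gamma,x:A\Rightarrow B\vdash\Delta$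 with $y$ an atomic label not occurring in the conclusion; $(\Rightarrow,r)$ premises $\Gamma,x:A\vdash\Delta,x:B$ and $\Gamma\vdash\Delta$, conclusion $\Gamma\vdash\Delta,x:A\Rightarrow B$; (success) axiom $\Gamma\vdash\Delta$ whenever all formulas in $\Gamma,\Delta$ are propositional variables and there exist labelling functions $f_1,\ldots,f_n$ ($n\ge1$) with $\biguplus_i f_i(\Gamma)=\biguplus_i f_i(\Delta)$. *)

theory Defs
  imports "HOL-Library.Multiset" "HOL-Computational_Algebra.Polynomial"
begin

section \<open>The labelled calculus\<close>

datatype fm =
    Var nat
  | Const_t
  | Neg fm
  | Plus fm fm
  | Imp fm fm       \<comment> \<open>\<open>A \<rightarrow> B\<close>\<close>
  | RImp fm fm      \<comment> \<open>\<open>A \<Rightarrow> B\<close>\<close>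

datatype label = Unit | Atom nat | Cat label label

type_synonym lfms = "(label \<times> fm) multiset"

primrec atoms :: "label \<Rightarrow> nat set" where
  "atoms Unit = {}"
| "atoms (Atom n) = {n}"
| "atoms (Cat x y) = atoms x \<union> atoms y"

definition atoms_of :: "lfms \<Rightarrow> nat set" where
  "atoms_of \<Gamma> = (\<Union>(x, A) \<in> set_mset \<Gamma>. atoms x)"

definition labelling :: "(label \<Rightarrow> nat) \<Rightarrow> bool" where
  "labelling f \<longleftrightarrow> range f \<subseteq> {0, 1} \<and> f Unit = 1 \<and> (\<forall>x y. f (Cat x y) = f x * f y)"

definition select :: "(label \<Rightarrow> nat) \<Rightarrow> lfms \<Rightarrow> fm multiset" where
  "select f \<Gamma> = image_mset snd (filter_mset (\<lambda>(x, A). f x = 1) \<Gamma>)"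

definition atomic :: "lfms \<Rightarrow> bool" where
  "atomic \<Gamma> \<longleftrightarrow> (\<forall>(x, A) \<in> set_mset \<Gamma>. \<exists>p. A = Var p)"

inductive GAl :: "lfms \<Rightarrow> lfms \<Rightarrow> bool" (infix "\<turnstile>\<^sub>l" 40) where
  t_l: "\<Gamma> \<turnstile>\<^sub>l \<Delta> \<Longrightarrow> add_mset (x, Const_t) \<Gamma> \<turnstile>\<^sub>l \<Delta>"
| t_r: "\<Gamma> \<turnstile>\<^sub>l \<Delta> \<Longrightarrow> \<Gamma> \<turnstile>\<^sub>l add_mset (x, Const_t) \<Delta>"
| Neg_l: "\<Gamma> \<turnstile>\<^sub>l add_mset (x, A) \<Delta> \<Longrightarrow> add_mset (x, Neg A) \<Gamma> \<turnstile>\<^sub>l \<Delta>"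
| Neg_r: "add_mset (x, A) \<Gamma> \<turnstile>\<^sub>l \<Delta> \<Longrightarrow> \<Gamma> \<turnstile>\<^sub>l add_mset (x, Neg A) \<Delta>"
| Plus_l: "add_mset (x, A) (add_mset (x, B) \<Gamma>) \<turnstile>\<^sub>l \<Delta> \<Longrightarrow> add_mset (x, Plus A B) \<Gamma> \<turnstile>\<^sub>l \<Delta>"
| Plus_r: "\<Gamma> \<turnstile>\<^sub>l add_mset (x, A) (add_mset (x, B) \<Delta>) \<Longrightarrow> \<Gamma> \<turnstile>\<^sub>l add_mset (x, Plus A B) \<Delta>"
| Imp_l: "add_mset (x, B) \<Gamma> \<turnstile>\<^sub>l add_mset (x, A) \<Delta> \<Longrightarrow> add_mset (x, Imp A B) \<Gamma> \<turnstile>\<^sub>l \<Delta>"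
| Imp_r: "add_mset (x, A) \<Gamma> \<turnstile>\<^sub>l add_mset (x, B) \<Delta> \<Longrightarrow> \<Gamma> \<turnstile>\<^sub>l add_mset (x, Imp A B) \<Delta>"
| RImp_l: "add_mset (Cat x (Atom y), B) \<Gamma> \<turnstile>\<^sub>l add_mset (Cat x (Atom y), A) \<Delta> \<Longrightarrow>
    y \<notin> atoms x \<union> atoms_of \<Gamma> \<union> atoms_of \<Delta> \<Longrightarrow> add_mset (x, RImp A B) \<Gamma> \<turnstile>\<^sub>l \<Delta>"
| RImp_r: "add_mset (x, A) \<Gamma> \<turnstile>\<^sub>l add_mset (x, B) \<Delta> \<Longrightarrow> \<Gamma> \<turnstile>\<^sub>l \<Delta> \<Longrightarrow>
    \<Gamma> \<turnstile>\<^sub>l add_mset (x, RImp A B) \<Delta>"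
| success: "atomic \<Gamma> \<Longrightarrow> atomic \<Delta> \<Longrightarrow> fs \<noteq> [] \<Longrightarrow> \<forall>f \<in> set fs. labelling f \<Longrightarrow>
    (\<Sum>f\<leftarrow>fs. select f \<Gamma>) = (\<Sum>f\<leftarrow>fs. select f \<Delta>) \<Longrightarrow> \<Gamma> \<turnstile>\<^sub>l \<Delta>"


section \<open>Formulas as binary words\<close>

text \<open>Binary digits of a variable index, least significant first; each digit is preceded by
  the continuation bit \<^term>\<open>True\<close>, and \<^term>\<open>False\<close> ends the number.\<close>

fun encode_nat :: "nat \<Rightarrow> bool list" where
  "encode_nat n = (if n = 0 then [False] else True # odd n # encode_nat (n div 2))"

declare encode_nat.simps [simp del]

text \<open>Polish notation, with a three-bit tag for each symbol.\<close>

primrec encode :: "fm \<Rightarrow> bool list" where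
  "encode (Var p) = [False, False, False] @ encode_nat p"
| "encode Const_t = [False, False, True]"
| "encode (Neg A) = [False, True, False] @ encode A"
| "encode (Plus A B) = [False, True, True] @ encode A @ encode B"
| "encode (Imp A B) = [True, False, False] @ encode A @ encode B"
| "encode (RImp A B) = [True, False, True] @ encode A @ encode B"

lemma encode_nat_append_inject:
  "encode_nat m @ v = encode_nat n @ w \<longleftrightarrow> m = n \<and> v = w"
proof (induction m arbitrary: n rule: less_induct)
  case (less m)
  show ?case
  proof (cases "m = 0 \<or> n = 0")
    case True
    then show ?thesis
      by (auto simp: encode_nat.simps[of m] encode_nat.simps[of n])
  next
    case False
    then have *: "encode_nat (m div 2) @ v = encode_nat (n div 2) @ w \<longleftrightarrow> m div 2 = n div 2 \<and> v = w"
      by (intro less) auto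
    have "m = n \<longleftrightarrow> odd m = odd n \<and> m div 2 = n div 2"
      by (metis bit_eq_rec)
    with * False show ?thesis
      by (auto simp: encode_nat.simps[of m] encode_nat.simps[of n])
  qed
qed

lemma encode_append_inject: "encode A @ v = encode B @ w \<longleftrightarrow> A = B \<and> v = w"
proof (induction A arbitrary: B v w)
  case (Var p) then show ?case by (cases B) (auto simp: encode_nat_append_inject)
next
  case Const_t then show ?case by (cases B) auto
next
  case (Neg A) then show ?case by (cases B) auto
next
  case (Plus A1 A2) then show ?case by (cases B) auto
next
  case (Imp A1 A2) then show ?case by (cases B) auto
next
  case (RImp A1 A2) then show ?case by (cases B) auto
qed

lemma inj_encode: "inj encode"
  using encode_append_inject[of _ "[]" _ "[]"] by (auto intro: injI)


section \<open>Turing machines, NP and co-NP\<close>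

text \<open>Deterministic multi-tape machines with two-way infinite tapes. A tape is its contents
  together with the head position. Symbol \<open>0\<close> is the blank, and \<open>1\<close>, \<open>2\<close> are the input bits.\<close>

datatype dir = Go_Left | Stay | Go_Right

type_synonym tape = "(int \<Rightarrow> nat) \<times> int"
type_synonym config = "nat \<times> tape list"

record tm =
  num_tapes :: nat
  num_symbols :: nat
  num_states :: nat
  start :: nat
  accept :: nat
  reject :: nat
  delta :: "nat \<Rightarrow> nat list \<Rightarrow> nat \<times> (nat \<times> dir) list"

definition wf_tm :: "tm \<Rightarrow> bool" where
  "wf_tm M \<longleftrightarrow> 2 \<le> num_tapes M \<and> 3 \<le> num_symbols M \<and>
     start M < num_states M \<and> accept M < num_states M \<and> reject M < num_states M \<and>
     accept M \<noteq> reject M \<and>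
     (\<forall>q < num_states M. \<forall>ss. length ss = num_tapes M \<and> set ss \<subseteq> {..<num_symbols M} \<longrightarrow>
        fst (delta M q ss) < num_states M \<and>
        length (snd (delta M q ss)) = num_tapes M \<and>
        fst ` set (snd (delta M q ss)) \<subseteq> {..<num_symbols M})"

fun read :: "tape \<Rightarrow> nat" where
  "read (c, h) = c h"

fun move :: "dir \<Rightarrow> int \<Rightarrow> int" where
  "move Go_Left h = h - 1"
| "move Stay h = h"
| "move Go_Right h = h + 1"

fun act :: "nat \<times> dir \<Rightarrow> tape \<Rightarrow> tape" where
  "act (s, d) (c, h) = (c(h := s), move d h)"

definition halted :: "tm \<Rightarrow> config \<Rightarrow> bool" where
  "halted M C \<longleftrightarrow> fst C \<in> {accept M, reject M}"

definition step :: "tm \<Rightarrow> config \<Rightarrow> config" where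
  "step M C =
     (if halted M C then C
      else let (q, as) = delta M (fst C) (map read (snd C)) in (q, map2 act as (snd C)))"

definition word_tape :: "bool list \<Rightarrow> tape" where
  "word_tape w =
     (\<lambda>i. if 0 \<le> i \<and> nat i < length w then (if w ! nat i then 2 else 1) else 0, 0)"

text \<open>The instance is on the first tape and the certificate on the second one.\<close>

definition init :: "tm \<Rightarrow> bool list \<Rightarrow> bool list \<Rightarrow> config" where
  "init M x u = (start M, word_tape x # word_tape u # replicate (num_tapes M - 2) (word_tape []))"

definition run :: "tm \<Rightarrow> nat \<Rightarrow> bool list \<Rightarrow> bool list \<Rightarrow> config" where
  "run M n x u = (step M ^^ n) (init M x u)"

definition accepts :: "tm \<Rightarrow> bool list \<Rightarrow> bool list \<Rightarrow> bool" where
  "accepts M x u \<longleftrightarrow> (\<exists>n. fst (run M n x u) = accept M)"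

definition NP :: "bool list set set" where
  "NP = {L. \<exists>M p q. wf_tm M \<and>
     (\<forall>x u. length u \<le> poly p (length x) \<longrightarrow> halted M (run M (poly q (length x)) x u)) \<and>
     (\<forall>x. x \<in> L \<longleftrightarrow> (\<exists>u. length u \<le> poly p (length x) \<and> accepts M x u))}"

definition co_NP :: "bool list set set" where
  "co_NP = {L. - L \<in> NP}"

end

theory Submission
  imports Defs "HOL-Library.FuncSet"
begin

text \<open>Read over the integers, with \<open>+\<close>, \<open>\<rightarrow>\<close> and \<open>\<not>\<close> as addition, subtraction and negation, \<open>t\<close> as \<open>0\<close>
  and \<open>A \<Rightarrow> B\<close> as \<open>min 0 (B - A)\<close>, a formula is derivable iff no valuation gives it a negative value:
  a labelling that puts a fresh label on or off picks the argument of the minimum, the rules are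
  semantically invertible, and success at an atomic sequent is Gordan's alternative to the existence of a
  refuting valuation. Hence a refuting valuation certifies underivability. It can be chosen small: fixing
  the argument of each minimum leaves a system of homogeneous linear inequalities, a solution with a
  maximal set of tight constraints spans the kernel of fewer constraints than variables, and Siegel's
  pigeonhole argument yields a kernel vector whose entries have polynomially many bits.
  The verifier, a program over stacks compiled to a multi-tape machine, accepts ill-formed words and
  otherwise evaluates the formula in two's complement.\<close>

section \<open>Validity in the integers\<close>

text \<open>Semantic validity lets the labelling depend on the valuation, whereas
  \<open>success\<close> asks for one finite list of labellings that balances the two sides
  outright. Gordan's alternative performs this exchange of quantifiers; all other rules are treated
  one valuation at a time. Determinants are avoided in the size bound. A minimal set of tight
  constraints that still determines the ray of a solution has fewer elements than there are
  variables, which is just what the pigeonhole argument asks for. The kernel being a line, the small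
  vector lies on that ray up to sign and inherits all constraints. The verifier never has to reject
  a certificate: every bit string is read as a table and every table defines a total valuation, so a
  bad certificate merely fails to refute. All numbers share one width \<open>N\<close>: one digit,
  plus one per table symbol, plus one per token. A looked-up value has no more digits than the table
  has symbols, and a formula has no more leaves than tokens, so the top digit is always the true
  sign.\<close>

primrec val :: "(nat \<Rightarrow> int) \<Rightarrow> fm \<Rightarrow> int" where
  "val v (Var p) = v p"
| "val v Const_t = 0"
| "val v (Neg A) = - val v A"
| "val v (Plus A B) = val v A + val v B"
| "val v (Imp A B) = val v B - val v A"
| "val v (RImp A B) = min 0 (val v B - val v A)"

definition mval :: "(nat \<Rightarrow> int) \<Rightarrow> (label \<Rightarrow> nat) \<Rightarrow> lfms \<Rightarrow> int" where
  "mval v f \<Gamma> = (\<Sum>(x, A)\<in>#\<Gamma>. if f x = 1 then val v A else 0)"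

lemma mval_empty [simp]: "mval v f {#} = 0"
  by (simp add: mval_def)

lemma mval_add [simp]:
  "mval v f (add_mset (x, A) \<Gamma>) = (if f x = 1 then val v A else 0) + mval v f \<Gamma>"
  by (simp add: mval_def)

lemma mval_select: "mval v f \<Gamma> = (\<Sum>A\<in>#select f \<Gamma>. val v A)"
  by (induction \<Gamma>) (auto simp: select_def)

lemma labelling_01: "labelling f \<Longrightarrow> f x = 0 \<or> f x = 1"
  unfolding labelling_def by blast

lemma labelling_Cat: "labelling f \<Longrightarrow> f (Cat x y) = f x * f y"
  unfolding labelling_def by blast

definition valid_at :: "(nat \<Rightarrow> int) \<Rightarrow> lfms \<Rightarrow> lfms \<Rightarrow> bool" where
  "valid_at v \<Gamma> \<Delta> \<longleftrightarrow> (\<exists>f. labelling f \<and> mval v f \<Gamma> \<le> mval v f \<Delta>)"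

text \<open>In \<open>RImp_l\<close> the labelling of the premise is kept, since \<open>min\<close>
  lies below both of its arguments. In \<open>RImp_r\<close> the sign of
  \<open>val v B - val v A\<close> decides which premise supplies the labelling. At
  \<open>success\<close>, equal totals over \<open>fs\<close> exclude a strict inequality for every
  single \<open>f\<close>.\<close>

lemma GAl_sound: "\<Gamma> \<turnstile>\<^sub>l \<Delta> \<Longrightarrow> valid_at v \<Gamma> \<Delta>"
proof (induction rule: GAl.induct)
  case (RImp_l x y B \<Gamma> A \<Delta>)
  then obtain f where f: "labelling f"
    "mval v f (add_mset (Cat x (Atom y), B) \<Gamma>) \<le> mval v f (add_mset (Cat x (Atom y), A) \<Delta>)"
    by (auto simp: valid_at_def)
  then show ?case
    using labelling_01[OF f(1), of x] labelling_01[OF f(1), of "Atom y"]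
    by (auto simp: valid_at_def labelling_Cat split: if_splits intro!: exI[of _ f])
next
  case (RImp_r x A \<Gamma> B \<Delta>)
  then obtain f g where f: "labelling f"
    "mval v f (add_mset (x, A) \<Gamma>) \<le> mval v f (add_mset (x, B) \<Delta>)"
    and g: "labelling g" "mval v g \<Gamma> \<le> mval v g \<Delta>"
    unfolding valid_at_def by blast
  show ?case
  proof (cases "val v B \<le> val v A")
    case True
    then show ?thesis using f by (auto simp: valid_at_def split: if_splits intro!: exI[of _ f])
  next
    case False
    then show ?thesis using g by (auto simp: valid_at_def split: if_splits intro!: exI[of _ g])
  qed
next
  case (success \<Gamma> \<Delta> fs)
  have *: "(\<Sum>f\<leftarrow>fs. mval v f \<Gamma>) = (\<Sum>A\<in>#(\<Sum>f\<leftarrow>fs. select f \<Gamma>). val v A)" for \<Gamma>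
    by (induction fs) (auto simp: mval_select)
  have eq: "(\<Sum>f\<leftarrow>fs. mval v f \<Gamma>) = (\<Sum>f\<leftarrow>fs. mval v f \<Delta>)"
    unfolding * success.hyps(5) ..
  show ?case
  proof (rule ccontr)
    assume "\<not> ?thesis"
    then have "\<And>f. f \<in> set fs \<Longrightarrow> mval v f \<Delta> < mval v f \<Gamma>"
      using success.hyps(4) by (force simp: valid_at_def)
    with success.hyps(3) have "(\<Sum>f\<leftarrow>fs. mval v f \<Delta>) < (\<Sum>f\<leftarrow>fs. mval v f \<Gamma>)"
      by (intro sum_list_strict_mono) auto
    with eq show False by simp
  qed
qed (fastforce simp: valid_at_def algebra_simps split: if_splits)+

section \<open>Gordan's alternative and small solutions of linear inequalities\<close>

definition dot :: "'a set \<Rightarrow> ('a \<Rightarrow> int) \<Rightarrow> ('a \<Rightarrow> int) \<Rightarrow> int" where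
  "dot P u w = (\<Sum>p\<in>P. u p * w p)"

lemma dot_lin: "dot P u (\<lambda>p. a * w p + b * z p) = a * dot P u w + b * dot P u z"
  by (simp add: dot_def sum.distrib sum_distrib_left algebra_simps)

lemma dot_cong: "(\<And>p. p \<in> P \<Longrightarrow> w p = z p) \<Longrightarrow> dot P u w = dot P u z"
  by (simp add: dot_def)

lemma dot_commute: "dot P u w = dot P w u"
  by (simp add: dot_def mult.commute)

text \<open>Nonnegative integer combinations with at least one positive coefficient, kept as plain
  sums so that they can be read back as a nonempty list of labellings.\<close>

inductive_set sums_of :: "('a \<Rightarrow> int) set \<Rightarrow> ('a \<Rightarrow> int) set" for S where
  base: "d \<in> S \<Longrightarrow> d \<in> sums_of S"
| add: "d \<in> sums_of S \<Longrightarrow> e \<in> sums_of S \<Longrightarrow> (\<lambda>p. d p + e p) \<in> sums_of S"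

lemma sums_of_scale:
  assumes "d \<in> sums_of S" "k > 0"
  shows "(\<lambda>p. k * d p) \<in> sums_of S"
proof -
  have "(\<lambda>p. (int n + 1) * d p) \<in> sums_of S" for n
  proof (induction n)
    case 0 then show ?case using assms by simp
  next
    case (Suc n)
    have "(\<lambda>p. (int (Suc n) + 1) * d p) = (\<lambda>p. (int n + 1) * d p + d p)"
      by (auto simp: algebra_simps)
    with sums_of.add[OF Suc assms(1)] show ?case by simp
  qed
  from this[of "nat (k - 1)"] assms(2) show ?thesis by simp
qed

lemma sums_of_trans: "e \<in> sums_of S' \<Longrightarrow> S' \<subseteq> sums_of S \<Longrightarrow> e \<in> sums_of S"
  by (induction rule: sums_of.induct) (auto intro: sums_of.intros)

text \<open>Provides the value of an eliminated coordinate. Either side may be empty; inserting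
  \<open>0\<close> keeps \<open>Min\<close> and \<open>Max\<close> meaningful in that case.\<close>

lemma between_finite_sets:
  fixes L U :: "rat set"
  assumes "finite L" "finite U" "\<And>l u. l \<in> L \<Longrightarrow> u \<in> U \<Longrightarrow> l < u"
  shows "\<exists>t. (\<forall>l\<in>L. l < t) \<and> (\<forall>u\<in>U. t < u)"
proof (cases "L = {} \<or> U = {}")
  case True
  show ?thesis
  proof (cases "L = {}")
    case True
    have "\<forall>u\<in>U. Min (insert 0 U) - 1 < u"
      using assms(2) by (metis Min_le diff_less_eq finite_insert insertCI le_less_trans less_add_one)
    with True show ?thesis by blast
  next
    case False
    with True have "U = {}" by simp
    moreover have "\<forall>l\<in>L. l < Max (insert 0 L) + 1"
      using assms(1) by (metis Max_ge finite_insert insertCI le_less_trans less_add_one)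
    ultimately show ?thesis by blast
  qed
next
  case False
  then have "Max L < Min U" using assms by simp
  then obtain t where "Max L < t" "t < Min U" using dense by blast
  then show ?thesis using False assms(1,2) by (intro exI[of _ t]) auto
qed

text \<open>Fourier-Motzkin elimination of one coordinate at a time, with the combinations kept
  inside \<open>sums_of S\<close>.\<close>

theorem gordan:
  fixes S :: "('a \<Rightarrow> int) set"
  assumes "finite P" "finite S" "S \<noteq> {}"
  shows "(\<exists>v. \<forall>d\<in>S. 0 < dot P d v) \<or> (\<exists>e\<in>sums_of S. \<forall>p\<in>P. e p = 0)"
  using assms
proof (induction P arbitrary: S rule: finite_induct)
  case empty
  then show ?case by (auto intro: sums_of.base)
next
  case (insert q P)
  note dot_ins = dot_def[of "insert q P"] sum.insert[OF insert.hyps]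
  \<comment> \<open>For \<open>d q > 0 > d' q\<close> both multipliers are positive and the
    coordinate \<open>q\<close> cancels.\<close>
  define comb where "comb = (\<lambda>(d::'a \<Rightarrow> int, d' :: 'a \<Rightarrow> int) p. (- d' q) * d p + d q * d' p)"
  define Pos where "Pos = {d \<in> S. 0 < d q}"
  define Neg where "Neg = {d \<in> S. d q < 0}"
  define S' where "S' = {d \<in> S. d q = 0} \<union> comb ` (Pos \<times> Neg)"
  have fin: "finite Pos" "finite Neg" "finite S'"
    using insert.prems by (auto simp: Pos_def Neg_def S'_def)
  have sub: "S' \<subseteq> sums_of S"
  proof -
    have "comb (d, d') \<in> sums_of S" if "d \<in> Pos" "d' \<in> Neg" for d d'
      using that unfolding comb_def split
      by (intro sums_of.add sums_of_scale sums_of.base) (auto simp: Pos_def Neg_def)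
    then show ?thesis by (auto simp: S'_def intro: sums_of.base)
  qed
  have zero: "d q = 0" if "d \<in> S'" for d
    using that by (auto simp: S'_def comb_def)
  have zero': "e q = 0" if "e \<in> sums_of S'" for e
    using that by (induction rule: sums_of.induct) (auto simp: zero)
  show ?case
  proof (cases "S' = {}")
    case True
    then have "{d \<in> S. d q = 0} = {}" and PN: "Pos = {} \<or> Neg = {}"
      by (auto simp: S'_def)
    then have nz: "\<forall>d\<in>S. d q \<noteq> 0" by blast
    \<comment> \<open>With no vector left after elimination, all \<open>d q\<close> are nonzero and
      of one sign, so plus or minus a unit vector solves the system.\<close>
    define s :: int where "s = (if Neg = {} then 1 else -1)"
    have "0 < dot (insert q P) d (\<lambda>p. if p = q then s else 0)" if "d \<in> S" for d
    proof -
      have "(\<Sum>p\<in>P. d p * (if p = q then s else 0)) = 0"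
        using insert.hyps by (intro sum.neutral) auto
      moreover have "0 < d q * s"
        using that nz PN unfolding s_def Pos_def Neg_def
        by (cases "d q" "0::int" rule: linorder_cases) auto
      ultimately show ?thesis by (simp add: dot_ins)
    qed
    then show ?thesis by blast
  next
    case False
    from insert.IH[OF fin(3) this] show ?thesis
    proof
      assume "\<exists>e\<in>sums_of S'. \<forall>p\<in>P. e p = 0"
      then show ?thesis using sums_of_trans[OF _ sub] zero' by blast
    next
      assume "\<exists>v. \<forall>d\<in>S'. 0 < dot P d v"
      then obtain v where v: "\<And>d. d \<in> S' \<Longrightarrow> 0 < dot P d v" by blast
      \<comment> \<open>The value of coordinate \<open>q\<close> at which \<open>d\<close> vanishes:
        a lower bound for \<open>d q > 0\<close>, an upper bound for \<open>d q < 0\<close>.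
        Positivity on the combinations separates the two kinds of bounds.\<close>
      define r where "r = (\<lambda>d. - of_int (dot P d v) / (of_int (d q) :: rat))"
      have "\<exists>t. (\<forall>l\<in>r ` Pos. l < t) \<and> (\<forall>u\<in>r ` Neg. t < u)"
      proof (rule between_finite_sets)
        fix l u assume "l \<in> r ` Pos" "u \<in> r ` Neg"
        then obtain d d' where d: "d \<in> Pos" "d' \<in> Neg" "l = r d" "u = r d'" by blast
        then have "0 < dot P (comb (d, d')) v" by (intro v) (auto simp: S'_def)
        also have "dot P (comb (d, d')) v = (- d' q) * dot P d v + d q * dot P d' v"
          unfolding comb_def split by (subst (1 2 3) dot_commute, rule dot_lin)
        finally have "(0::rat) < of_int ((- d' q) * dot P d v + d q * dot P d' v)"
          by (simp only: of_int_0_less_iff)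
        then have "0 < (- of_int (d' q)) * of_int (dot P d v) + of_int (d q) * (of_int (dot P d' v) :: rat)"
          by simp
        moreover have "(0::rat) < of_int (d q)" "of_int (d' q) < (0::rat)"
          using d by (auto simp: Pos_def Neg_def)
        ultimately show "l < u" unfolding d r_def by (simp add: field_simps)
      qed (use fin in auto)
      then obtain t where "\<forall>l\<in>r ` Pos. l < t" "\<forall>u\<in>r ` Neg. t < u" by (elim exE conjE)
      then have t: "\<And>d. d \<in> Pos \<Longrightarrow> r d < t" "\<And>d. d \<in> Neg \<Longrightarrow> t < r d" by auto
      obtain a b where q: "quotient_of t = (a, b)" by (cases "quotient_of t")
      have ab: "t = of_int a / of_int b" "b > 0"
        using quotient_of_div[OF q] quotient_of_denom_pos[OF q] by auto
      \<comment> \<open>Multiplying by the positive denominator \<open>b\<close> of \<open>t\<close>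
        makes the solution integral.\<close>
      let ?v = "\<lambda>p. if p = q then a else b * v p"
      have dv: "dot (insert q P) d ?v = d q * a + b * dot P d v" for d
      proof -
        have "(\<Sum>p\<in>P. d p * ?v p) = (\<Sum>p\<in>P. b * (d p * v p))"
          using insert.hyps by (intro sum.cong) auto
        then show ?thesis by (simp add: dot_ins sum_distrib_left dot_def)
      qed
      have b: "(0::rat) < of_int b" using ab(2) by simp
      have "0 < dot (insert q P) d ?v" if dS: "d \<in> S" for d
      proof -
        consider "d q = 0" | "d \<in> Pos" | "d \<in> Neg"
          using dS unfolding Pos_def Neg_def by (cases "d q" "0 :: int" rule: linorder_cases) auto
        then show ?thesis
        proof cases
          case 1
          then have "0 < dot P d v" using dS by (intro v) (auto simp: S'_def)
          with 1 ab show ?thesis by (simp add: dv)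
        next
          case 2
          then have "(0::rat) < of_int (d q)" by (simp add: Pos_def)
          moreover have "- rat_of_int (dot P d v) / of_int (d q) < of_int a / of_int b"
            using t(1)[OF 2] unfolding r_def ab(1) .
          ultimately have "(0::rat) < of_int (d q) * of_int a + of_int b * of_int (dot P d v)"
            using b by (simp add: field_simps)
          then have "(0::rat) < of_int (d q * a + b * dot P d v)" by simp
          then show ?thesis unfolding dv by (simp only: of_int_0_less_iff)
        next
          case 3
          then have "of_int (d q) < (0::rat)" by (simp add: Neg_def)
          moreover have "of_int a / of_int b < - rat_of_int (dot P d v) / of_int (d q)"
            using t(2)[OF 3] unfolding r_def ab(1) .
          ultimately have "(0::rat) < of_int (d q) * of_int a + of_int b * of_int (dot P d v)"
            using b by (simp add: field_simps)
          then have "(0::rat) < of_int (d q * a + b * dot P d v)" by simp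
          then show ?thesis unfolding dv by (simp only: of_int_0_less_iff)
        qed
      qed
      then show ?thesis by blast
    qed
  qed
qed

section \<open>Small integer kernel vectors and extreme rays of cones\<close>

lemma siegel:
  fixes a :: "'r \<Rightarrow> 'c \<Rightarrow> int"
  assumes "finite R" "finite C" "card R < card C"
    and M: "\<And>r. r \<in> R \<Longrightarrow> (\<Sum>c\<in>C. \<bar>a r c\<bar>) \<le> int M"
  shows "\<exists>u. (\<exists>c\<in>C. u c \<noteq> 0) \<and> (\<forall>r\<in>R. dot C (a r) u = 0) \<and> (\<forall>c\<in>C. \<bar>u c\<bar> \<le> (2 * int M + 1) ^ card C)"
proof -
  \<comment> \<open>The box has \<open>(B + 1) ^ card C\<close> points and its image at most
    \<open>(2 * M * B + 1) ^ card R\<close>. The first number wins because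
    \<open>(2 * M + 1) ^ (card C - 1) < B + 1\<close>.\<close>
  define B where "B = (2 * M + 1) ^ card C"
  define Dom where "Dom = C \<rightarrow>\<^sub>E {0..int B}"
  define Cod where "Cod = R \<rightarrow>\<^sub>E {- int (M * B)..int (M * B)}"
  define \<phi> where "\<phi> = (\<lambda>x. restrict (\<lambda>r. dot C (a r) x) R)"
  have "card Cod = (2 * M * B + 1) ^ card R"
    using assms(1) unfolding Cod_def by (subst card_PiE) (auto simp: nat_add_distrib nat_mult_distrib mult_ac)
  also have "\<dots> \<le> (2 * M * B + 1) ^ (card C - 1)"
    using assms(3) by (intro power_increasing) auto
  also have "\<dots> \<le> ((2 * M + 1) * (B + 1)) ^ (card C - 1)"
    by (intro power_mono) (auto simp: algebra_simps)
  also have "\<dots> = (2 * M + 1) ^ (card C - 1) * (B + 1) ^ (card C - 1)"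
    by (rule power_mult_distrib)
  also have "\<dots> < (B + 1) * (B + 1) ^ (card C - 1)"
  proof -
    have "(2 * M + 1) ^ (card C - 1) \<le> B"
      unfolding B_def by (intro power_increasing) auto
    then show ?thesis by (intro mult_strict_right_mono) auto
  qed
  also have "\<dots> = (B + 1) ^ card C"
    using assms(3) by (metis Suc_diff_1 gr_implies_not0 neq0_conv power_Suc)
  also have "\<dots> = card Dom"
    using assms(2) unfolding Dom_def by (subst card_PiE) (auto simp: nat_add_distrib)
  finally have card: "card Cod < card Dom" .
  have "\<phi> ` Dom \<subseteq> Cod"
  proof
    fix y assume "y \<in> \<phi> ` Dom"
    then obtain x where x: "x \<in> Dom" "y = \<phi> x" by blast
    have "\<bar>dot C (a r) x\<bar> \<le> int (M * B)" if "r \<in> R" for r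
    proof -
      have "\<bar>dot C (a r) x\<bar> \<le> (\<Sum>c\<in>C. \<bar>a r c * x c\<bar>)"
        unfolding dot_def by (rule sum_abs)
      also have "\<dots> \<le> (\<Sum>c\<in>C. \<bar>a r c\<bar> * int B)"
      proof (rule sum_mono)
        fix c assume "c \<in> C"
        then have "x c \<in> {0..int B}" using x(1) by (auto simp: Dom_def)
        then show "\<bar>a r c * x c\<bar> \<le> \<bar>a r c\<bar> * int B" by (auto simp: abs_mult intro: mult_left_mono)
      qed
      also have "\<dots> \<le> int M * int B"
        unfolding sum_distrib_right[symmetric] by (intro mult_right_mono M that) auto
      finally show ?thesis by simp
    qed
    then show "y \<in> Cod" unfolding x(2) \<phi>_def Cod_def by (fastforce simp: abs_le_iff)
  qed
  moreover have "finite Cod" using assms(1) by (auto simp: Cod_def intro: finite_PiE)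
  ultimately have "card (\<phi> ` Dom) < card Dom"
    using card card_mono[of Cod "\<phi> ` Dom"] by linarith
  then have "\<not> inj_on \<phi> Dom" using card_image by fastforce
  \<comment> \<open>Two colliding points differ by a kernel vector; since the box starts at
    \<open>0\<close>, its entries are at most \<open>B\<close> in absolute value.\<close>
  then obtain x y where xy: "x \<in> Dom" "y \<in> Dom" "\<phi> x = \<phi> y" "x \<noteq> y"
    by (auto simp: inj_on_def)
  have "\<exists>c\<in>C. x c \<noteq> y c"
    using xy PiE_ext unfolding Dom_def by metis
  moreover have "dot C (a r) (\<lambda>c. x c - y c) = 0" if "r \<in> R" for r
  proof -
    have "dot C (a r) x = dot C (a r) y"
      using fun_cong[OF xy(3), of r] that by (simp add: \<phi>_def)
    then show ?thesis by (simp add: dot_def right_diff_distrib sum_subtractf)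
  qed
  moreover have "\<bar>x c - y c\<bar> \<le> (2 * int M + 1) ^ card C" if "c \<in> C" for c
  proof -
    have "x c \<in> {0..int B}" "y c \<in> {0..int B}" using xy that by (auto simp: Dom_def)
    then have "\<bar>x c - y c\<bar> \<le> int B" by auto
    then show ?thesis by (simp add: B_def add.commute)
  qed
  ultimately show ?thesis by (intro exI[of _ "\<lambda>c. x c - y c"]) auto
qed


text \<open>The vectors \<open>u j\<close> form a dual system to \<open>J\<close> and
  \<open>w\<close> is killed by all of \<open>J\<close>, so these \<open>card J + 1\<close> vectors
  are linearly independent. Here \<open>siegel\<close> only serves to produce a nontrivial relation
  among too many vectors; any finite entry bound will do.\<close>

lemma rank_bound:
  fixes w :: "'p \<Rightarrow> int"
  assumes "finite P" "finite J" "\<exists>p\<in>P. w p \<noteq> 0"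
    and w: "\<And>g. g \<in> J \<Longrightarrow> dot P g w = 0"
    and u: "\<And>j g. j \<in> J \<Longrightarrow> g \<in> J \<Longrightarrow> dot P g (u j) = 0 \<longleftrightarrow> g \<noteq> j"
  shows "card J < card P"
proof (rule ccontr)
  assume "\<not> ?thesis"
  define C where "C = insert None (Some ` J)"
  define a where "a = (\<lambda>p c. case c of None \<Rightarrow> w p | Some j \<Rightarrow> u j p)"
  have C: "finite C" "card C = Suc (card J)"
    using assms(2) by (auto simp: C_def card_image)
  have "(\<Sum>c\<in>C. \<bar>a p c\<bar>) \<le> int (nat (\<Sum>p\<in>P. \<Sum>c\<in>C. \<bar>a p c\<bar>))" if "p \<in> P" for p
    using member_le_sum[OF that, of "\<lambda>p. \<Sum>c\<in>C. \<bar>a p c\<bar>"] assms(1)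
    by (simp add: sum_nonneg)
  from siegel[of P C a, OF assms(1) C(1) _ this] \<open>\<not> ?thesis\<close> C(2)
  obtain z where z: "\<exists>c\<in>C. z c \<noteq> 0" "\<And>p. p \<in> P \<Longrightarrow> dot C (a p) z = 0" by auto
  have dotC: "dot C (a p) z = w p * z None + (\<Sum>j\<in>J. u j p * z (Some j))" for p
    using assms(2) by (simp add: dot_def C_def a_def sum.reindex)
  \<comment> \<open>Pairing the relation with \<open>g\<close> removes \<open>w\<close> and every
    \<open>u j\<close> except \<open>u g\<close>.\<close>
  have zero: "z (Some g) = 0" if "g \<in> J" for g
  proof -
    have "0 = (\<Sum>p\<in>P. g p * dot C (a p) z)" using z(2) by simp
    also have "\<dots> = z None * dot P g w + (\<Sum>j\<in>J. z (Some j) * dot P g (u j))"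
      unfolding dotC unfolding distrib_left sum.distrib sum_distrib_left dot_def
      by (subst (2) sum.swap) (simp add: mult_ac)
    also have "(\<Sum>j\<in>J. z (Some j) * dot P g (u j)) = (\<Sum>j\<in>J. if j = g then z (Some g) * dot P g (u g) else 0)"
      using u[OF _ that] by (intro sum.cong) auto
    also have "\<dots> = z (Some g) * dot P g (u g)" using assms(2) that by simp
    finally have "z (Some g) * dot P g (u g) = 0" using w[OF that] by simp
    with u[OF that that] show ?thesis by auto
  qed
  then have "z None \<noteq> 0" using z(1) by (auto simp: C_def)
  moreover have "w p * z None = 0" if "p \<in> P" for p
    using z(2)[OF that] zero unfolding dotC by simp
  ultimately show False using assms(3) by auto
qed

text \<open>Otherwise one could walk from \<open>w\<close> inside the cone, keeping \<open>l\<close>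
  negative and the tight constraints tight, until a further constraint becomes tight.\<close>

lemma tight_point_spans:
  fixes G :: "('p \<Rightarrow> int) set"
  assumes "finite P" "finite G"
    and pointed: "\<And>u. (\<forall>g\<in>G. dot P g u = 0) \<Longrightarrow> \<forall>p\<in>P. u p = 0"
    and w: "\<And>g. g \<in> G \<Longrightarrow> 0 \<le> dot P g w" "dot P l w < 0"
    and maximal: "\<And>z. (\<forall>g\<in>G. 0 \<le> dot P g z) \<Longrightarrow> dot P l z < 0 \<Longrightarrow>
       card {g \<in> G. dot P g z = 0} \<le> card {g \<in> G. dot P g w = 0}"
    and u: "\<forall>g\<in>G. dot P g w = 0 \<longrightarrow> dot P g u = 0"
  shows "\<forall>p\<in>P. dot P l w * u p = dot P l u * w p"
proof -
  have False if x: "dot P l x = 0" "\<forall>g\<in>G. dot P g w = 0 \<longrightarrow> dot P g x = 0"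
    "\<exists>g\<in>G. dot P g x < 0" for x
  proof -
    \<comment> \<open>Ratio test of the simplex method: \<open>r g\<close> is the distance along
      \<open>x\<close> at which \<open>g\<close> becomes tight, and \<open>g0\<close> is hit first.
      The point \<open>z\<close> reached there is scaled to be integral.\<close>
    define r where "r = (\<lambda>g. (of_int (dot P g w) :: rat) / of_int (- dot P g x))"
    have "finite {g \<in> G. dot P g x < 0}" "{g \<in> G. dot P g x < 0} \<noteq> {}"
      using assms(2) x(3) by auto
    from arg_min_if_finite(1)[OF this, of r] arg_min_least[OF this, of _ r]
    obtain g0 where g0: "g0 \<in> G" "dot P g0 x < 0"
      "\<And>g. g \<in> G \<Longrightarrow> dot P g x < 0 \<Longrightarrow> r g0 \<le> r g" by auto
    define z where "z = (\<lambda>p. (- dot P g0 x) * w p + dot P g0 w * x p)"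
    have dz: "dot P g z = (- dot P g0 x) * dot P g w + dot P g0 w * dot P g x" for g
      unfolding z_def by (rule dot_lin)
    have "0 \<le> dot P g z" if "g \<in> G" for g
    proof (cases "dot P g x < 0")
      case False
      then have "0 \<le> (- dot P g0 x) * dot P g w" "0 \<le> dot P g0 w * dot P g x"
        using w(1)[OF that] w(1)[OF g0(1)] g0(2) by (auto intro: mult_nonneg_nonneg mult_nonpos_nonneg)
      then show ?thesis by (simp add: dz)
    next
      case True
      have "(of_int (dot P g x) :: rat) < 0" "(of_int (dot P g0 x) :: rat) < 0"
        using True g0(2) by auto
      with g0(3)[OF that True]
      have "(0 :: rat) \<le> (- of_int (dot P g0 x)) * of_int (dot P g w) + of_int (dot P g0 w) * of_int (dot P g x)"
        by (simp add: r_def field_simps)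
      then have "(0 :: rat) \<le> of_int (dot P g z)" by (simp add: dz)
      then show ?thesis by (simp only: of_int_0_le_iff)
    qed
    moreover have "dot P l z < 0" using x(1) w(2) g0(2) by (simp add: dz mult_neg_neg)
    ultimately have le: "card {g \<in> G. dot P g z = 0} \<le> card {g \<in> G. dot P g w = 0}"
      using maximal by blast
    have "{g \<in> G. dot P g w = 0} \<subseteq> {g \<in> G. dot P g z = 0}" using x(2) by (auto simp: dz)
    moreover have "g0 \<in> {g \<in> G. dot P g z = 0}" using g0 by (simp add: dz)
    moreover have "g0 \<notin> {g \<in> G. dot P g w = 0}" using g0 x(2) by auto
    ultimately have "{g \<in> G. dot P g w = 0} \<subset> {g \<in> G. dot P g z = 0}" by blast
    from psubset_card_mono[OF _ this] assms(2) le show False by simp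
  qed note no = this
  \<comment> \<open>The part of \<open>u\<close> on which \<open>l\<close> vanishes, after
    subtracting a multiple of \<open>w\<close>. Since neither \<open>x\<close> nor its negative can
    decrease a constraint, all constraints vanish on \<open>x\<close>.\<close>
  define x where "x = (\<lambda>p. dot P l w * u p + (- dot P l u) * w p)"
  have dx: "dot P g x = dot P l w * dot P g u + (- dot P l u) * dot P g w" for g
    unfolding x_def by (rule dot_lin)
  have neg: "dot P g (\<lambda>p. - x p) = - dot P g x" for g by (simp add: dot_def sum_negf)
  have "dot P g x = 0" if "g \<in> G" for g
    using no[of x] no[of "\<lambda>p. - x p"] that u unfolding neg by (force simp: dx)
  then have "\<forall>p\<in>P. x p = 0" using pointed by blast
  then show ?thesis by (simp add: x_def)
qed

text \<open>A point with as many tight constraints as possible spans a ray cut out by fewer than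
  \<open>card P\<close> equations with small coefficients; \<open>siegel\<close> finds a small point
  of that ray.\<close>

theorem small_cone_point:
  fixes G :: "('p \<Rightarrow> int) set"
  assumes "finite P" "finite G" "1 \<le> M"
    and M: "\<And>g. g \<in> G \<Longrightarrow> (\<Sum>p\<in>P. \<bar>g p\<bar>) \<le> int M"
    and w: "\<And>g. g \<in> G \<Longrightarrow> 0 \<le> dot P g w" "dot P l w < 0"
  shows "\<exists>v. (\<forall>g\<in>G. 0 \<le> dot P g v) \<and> dot P l v < 0 \<and> (\<forall>p\<in>P. \<bar>v p\<bar> \<le> (2 * int M + 1) ^ card P)"
proof -
  \<comment> \<open>Sign constraints of the orthant containing \<open>w\<close>. They make the cone
    pointed, at no cost in the coefficient bound, as each row has norm \<open>1\<close>.\<close>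
  define e where "e = (\<lambda>p q. if q = p then (if 0 \<le> w p then 1 else -1 :: int) else 0)"
  define G' where "G' = G \<union> e ` P"
  have de: "dot P (e p) z = (if 0 \<le> w p then z p else - z p)" if "p \<in> P" for p z
  proof -
    have "dot P (e p) z = (\<Sum>q\<in>P. if q = p then (if 0 \<le> w p then z p else - z p) else 0)"
      unfolding dot_def e_def by (intro sum.cong) auto
    then show ?thesis using that assms(1) by simp
  qed
  have fin: "finite G'" using assms by (simp add: G'_def)
  have M': "(\<Sum>p\<in>P. \<bar>g p\<bar>) \<le> int M" if "g \<in> G'" for g
  proof -
    have "(\<Sum>p\<in>P. \<bar>e q p\<bar>) = 1" if "q \<in> P" for q
    proof -
      have "(\<Sum>p\<in>P. \<bar>e q p\<bar>) = (\<Sum>p\<in>P. if p = q then 1 else 0)"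
        by (intro sum.cong) (auto simp: e_def)
      then show ?thesis using that assms(1) by simp
    qed
    then show ?thesis using that M \<open>1 \<le> M\<close> by (auto simp: G'_def)
  qed
  have pointed: "\<forall>p\<in>P. u p = 0" if "\<forall>g\<in>G'. dot P g u = 0" for u
  proof
    fix p assume "p \<in> P"
    then show "u p = 0" using that de[of p u] by (auto simp: G'_def split: if_splits)
  qed
  define ok where "ok = (\<lambda>z. (\<forall>g\<in>G'. 0 \<le> dot P g z) \<and> dot P l z < 0)"
  have "ok w" using w de by (auto simp: ok_def G'_def)
  moreover have "\<forall>z. ok z \<longrightarrow> card {g \<in> G'. dot P g z = 0} < Suc (card G')"
    using fin by (auto simp: less_Suc_eq_le intro: card_mono)
  ultimately obtain w' where w': "ok w'"
    "\<And>z. ok z \<Longrightarrow> card {g \<in> G'. dot P g z = 0} \<le> card {g \<in> G'. dot P g w' = 0}"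
    using ex_has_greatest_nat[of ok w "\<lambda>z. card {g \<in> G'. dot P g z = 0}"] by blast
  have w'0: "dot P l w' < 0" "\<And>g. g \<in> G' \<Longrightarrow> 0 \<le> dot P g w'" using w'(1) by (auto simp: ok_def)
  define I where "I = {g \<in> G'. dot P g w' = 0}"
  \<comment> \<open>The kernel of \<open>J\<close> lies on the line through \<open>w'\<close>,
    written as a cross-multiplied proportion with \<open>l\<close> as the yardstick.\<close>
  define spans where "spans = (\<lambda>J. \<forall>u. (\<forall>g\<in>J. dot P g u = 0) \<longrightarrow> (\<forall>p\<in>P. dot P l w' * u p = dot P l u * w' p))"
  have "spans I"
    unfolding spans_def
  proof (intro allI impI)
    fix u assume "\<forall>g\<in>I. dot P g u = 0"
    then show "\<forall>p\<in>P. dot P l w' * u p = dot P l u * w' p"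
      using w'0 w'(2) by (intro tight_point_spans[OF assms(1) fin pointed]) (auto simp: ok_def I_def)
  qed
  \<comment> \<open>By minimality every constraint in \<open>J\<close> is indispensable. Dropping
    \<open>j\<close> admits a vector off the line, and these vectors form the dual system required
    by \<open>rank_bound\<close>.\<close>
  then obtain J where J: "J \<subseteq> I" "spans J" "\<And>K. K \<subseteq> I \<Longrightarrow> spans K \<Longrightarrow> card J \<le> card K"
    using ex_has_least_nat[of "\<lambda>J. J \<subseteq> I \<and> spans J" I card] by blast
  have finJ: "finite J" using J(1) fin by (auto simp: I_def intro: finite_subset)
  have "\<exists>u. \<forall>g\<in>J. dot P g u = 0 \<longleftrightarrow> g \<noteq> j" if "j \<in> J" for j
  proof -
    have "card (J - {j}) < card J" using finJ that by (intro psubset_card_mono) auto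
    then have "\<not> spans (J - {j})" using J(1) J(3)[of "J - {j}"] by fastforce
    then obtain u where u: "\<forall>g\<in>J - {j}. dot P g u = 0" "\<not> (\<forall>p\<in>P. dot P l w' * u p = dot P l u * w' p)"
      unfolding spans_def by blast
    with J(2) have "dot P j u \<noteq> 0" unfolding spans_def by (metis Diff_iff empty_iff insert_iff)
    with u(1) show ?thesis by (intro exI[of _ u]) auto
  qed
  then obtain u where u: "\<And>j g. j \<in> J \<Longrightarrow> g \<in> J \<Longrightarrow> dot P g (u j) = 0 \<longleftrightarrow> g \<noteq> j" by metis
  have "\<exists>p\<in>P. w' p \<noteq> 0"
  proof (rule ccontr)
    assume "\<not> ?thesis"
    then have "dot P l w' = 0" by (simp add: dot_def)
    with w'0 show False by simp
  qed
  from rank_bound[OF assms(1) finJ this _ u] J(1) have "card J < card P"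
    by (auto simp: I_def)
  moreover have "(\<Sum>p\<in>P. \<bar>g p\<bar>) \<le> int M" if "g \<in> J" for g
    using that J(1) M' by (auto simp: I_def)
  ultimately obtain z where z: "\<exists>p\<in>P. z p \<noteq> 0" "\<And>g. g \<in> J \<Longrightarrow> dot P g z = 0"
    "\<And>p. p \<in> P \<Longrightarrow> \<bar>z p\<bar> \<le> (2 * int M + 1) ^ card P"
    using siegel[OF finJ assms(1), of "\<lambda>g. g" M] by blast
  have zw: "dot P l w' * z p = dot P l z * w' p" if "p \<in> P" for p
    using J(2) z(2) that by (simp add: spans_def)
  have nz: "dot P l z \<noteq> 0" using z(1) zw w'0(1) by auto
  \<comment> \<open>The kernel vector \<open>z\<close> may point opposite to \<open>w'\<close>;
    \<open>s\<close> turns it to the side where \<open>l\<close> is negative.\<close>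
  define s :: int where "s = (if dot P l z < 0 then 1 else -1)"
  define v where "v = (\<lambda>p. s * z p)"
  have dv: "dot P g v = s * dot P g z" for g
    by (simp add: v_def dot_def sum_distrib_left mult_ac)
  have lv: "dot P l v < 0" using nz by (auto simp: dv s_def)
  have "0 \<le> dot P g v" if "g \<in> G" for g
  proof -
    \<comment> \<open>Both \<open>dot P l w'\<close> and \<open>dot P l v\<close> are negative, so
      proportionality carries the sign of \<open>g\<close> over from \<open>w'\<close> to
      \<open>v\<close>.\<close>
    have "dot P l w' * dot P g v = s * (dot P g (\<lambda>p. dot P l w' * z p + 0 * z p))"
      unfolding dv by (subst dot_lin) simp
    also have "dot P g (\<lambda>p. dot P l w' * z p + 0 * z p) = dot P g (\<lambda>p. dot P l z * w' p + 0 * w' p)"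
      by (intro dot_cong) (simp add: zw)
    also have "s * \<dots> = dot P l v * dot P g w'" unfolding dv by (subst dot_lin) simp
    also have "\<dots> \<le> 0" using lv w'0(2)[of g] that by (simp add: G'_def mult_nonpos_nonneg)
    finally show ?thesis using w'0(1) by (simp add: mult_le_0_iff)
  qed
  with lv z(3) show ?thesis by (intro exI[of _ v]) (auto simp: v_def s_def abs_mult)
qed

section \<open>Small countermodels\<close>

primrec vars :: "fm \<Rightarrow> nat set" where
  "vars (Var p) = {p}"
| "vars Const_t = {}"
| "vars (Neg A) = vars A"
| "vars (Plus A B) = vars A \<union> vars B"
| "vars (Imp A B) = vars A \<union> vars B"
| "vars (RImp A B) = vars A \<union> vars B"

primrec leaves :: "fm \<Rightarrow> nat" where
  "leaves (Var p) = 1"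
| "leaves Const_t = 1"
| "leaves (Neg A) = leaves A"
| "leaves (Plus A B) = leaves A + leaves B"
| "leaves (Imp A B) = leaves A + leaves B"
| "leaves (RImp A B) = leaves A + leaves B"

lemma finite_vars [simp]: "finite (vars A)"
  by (induction A) auto

lemma card_vars_le: "card (vars A) \<le> leaves A"
  by (induction A) (auto intro: order_trans[OF card_Un_le])

lemma leaves_pos: "1 \<le> leaves A"
  by (induction A) auto

lemma val_cong: "(\<And>p. p \<in> vars A \<Longrightarrow> v p = w p) \<Longrightarrow> val v A = val w A"
  by (induction A) simp_all

text \<open>\<open>F\<close> agrees with the form \<open>l\<close> on a cone containing
  \<open>v0\<close>. The number \<open>n\<close> bounds sums of absolute coefficients because this
  is the quantity that enters \<open>siegel\<close>, and it adds up over subformulas.\<close>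

definition linear_on :: "nat set \<Rightarrow> (nat \<Rightarrow> int) \<Rightarrow> nat \<Rightarrow> ((nat \<Rightarrow> int) \<Rightarrow> int) \<Rightarrow> (nat \<Rightarrow> int) set \<Rightarrow> (nat \<Rightarrow> int) \<Rightarrow> bool" where
  "linear_on P v0 n F G l \<longleftrightarrow> finite G \<and> (\<forall>g\<in>insert l G. (\<Sum>p\<in>P. \<bar>g p\<bar>) \<le> int n) \<and>
    (\<forall>g\<in>G. 0 \<le> dot P g v0) \<and> (\<forall>v. (\<forall>g\<in>G. 0 \<le> dot P g v) \<longrightarrow> F v = dot P l v)"

lemma linear_on_combine:
  assumes "linear_on P v0 m F G l" "linear_on P v0 n F' G' l'" "\<bar>a\<bar> \<le> 1" "\<bar>b\<bar> \<le> 1"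
  shows "linear_on P v0 (m + n) (\<lambda>v. a * F v + b * F' v) (G \<union> G') (\<lambda>p. a * l p + b * l' p)"
proof -
  have "(\<Sum>p\<in>P. \<bar>a * l p + b * l' p\<bar>) \<le> (\<Sum>p\<in>P. \<bar>l p\<bar> + \<bar>l' p\<bar>)"
  proof (rule sum_mono)
    fix p
    have "\<bar>a * l p\<bar> \<le> 1 * \<bar>l p\<bar>" "\<bar>b * l' p\<bar> \<le> 1 * \<bar>l' p\<bar>"
      unfolding abs_mult using assms(3,4) by (intro mult_right_mono; simp)+
    then show "\<bar>a * l p + b * l' p\<bar> \<le> \<bar>l p\<bar> + \<bar>l' p\<bar>" by linarith
  qed
  also have "\<dots> \<le> int (m + n)"
    using assms(1,2) by (simp add: linear_on_def sum.distrib)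
  finally have "(\<Sum>p\<in>P. \<bar>a * l p + b * l' p\<bar>) \<le> int (m + n)" .
  moreover have "dot P (\<lambda>p. a * l p + b * l' p) v = a * dot P l v + b * dot P l' v" for v
    by (subst (1 2 3) dot_commute) (rule dot_lin)
  ultimately show ?thesis
    using assms(1,2) by (fastforce simp: linear_on_def)
qed

text \<open>On the cone where every minimum is attained at the same argument as at \<open>v0\<close>, the value is
  linear.\<close>

lemma val_linearise:
  assumes "finite P" "vars A \<subseteq> P"
  shows "\<exists>G l. linear_on P v0 (leaves A) (\<lambda>v. val v A) G l"
  using assms(2)
proof (induction A)
  case (Var p)
  define l where "l = (\<lambda>q. if q = p then 1 else 0 :: int)"
  have "dot P l v = (\<Sum>q\<in>P. if q = p then v q else 0)" for v
    unfolding dot_def l_def by (intro sum.cong) auto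
  then have "dot P l v = v p" for v using Var assms(1) by simp
  moreover have "(\<Sum>p\<in>P. \<bar>l p\<bar>) = (\<Sum>q\<in>P. if q = p then 1 else 0)"
    by (intro sum.cong) (auto simp: l_def)
  ultimately show ?case using Var assms(1)
    by (intro exI[of _ "{}"] exI[of _ l]) (auto simp: linear_on_def)
next
  case Const_t
  show ?case by (intro exI[of _ "{}"] exI[of _ "\<lambda>_. 0"]) (simp add: dot_def linear_on_def)
next
  case (Neg A)
  then obtain G l where "linear_on P v0 (leaves A) (\<lambda>v. val v A) G l" by auto
  moreover have "linear_on P v0 0 (\<lambda>_. 0) {} (\<lambda>_. 0)" by (simp add: linear_on_def dot_def)
  ultimately show ?case using linear_on_combine[of P v0 "leaves A" _ G l 0 _ _ _ "-1" 0] by fastforce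
next
  case (Plus A B)
  then obtain G l G' l' where "linear_on P v0 (leaves A) (\<lambda>v. val v A) G l"
    "linear_on P v0 (leaves B) (\<lambda>v. val v B) G' l'" by auto
  from linear_on_combine[OF this, of 1 1] show ?case by auto
next
  case (Imp A B)
  then obtain G l G' l' where "linear_on P v0 (leaves A) (\<lambda>v. val v A) G l"
    "linear_on P v0 (leaves B) (\<lambda>v. val v B) G' l'" by auto
  from linear_on_combine[OF this, of "-1" 1] show ?case by auto
next
  case (RImp A B)
  then obtain G l G' l' where l: "linear_on P v0 (leaves A) (\<lambda>v. val v A) G l"
    "linear_on P v0 (leaves B) (\<lambda>v. val v B) G' l'" by auto
  define n where "n = leaves A + leaves B"
  define d where "d = (\<lambda>p. - 1 * l p + 1 * l' p)"
  define e where "e = (\<lambda>p. 1 * l p + - 1 * l' p)"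
  have D: "linear_on P v0 n (\<lambda>v. - 1 * val v A + 1 * val v B) (G \<union> G') d"
    unfolding d_def n_def by (intro linear_on_combine l) auto
  have E: "linear_on P v0 n (\<lambda>v. 1 * val v A + - 1 * val v B) (G \<union> G') e"
    unfolding e_def n_def by (intro linear_on_combine l) auto
  have G: "finite (G \<union> G')" "\<And>g. g \<in> G \<union> G' \<Longrightarrow> 0 \<le> dot P g v0 \<and> (\<Sum>p\<in>P. \<bar>g p\<bar>) \<le> int n"
    using D by (auto simp: linear_on_def)
  have d0: "\<And>v. \<forall>g\<in>G \<union> G'. 0 \<le> dot P g v \<Longrightarrow> val v B - val v A = dot P d v" "(\<Sum>p\<in>P. \<bar>d p\<bar>) \<le> int n"
    using D by (auto simp: linear_on_def)
  have e0: "\<And>v. \<forall>g\<in>G \<union> G'. 0 \<le> dot P g v \<Longrightarrow> val v A - val v B = dot P e v" "(\<Sum>p\<in>P. \<bar>e p\<bar>) \<le> int n"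
    using E by (auto simp: linear_on_def)
  have v0: "\<forall>g\<in>G \<union> G'. 0 \<le> dot P g v0" using G(2) by blast
  show ?case
  \<comment> \<open>Each minimum contributes one constraint, \<open>d\<close> or \<open>e\<close>,
    recording which argument is attained at \<open>v0\<close>. The inequality is weak, which
    suffices since the two arguments agree on the boundary.\<close>
  proof (cases "val v0 A \<le> val v0 B")
    case True
    then have nonneg: "0 \<le> dot P d v0" using d0(1)[OF v0] by linarith
    have lin: "min 0 (val v B - val v A) = dot P (\<lambda>_. 0) v"
      if "\<forall>g\<in>insert d (G \<union> G'). 0 \<le> dot P g v" for v
    proof -
      have "val v B - val v A = dot P d v" "0 \<le> dot P d v" using that by (auto intro!: d0(1))
      then show ?thesis by (simp add: dot_def)
    qed
    have "linear_on P v0 n (\<lambda>v. val v (RImp A B)) (insert d (G \<union> G')) (\<lambda>_. 0)"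
      unfolding linear_on_def val.simps
    proof (intro conjI allI impI)
      show "\<forall>g\<in>insert (\<lambda>_. 0) (insert d (G \<union> G')). (\<Sum>p\<in>P. \<bar>g p\<bar>) \<le> int n"
        using G(2) d0(2) by auto
    qed (use G nonneg lin in auto)
    then show ?thesis by (auto simp: n_def)
  next
    case False
    then have nonneg: "0 \<le> dot P e v0" using e0(1)[OF v0] by linarith
    have lin: "min 0 (val v B - val v A) = dot P d v"
      if "\<forall>g\<in>insert e (G \<union> G'). 0 \<le> dot P g v" for v
    proof -
      have "val v B - val v A = dot P d v" "val v A - val v B = dot P e v" "0 \<le> dot P e v"
        using that by (auto intro!: d0(1) e0(1))
      then show ?thesis by linarith
    qed
    have "linear_on P v0 n (\<lambda>v. val v (RImp A B)) (insert e (G \<union> G')) d"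
      unfolding linear_on_def val.simps
    proof (intro conjI allI impI)
      show "\<forall>g\<in>insert d (insert e (G \<union> G')). (\<Sum>p\<in>P. \<bar>g p\<bar>) \<le> int n"
        using G(2) d0(2) e0(2) by auto
    qed (use G nonneg lin in auto)
    then show ?thesis by (auto simp: n_def)
  qed
qed

text \<open>The refuting valuation fixes the cone and the form \<open>l\<close>. Any point of the
  cone where \<open>l\<close> is negative refutes as well, because the value is still
  \<open>l\<close> there.\<close>

theorem small_countermodel:
  assumes "val v0 A < 0"
  shows "\<exists>v. val v A < 0 \<and> (\<forall>p\<in>vars A. \<bar>v p\<bar> \<le> (2 * int (leaves A) + 1) ^ leaves A)"
proof -
  obtain G l where Gl: "linear_on (vars A) v0 (leaves A) (\<lambda>v. val v A) G l"
    using val_linearise[of "vars A" A v0] by auto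
  have "dot (vars A) l v0 < 0" using Gl assms unfolding linear_on_def by metis
  then obtain v where v: "\<forall>g\<in>G. 0 \<le> dot (vars A) g v" "dot (vars A) l v < 0"
    "\<And>p. p \<in> vars A \<Longrightarrow> \<bar>v p\<bar> \<le> (2 * int (leaves A) + 1) ^ card (vars A)"
    using small_cone_point[of "vars A" G "leaves A" v0 l] Gl leaves_pos[of A]
    unfolding linear_on_def by auto
  have "val v A < 0" using Gl v unfolding linear_on_def by simp
  moreover have "(2 * int (leaves A) + 1) ^ card (vars A) \<le> (2 * int (leaves A) + 1) ^ leaves A"
    by (intro power_increasing card_vars_le) auto
  ultimately show ?thesis using v(3) by (meson order_trans)
qed

section \<open>Completeness of the calculus\<close>

text \<open>\<open>Const_t\<close> has weight \<open>1\<close> and \<open>Var\<close> weight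
  \<open>0\<close>: only variables may survive in a success axiom, and every rule must lower the
  total weight from conclusion to premise.\<close>

primrec cplx :: "fm \<Rightarrow> nat" where
  "cplx (Var p) = 0"
| "cplx Const_t = 1"
| "cplx (Neg A) = Suc (cplx A)"
| "cplx (Plus A B) = Suc (cplx A + cplx B)"
| "cplx (Imp A B) = Suc (cplx A + cplx B)"
| "cplx (RImp A B) = Suc (cplx A + cplx B)"

section \<open>Changing labellings and inverting the rules\<close>

lemma finite_atoms: "finite (atoms x)"
  by (induction x) auto

lemma finite_atoms_of: "finite (atoms_of \<Gamma>)"
  by (auto simp: atoms_of_def finite_atoms)

text \<open>A labelling is the multiplicative extension of arbitrary
  \<open>0\<close>/\<open>1\<close> values on atoms, so one atom can be reset independently of the
  others.\<close>

lemma labelling_fresh: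
  assumes "labelling f" "b = 0 \<or> b = 1"
  obtains g where "labelling g" "g (Atom y) = b" "\<And>x. y \<notin> atoms x \<Longrightarrow> g x = f x"
proof
  define g where "g = rec_label 1 (\<lambda>n. if n = y then b else f (Atom n)) (\<lambda>_ _ (a::nat) b. a * b)"
  have g: "g Unit = 1" "g (Cat x z) = g x * g z" "g (Atom n) = (if n = y then b else f (Atom n))" for x z n
    by (auto simp: g_def)
  have "range g \<subseteq> {0, 1}"
  proof (rule image_subsetI)
    fix x
    have "g x = 0 \<or> g x = 1"
      using assms labelling_01[OF assms(1)] by (induction x) (auto simp: g)
    then show "g x \<in> {0, 1}" by simp
  qed
  then show "labelling g" by (simp add: labelling_def g)
  show "g (Atom y) = b" by (simp add: g)
  show "g x = f x" if "y \<notin> atoms x" for x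
    using that assms(1) by (induction x) (auto simp: g labelling_def)
qed

lemma mval_cong: "(\<And>x A. (x, A) \<in># \<Gamma> \<Longrightarrow> f x = g x) \<Longrightarrow> mval v f \<Gamma> = mval v g \<Gamma>"
  unfolding mval_def by (intro arg_cong[of _ _ sum_mset] image_mset_cong) auto

lemma mval_fresh:
  assumes "\<And>x. y \<notin> atoms x \<Longrightarrow> g x = f x" "y \<notin> atoms_of \<Gamma>"
  shows "mval v g \<Gamma> = mval v f \<Gamma>"
  using assms by (intro mval_cong) (fastforce simp: atoms_of_def)

text \<open>Each equivalence already holds for every single labelling. Read from left to right, it
  inverts the corresponding rule.\<close>

lemma valid_at_simps:
  "valid_at v (add_mset (x, Const_t) \<Gamma>) \<Delta> \<longleftrightarrow> valid_at v \<Gamma> \<Delta>"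
  "valid_at v \<Gamma> (add_mset (x, Const_t) \<Delta>) \<longleftrightarrow> valid_at v \<Gamma> \<Delta>"
  "valid_at v (add_mset (x, Neg A) \<Gamma>) \<Delta> \<longleftrightarrow> valid_at v \<Gamma> (add_mset (x, A) \<Delta>)"
  "valid_at v \<Gamma> (add_mset (x, Neg A) \<Delta>) \<longleftrightarrow> valid_at v (add_mset (x, A) \<Gamma>) \<Delta>"
  "valid_at v (add_mset (x, Plus A B) \<Gamma>) \<Delta> \<longleftrightarrow> valid_at v (add_mset (x, A) (add_mset (x, B) \<Gamma>)) \<Delta>"
  "valid_at v \<Gamma> (add_mset (x, Plus A B) \<Delta>) \<longleftrightarrow> valid_at v \<Gamma> (add_mset (x, A) (add_mset (x, B) \<Delta>))"
  "valid_at v (add_mset (x, Imp A B) \<Gamma>) \<Delta> \<longleftrightarrow> valid_at v (add_mset (x, B) \<Gamma>) (add_mset (x, A) \<Delta>)"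
  "valid_at v \<Gamma> (add_mset (x, Imp A B) \<Delta>) \<longleftrightarrow> valid_at v (add_mset (x, A) \<Gamma>) (add_mset (x, B) \<Delta>)"
  unfolding valid_at_def by (intro arg_cong[of _ _ Ex] ext conj_cong refl; auto)+

text \<open>The labelling of the conclusion serves both premises, because the minimum lies below
  \<open>0\<close> and below \<open>val v B - val v A\<close>.\<close>

lemma valid_at_RImp_r:
  assumes "valid_at v \<Gamma> (add_mset (x, RImp A B) \<Delta>)"
  shows "valid_at v (add_mset (x, A) \<Gamma>) (add_mset (x, B) \<Delta>)" "valid_at v \<Gamma> \<Delta>"
proof -
  obtain f where f: "labelling f" "mval v f \<Gamma> \<le> mval v f (add_mset (x, RImp A B) \<Delta>)"
    using assms by (auto simp: valid_at_def)
  from f(2) have "mval v f (add_mset (x, A) \<Gamma>) \<le> mval v f (add_mset (x, B) \<Delta>)" "mval v f \<Gamma> \<le> mval v f \<Delta>"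
    by (auto split: if_splits)
  with f(1) show "valid_at v (add_mset (x, A) \<Gamma>) (add_mset (x, B) \<Delta>)" "valid_at v \<Gamma> \<Delta>"
    unfolding valid_at_def by blast+
qed

lemma valid_at_RImp_l:
  assumes "valid_at v (add_mset (x, RImp A B) \<Gamma>) \<Delta>" "y \<notin> atoms x \<union> atoms_of \<Gamma> \<union> atoms_of \<Delta>"
  shows "valid_at v (add_mset (Cat x (Atom y), B) \<Gamma>) (add_mset (Cat x (Atom y), A) \<Delta>)"
proof -
  obtain f where f: "labelling f" "mval v f (add_mset (x, RImp A B) \<Gamma>) \<le> mval v f \<Delta>"
    using assms(1) by (auto simp: valid_at_def)
  \<comment> \<open>The fresh atom is switched on exactly when the minimum is
    \<open>val v B - val v A\<close>, and off when it is \<open>0\<close>. Freshness keeps the rest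
    of the sequent unaffected.\<close>
  define b :: nat where "b = (if val v B < val v A then 1 else 0)"
  have "b = 0 \<or> b = 1" by (simp add: b_def)
  then obtain g where g: "labelling g" "g (Atom y) = b" "\<And>x. y \<notin> atoms x \<Longrightarrow> g x = f x"
    using labelling_fresh[OF f(1)] by metis
  have "mval v g \<Gamma> = mval v f \<Gamma>" "mval v g \<Delta> = mval v f \<Delta>" "g x = f x"
    using assms(2) by (auto intro: mval_fresh g(3))
  with f(2) g(1,2) show ?thesis
    using labelling_01[OF f(1), of x]
    by (auto simp: valid_at_def labelling_Cat b_def split: if_splits intro!: exI[of _ g])
qed

section \<open>Success at valid atomic sequents\<close>

lemma select_cong: "(\<And>x A. (x, A) \<in># \<Gamma> \<Longrightarrow> f x = g x) \<Longrightarrow> select f \<Gamma> = select g \<Gamma>"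
  unfolding select_def by (intro arg_cong[of _ _ "image_mset snd"] filter_mset_cong) auto

lemma sum_mset_eq_sum:
  fixes h :: "'a \<Rightarrow> int"
  assumes "finite T" "set_mset M \<subseteq> T"
  shows "(\<Sum>A\<in>#M. h A) = (\<Sum>A\<in>T. int (count M A) * h A)"
  using assms(2)
proof (induction M)
  case (add a M)
  have "(\<Sum>A\<in>T. int (count (add_mset a M) A) * h A) =
    (\<Sum>A\<in>T. int (count M A) * h A + (if A = a then h a else 0))"
    by (intro sum.cong) (auto simp: algebra_simps)
  with add assms(1) show ?case by (simp add: sum.distrib)
qed simp

lemma sums_of_sum_list:
  assumes "e \<in> sums_of (d ` F)"
  shows "\<exists>fs. fs \<noteq> [] \<and> set fs \<subseteq> F \<and> e = (\<lambda>p. \<Sum>f\<leftarrow>fs. d f p)"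
  using assms
proof (induction rule: sums_of.induct)
  case (base e)
  then obtain f where "f \<in> F" "e = d f" by blast
  then show ?case by (intro exI[of _ "[f]"]) auto
next
  case (add e e')
  then obtain fs gs where "fs \<noteq> []" "set fs \<subseteq> F" "e = (\<lambda>p. \<Sum>f\<leftarrow>fs. d f p)"
    "set gs \<subseteq> F" "e' = (\<lambda>p. \<Sum>f\<leftarrow>gs. d f p)" by blast
  then show ?case by (intro exI[of _ "fs @ gs"]) auto
qed

text \<open>The occurrence differences \<open>d f\<close> cannot all be made positive by one
  valuation, as that would refute the sequent. Gordan then yields labellings whose differences sum
  to zero, which is the balance demanded by \<open>success\<close>.\<close>

lemma success_if_valid:
  assumes "atomic \<Gamma>" "atomic \<Delta>" "\<And>v. valid_at v \<Gamma> \<Delta>"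
  shows "\<Gamma> \<turnstile>\<^sub>l \<Delta>"
proof -
  define P where "P = {p. \<exists>x. (x, Var p) \<in># \<Gamma> + \<Delta>}"
  have "P \<subseteq> (\<lambda>(x, A). case A of Var p \<Rightarrow> p) ` set_mset (\<Gamma> + \<Delta>)" by (force simp: P_def)
  then have finP: "finite P" using finite_surj by blast
  define d where "d = (\<lambda>f p. int (count (select f \<Gamma>) (Var p)) - int (count (select f \<Delta>) (Var p)))"
  define S where "S = d ` {f. labelling f}"
  define L where "L = fst ` set_mset (\<Gamma> + \<Delta>)"
  have finS: "finite S"
  proof -
    \<comment> \<open>There are infinitely many labellings, but \<open>d f\<close> depends only on
      the values at the finitely many labels of the sequent; \<open>gordan\<close> needs this
      finiteness.\<close>
    have "d f \<in> d ` (L \<rightarrow>\<^sub>E {0, 1})" if "labelling f" for f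
    proof
      have "x \<in> L" if "(x, A) \<in># \<Gamma> \<or> (x, A) \<in># \<Delta>" for x A
        using that by (force simp: L_def)
      then have "select (restrict f L) \<Gamma> = select f \<Gamma>" "select (restrict f L) \<Delta> = select f \<Delta>"
        by (intro select_cong; auto)+
      then show "d f = d (restrict f L)" by (simp add: d_def)
      show "restrict f L \<in> L \<rightarrow>\<^sub>E {0, 1}" using labelling_01[OF that] by auto
    qed
    then show ?thesis
      by (intro finite_subset[of S "d ` (L \<rightarrow>\<^sub>E {0, 1})"]) (auto simp: S_def L_def intro: finite_PiE)
  qed
  have "labelling (\<lambda>_. 1)" by (auto simp: labelling_def)
  then have neS: "S \<noteq> {}" by (auto simp: S_def)
  have Var: "A \<in> Var ` P" if "A \<in># select f \<Gamma>'" "\<Gamma>' \<in> {\<Gamma>, \<Delta>}" for f \<Gamma>' A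
    using that assms(1,2) by (fastforce simp: select_def atomic_def P_def)
  have mv: "mval v f \<Gamma>' = (\<Sum>p\<in>P. int (count (select f \<Gamma>') (Var p)) * v p)"
    if "\<Gamma>' \<in> {\<Gamma>, \<Delta>}" for f \<Gamma>' v
  proof -
    have "mval v f \<Gamma>' = (\<Sum>A\<in>Var ` P. int (count (select f \<Gamma>') A) * val v A)"
      unfolding mval_select using that finP by (intro sum_mset_eq_sum) (auto intro: Var)
    then show ?thesis by (simp add: sum.reindex inj_on_def)
  qed
  have dot_d: "dot P (d f) v = mval v f \<Gamma> - mval v f \<Delta>" for f v
    by (simp add: mv dot_def d_def left_diff_distrib sum_subtractf)
  have "\<not> (\<exists>v. \<forall>e\<in>S. 0 < dot P e v)"
  proof
    assume "\<exists>v. \<forall>e\<in>S. 0 < dot P e v"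
    then obtain v where "\<And>f. labelling f \<Longrightarrow> 0 < dot P (d f) v" by (auto simp: S_def)
    with assms(3)[of v] show False by (force simp: valid_at_def dot_d)
  qed
  then obtain e where e: "e \<in> sums_of S" "\<forall>p\<in>P. e p = 0"
    using gordan[OF finP finS neS] by blast
  then obtain fs where fs: "fs \<noteq> []" "set fs \<subseteq> {f. labelling f}" "e = (\<lambda>p. \<Sum>f\<leftarrow>fs. d f p)"
    unfolding S_def using sums_of_sum_list by blast
  have cnt: "count (\<Sum>f\<leftarrow>fs. select f \<Gamma>') A = (\<Sum>f\<leftarrow>fs. count (select f \<Gamma>') A)" for A \<Gamma>'
    by (induction fs) auto
  have "(\<Sum>f\<leftarrow>fs. select f \<Gamma>) = (\<Sum>f\<leftarrow>fs. select f \<Delta>)"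
  proof (rule multiset_eqI)
    fix A
    show "count (\<Sum>f\<leftarrow>fs. select f \<Gamma>) A = count (\<Sum>f\<leftarrow>fs. select f \<Delta>) A"
    proof (cases "A \<in> Var ` P")
      case True
      then obtain p where p: "A = Var p" "p \<in> P" by blast
      have "(\<Sum>f\<leftarrow>fs. d f p) = 0" using e(2) p fs(3) by simp
      moreover have "(\<Sum>f\<leftarrow>fs. d f p) =
        int (\<Sum>f\<leftarrow>fs. count (select f \<Gamma>) A) - int (\<Sum>f\<leftarrow>fs. count (select f \<Delta>) A)"
        unfolding p d_def by (induction fs) auto
      ultimately show ?thesis by (simp add: cnt)
    next
      case False
      then have "count (select f \<Gamma>') A = 0" if "\<Gamma>' \<in> {\<Gamma>, \<Delta>}" for f \<Gamma>'
        using Var[of A f \<Gamma>'] that by (auto simp: count_eq_zero_iff)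
      then show ?thesis by (simp add: cnt)
    qed
  qed
  then show ?thesis using fs assms(1,2) by (intro GAl.success[of _ _ fs]) auto
qed

text \<open>As all logical rules are semantically invertible, any compound formula may be decomposed
  in any order without search, until the sequent is atomic.\<close>

theorem GAl_complete: "(\<And>v. valid_at v \<Gamma> \<Delta>) \<Longrightarrow> \<Gamma> \<turnstile>\<^sub>l \<Delta>"
proof (induction "(\<Sum>(x, A)\<in>#\<Gamma>. cplx A) + (\<Sum>(x, A)\<in>#\<Delta>. cplx A)" arbitrary: \<Gamma> \<Delta> rule: less_induct)
  case less
  note val = less.prems
  show ?case
  proof (cases "atomic \<Gamma> \<and> atomic \<Delta>")
    case True
    then show ?thesis using val by (blast intro: success_if_valid)
  next
    case False
    then consider x A where "(x, A) \<in># \<Gamma>" "\<And>p. A \<noteq> Var p" | x A where "(x, A) \<in># \<Delta>" "\<And>p. A \<noteq> Var p"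
      unfolding atomic_def by auto
    then show ?thesis
    proof cases
      case (1 x A)
      then obtain \<Gamma>' where \<Gamma>: "\<Gamma> = add_mset (x, A) \<Gamma>'" by (metis mset_add)
      show ?thesis
      proof (cases A)
        case (Var p) then show ?thesis using 1 by blast
      next
        case Const_t
        show ?thesis unfolding \<Gamma> Const_t
          by (rule GAl.t_l, rule less.hyps) (use val in \<open>simp_all add: \<Gamma> Const_t valid_at_simps\<close>)
      next
        case (Neg B)
        show ?thesis unfolding \<Gamma> Neg
          by (rule GAl.Neg_l, rule less.hyps) (use val in \<open>simp_all add: \<Gamma> Neg valid_at_simps\<close>)
      next
        case (Plus B C)
        show ?thesis unfolding \<Gamma> Plus
          by (rule GAl.Plus_l, rule less.hyps) (use val in \<open>simp_all add: \<Gamma> Plus valid_at_simps\<close>)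
      next
        case (Imp B C)
        show ?thesis unfolding \<Gamma> Imp
          by (rule GAl.Imp_l, rule less.hyps) (use val in \<open>simp_all add: \<Gamma> Imp valid_at_simps\<close>)
      next
        case (RImp B C)
        have "finite (atoms x \<union> atoms_of \<Gamma>' \<union> atoms_of \<Delta>)" by (simp add: finite_atoms finite_atoms_of)
        from ex_new_if_finite[OF infinite_UNIV_nat this]
        obtain y where y: "y \<notin> atoms x \<union> atoms_of \<Gamma>' \<union> atoms_of \<Delta>" ..
        have "valid_at v (add_mset (x, RImp B C) \<Gamma>') \<Delta>" for v using val[of v] by (simp only: \<Gamma> RImp)
        then have "add_mset (Cat x (Atom y), C) \<Gamma>' \<turnstile>\<^sub>l add_mset (Cat x (Atom y), B) \<Delta>"
          by (intro less.hyps valid_at_RImp_l[OF _ y]) (simp_all add: \<Gamma> RImp)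
        then show ?thesis unfolding \<Gamma> RImp by (rule GAl.RImp_l[OF _ y])
      qed
    next
      case (2 x A)
      then obtain \<Delta>' where \<Delta>: "\<Delta> = add_mset (x, A) \<Delta>'" by (metis mset_add)
      show ?thesis
      proof (cases A)
        case (Var p) then show ?thesis using 2 by blast
      next
        case Const_t
        show ?thesis unfolding \<Delta> Const_t
          by (rule GAl.t_r, rule less.hyps) (use val in \<open>simp_all add: \<Delta> Const_t valid_at_simps\<close>)
      next
        case (Neg B)
        show ?thesis unfolding \<Delta> Neg
          by (rule GAl.Neg_r, rule less.hyps) (use val in \<open>simp_all add: \<Delta> Neg valid_at_simps\<close>)
      next
        case (Plus B C)
        show ?thesis unfolding \<Delta> Plus
          by (rule GAl.Plus_r, rule less.hyps) (use val in \<open>simp_all add: \<Delta> Plus valid_at_simps\<close>)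
      next
        case (Imp B C)
        show ?thesis unfolding \<Delta> Imp
          by (rule GAl.Imp_r, rule less.hyps) (use val in \<open>simp_all add: \<Delta> Imp valid_at_simps\<close>)
      next
        case (RImp B C)
        have step: "valid_at v (add_mset (x, B) \<Gamma>) (add_mset (x, C) \<Delta>')" "valid_at v \<Gamma> \<Delta>'" for v
          using val[of v] unfolding \<Delta> RImp by (rule valid_at_RImp_r)+
        have "add_mset (x, B) \<Gamma> \<turnstile>\<^sub>l add_mset (x, C) \<Delta>'" "\<Gamma> \<turnstile>\<^sub>l \<Delta>'"
          by (rule less.hyps, simp add: \<Delta> RImp, rule step)+
        then show ?thesis unfolding \<Delta> RImp by (rule GAl.RImp_r)
      qed
    qed
  qed
qed

theorem derivable_iff: "{#} \<turnstile>\<^sub>l {#(Unit, A)#} \<longleftrightarrow> (\<forall>v. 0 \<le> val v A)"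
proof
  assume "{#} \<turnstile>\<^sub>l {#(Unit, A)#}"
  then have "valid_at v {#} {#(Unit, A)#}" for v by (rule GAl_sound)
  then show "\<forall>v. 0 \<le> val v A" by (force simp: valid_at_def labelling_def)
next
  assume "\<forall>v. 0 \<le> val v A"
  moreover have "labelling (\<lambda>_. 1)" by (auto simp: labelling_def)
  ultimately show "{#} \<turnstile>\<^sub>l {#(Unit, A)#}" by (intro GAl_complete) (auto simp: valid_at_def intro!: exI[of _ "\<lambda>_. 1"])
qed

section \<open>Stack programs\<close>

datatype stack_act = Keep | Pop | Push nat | Repl nat

type_synonym store = "nat \<Rightarrow> nat list"

primrec do_act :: "stack_act \<Rightarrow> nat list \<Rightarrow> nat list" where
  "do_act Keep l = l"
| "do_act Pop l = tl l"
| "do_act (Push a) l = a # l"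
| "do_act (Repl a) l = a # tl l"

definition do_acts :: "(nat \<Rightarrow> stack_act) \<Rightarrow> store \<Rightarrow> store" where
  "do_acts as s = (\<lambda>r. do_act (as r) (s r))"

text \<open>An empty stack shows \<open>0\<close>, just as its tape shows a blank. Stacks hold only
  nonzero symbols in the program below, so \<open>0\<close> serves as the test for
  emptiness.\<close>

definition top0 :: "nat list \<Rightarrow> nat" where
  "top0 l = (case l of [] \<Rightarrow> 0 | a # _ \<Rightarrow> a)"

lemma top0_simps [simp]: "top0 [] = 0" "top0 (a # l) = a"
  by (auto simp: top0_def)

definition tops :: "store \<Rightarrow> nat \<Rightarrow> nat" where
  "tops s = (\<lambda>r. top0 (s r))"

datatype com =
    Upd "(nat \<Rightarrow> nat) \<Rightarrow> nat \<Rightarrow> stack_act"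
  | Put "nat \<Rightarrow> stack_act" \<comment> \<open>control state between the two machine steps of \<open>Upd\<close>; not for programs\<close>
  | Seq com com (infixr ";;" 60)
  | Cond "(nat \<Rightarrow> nat) \<Rightarrow> bool" com com
  | While "(nat \<Rightarrow> nat) \<Rightarrow> bool" com
  | Halt bool

text \<open>Control states are continuations, that is, lists of commands still to be executed.\<close>

fun cstep :: "com list \<times> store \<Rightarrow> com list \<times> store" where
  "cstep ([], s) = ([], s)"
| "cstep (Upd f # k, s) = (k, do_acts (f (tops s)) s)"
| "cstep (Put as # k, s) = (k, s)"
| "cstep ((a ;; b) # k, s) = (a # b # k, s)"
| "cstep (Cond P a b # k, s) = ((if P (tops s) then a else b) # k, s)"
| "cstep (While P a # k, s) = (if P (tops s) then a # While P a # k else k, s)"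
| "cstep (Halt b # k, s) = ([Halt b], s)"

text \<open>\<open>Inl\<close> is normal termination and \<open>Inr\<close> an abort that discards
  the continuation. The step count is chosen before the continuation \<open>k\<close>, which makes
  the relation compositional.\<close>

definition exec :: "com \<Rightarrow> store \<Rightarrow> nat \<Rightarrow> store + bool \<Rightarrow> bool" where
  "exec c s n r \<longleftrightarrow> (\<exists>m\<le>n. \<forall>k. case r of Inl s' \<Rightarrow> (cstep ^^ m) (c # k, s) = (k, s')
      | Inr b \<Rightarrow> \<exists>s'. (cstep ^^ m) (c # k, s) = ([Halt b], s'))"

lemma funpow_trans: "(f ^^ m) a = b \<Longrightarrow> (f ^^ n) b = c \<Longrightarrow> (f ^^ (m + n)) a = c"
  by (metis add.commute comp_apply funpow_add)

lemma exec_mono: "exec c s n r \<Longrightarrow> n \<le> n' \<Longrightarrow> exec c s n' r"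
  unfolding exec_def by (meson order_trans)

lemma exec_step:
  assumes "\<And>k. cstep (c # k, s) = (c' # k, s')" "exec c' s' n r"
  shows "exec c s (Suc n) r"
proof -
  obtain m where m: "m \<le> n" "\<forall>k. case r of Inl s'' \<Rightarrow> (cstep ^^ m) (c' # k, s') = (k, s'')
      | Inr b \<Rightarrow> \<exists>s''. (cstep ^^ m) (c' # k, s') = ([Halt b], s'')"
    using assms(2) unfolding exec_def by blast
  then show ?thesis unfolding exec_def
    by (intro exI[of _ "Suc m"]) (simp add: funpow_Suc_right assms(1) split: sum.splits del: funpow.simps)
qed

text \<open>Shared by \<open>Seq\<close> and by a \<open>While\<close> whose test succeeds: both
  unfold to two commands in front of the continuation.\<close>

lemma exec_append:
  assumes start: "\<And>k. cstep (c # k, s) = (a # b # k, s)"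
    and a: "exec a s n (Inl s')" and b: "exec b s' m r"
  shows "exec c s (n + m + 1) r"
proof -
  obtain i where i: "i \<le> n" "\<And>k. (cstep ^^ i) (a # k, s) = (k, s')"
    using a unfolding exec_def by auto
  obtain j where j: "j \<le> m" "\<And>k. case r of Inl s'' \<Rightarrow> (cstep ^^ j) (b # k, s') = (k, s'')
      | Inr b' \<Rightarrow> \<exists>s''. (cstep ^^ j) (b # k, s') = ([Halt b'], s'')"
    using b unfolding exec_def by auto
  have *: "(cstep ^^ (1 + i)) (c # k, s) = (b # k, s')" for k
    using start i(2)[of "b # k"] by (intro funpow_trans[where f = cstep]) auto
  show ?thesis unfolding exec_def
  proof (intro exI[of _ "1 + i + j"] conjI allI)
    fix k
    show "case r of Inl s'' \<Rightarrow> (cstep ^^ (1 + i + j)) (c # k, s) = (k, s'')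
      | Inr b' \<Rightarrow> \<exists>s''. (cstep ^^ (1 + i + j)) (c # k, s) = ([Halt b'], s'')"
      unfolding funpow_trans[OF *[of k] refl] by (rule j(2))
  qed (use i j in simp)
qed

lemma exec_append_exit:
  assumes start: "\<And>k. cstep (c # k, s) = (a # b # k, s)"
    and a: "exec a s n (Inr x)"
  shows "exec c s (n + 1) (Inr x)"
proof -
  obtain i where i: "i \<le> n" "\<And>k. \<exists>s'. (cstep ^^ i) (a # k, s) = ([Halt x], s')"
    using a unfolding exec_def by auto
  have "\<exists>s'. (cstep ^^ (1 + i)) (c # k, s) = ([Halt x], s')" for k
  proof -
    obtain s' where "(cstep ^^ i) (a # b # k, s) = ([Halt x], s')" using i(2) by blast
    then have "(cstep ^^ (1 + i)) (c # k, s) = ([Halt x], s')"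
      using start by (intro funpow_trans[where f = cstep]) auto
    then show ?thesis by blast
  qed
  then show ?thesis unfolding exec_def using i(1) by (intro exI[of _ "1 + i"]) simp
qed

lemma exec_Upd: "s' = do_acts (f (tops s)) s \<Longrightarrow> exec (Upd f) s 1 (Inl s')"
  unfolding exec_def by (intro exI[of _ 1]) simp

lemma exec_Halt: "exec (Halt b) s 1 (Inr b)"
  unfolding exec_def by (intro exI[of _ 1]) simp

lemma exec_Seq: "exec a s n (Inl s') \<Longrightarrow> exec b s' m r \<Longrightarrow> exec (a ;; b) s (n + m + 1) r"
  by (rule exec_append) simp_all

lemma exec_Seq_exit: "exec a s n (Inr x) \<Longrightarrow> exec (a ;; b) s (n + 1) (Inr x)"
  by (rule exec_append_exit) simp_all

lemma exec_Cond: "exec (if P (tops s) then a else b) s n r \<Longrightarrow> exec (Cond P a b) s (n + 1) r"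
  unfolding Suc_eq_plus1[symmetric] by (rule exec_step) simp_all

lemma exec_While_end: "\<not> P (tops s) \<Longrightarrow> exec (While P a) s 1 (Inl s)"
  unfolding exec_def by (intro exI[of _ 1]) simp

lemma exec_While_step:
  "P (tops s) \<Longrightarrow> exec a s n (Inl s') \<Longrightarrow> exec (While P a) s' m r \<Longrightarrow> exec (While P a) s (n + m + 1) r"
  by (rule exec_append) simp_all

lemma exec_While_exit:
  "P (tops s) \<Longrightarrow> exec a s n (Inr x) \<Longrightarrow> exec (While P a) s (n + 1) (Inr x)"
  by (rule exec_append_exit) simp_all

section \<open>Compilation to Turing machines\<close>

definition bit_sym :: "bool \<Rightarrow> nat" where
  "bit_sym b = (if b then 2 else 1)"

definition init_store :: "bool list \<Rightarrow> bool list \<Rightarrow> store" where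
  "init_store x u = (\<lambda>_. [])(0 := map bit_sym x, 1 := map bit_sym u)"

primrec act_sym :: "stack_act \<Rightarrow> nat" where
  "act_sym Keep = 0"
| "act_sym Pop = 0"
| "act_sym (Push a) = a"
| "act_sym (Repl a) = a"

primrec ok_com :: "nat \<Rightarrow> nat \<Rightarrow> com \<Rightarrow> bool" where
  "ok_com K S (Upd f) \<longleftrightarrow>
     (\<forall>t. (\<forall>r. t r < S) \<longrightarrow> (\<forall>r. act_sym (f t r) < S \<and> (r \<ge> K \<longrightarrow> f t r = Keep)))"
| "ok_com K S (Put _) \<longleftrightarrow> False"
| "ok_com K S (a ;; b) \<longleftrightarrow> ok_com K S a \<and> ok_com K S b"
| "ok_com K S (Cond _ a b) \<longleftrightarrow> ok_com K S a \<and> ok_com K S b"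
| "ok_com K S (While _ a) \<longleftrightarrow> ok_com K S a"
| "ok_com K S (Halt _) \<longleftrightarrow> True"

text \<open>Pushing takes two machine steps, since the head has to move before it writes.\<close>

primrec tape_act1 :: "stack_act \<Rightarrow> nat \<Rightarrow> nat \<times> dir" where
  "tape_act1 Keep a = (a, Stay)"
| "tape_act1 Pop a = (a, Go_Right)"
| "tape_act1 (Push b) a = (a, Go_Left)"
| "tape_act1 (Repl b) a = (b, Stay)"

primrec tape_act2 :: "stack_act \<Rightarrow> nat \<Rightarrow> nat \<times> dir" where
  "tape_act2 Keep a = (a, Stay)"
| "tape_act2 Pop a = (a, Stay)"
| "tape_act2 (Push b) a = (b, Stay)"
| "tape_act2 (Repl b) a = (a, Stay)"

text \<open>\<open>Put\<close> stores the actions chosen from the old tops, since after the first of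
  the two machine steps the heads may read other symbols.\<close>

fun control :: "com list \<Rightarrow> (nat \<Rightarrow> nat) \<Rightarrow> com list \<times> (nat \<Rightarrow> nat \<Rightarrow> nat \<times> dir)" where
  "control [] t = ([], \<lambda>_ a. (a, Stay))"
| "control (Upd f # k) t = (Put (f t) # k, \<lambda>r. tape_act1 (f t r))"
| "control (Put as # k) t = (k, \<lambda>r. tape_act2 (as r))"
| "control ((a ;; b) # k) t = (a # b # k, \<lambda>_ a. (a, Stay))"
| "control (Cond P a b # k) t = ((if P t then a else b) # k, \<lambda>_ a. (a, Stay))"
| "control (While P a # k) t = (if P t then a # While P a # k else k, \<lambda>_ a. (a, Stay))"
| "control (Halt b # k) t = ([Halt b], \<lambda>_ a. (a, Stay))"

definition tops_of_list :: "nat list \<Rightarrow> nat \<Rightarrow> nat" where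
  "tops_of_list ss = (\<lambda>r. if r < length ss then ss ! r else 0)"

definition top_funs :: "nat \<Rightarrow> nat \<Rightarrow> (nat \<Rightarrow> nat) set" where
  "top_funs K S = tops_of_list ` {ss. set ss \<subseteq> {..<S} \<and> length ss = K}"

text \<open>Covers all control states met while \<open>c\<close> runs in front of \<open>k\<close>.
  It stays finite because a loop body always returns to the same continuation and only the finitely
  many top functions in \<open>Ts\<close> occur in \<open>Put\<close>.\<close>

primrec conts :: "(nat \<Rightarrow> nat) set \<Rightarrow> com \<Rightarrow> com list \<Rightarrow> com list set" where
  "conts Ts (Upd f) k = insert (Upd f # k) ((\<lambda>t. Put (f t) # k) ` Ts)"
| "conts Ts (Put as) k = {Put as # k}"
| "conts Ts (a ;; b) k = insert ((a ;; b) # k) (conts Ts a (b # k) \<union> conts Ts b k)"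
| "conts Ts (Cond P a b) k = insert (Cond P a b # k) (conts Ts a k \<union> conts Ts b k)"
| "conts Ts (While P a) k = insert (While P a # k) (conts Ts a (While P a # k))"
| "conts Ts (Halt b) k = {Halt b # k}"

lemma conts_start: "c # k \<in> conts Ts c k"
  by (cases c) auto

lemma finite_conts: "finite Ts \<Longrightarrow> finite (conts Ts c k)"
  by (induction c arbitrary: k) auto

lemma conts_control:
  assumes "t \<in> Ts" "k' \<in> conts Ts c k"
  shows "fst (control k' t) \<in> conts Ts c k \<union> {k, [Halt True], [Halt False]}"
  using assms(2)
proof (induction c arbitrary: k)
  case (Seq a b)
  then consider "k' = (a ;; b) # k" | "k' \<in> conts Ts a (b # k)" | "k' \<in> conts Ts b k" by auto
  then show ?case
  proof cases
    case 1 then show ?thesis by (simp add: conts_start)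
  next
    case 2 then show ?thesis using Seq.IH(1)[OF 2] conts_start[of b k Ts] by auto
  next
    case 3 then show ?thesis using Seq.IH(2)[OF 3] by auto
  qed
next
  case (Cond P a b)
  then consider "k' = Cond P a b # k" | "k' \<in> conts Ts a k" | "k' \<in> conts Ts b k" by auto
  then show ?case
  proof cases
    case 1 then show ?thesis by (simp add: conts_start)
  next
    case 2 then show ?thesis using Cond.IH(1)[OF 2] by auto
  next
    case 3 then show ?thesis using Cond.IH(2)[OF 3] by auto
  qed
next
  case (While P a)
  then consider "k' = While P a # k" | "k' \<in> conts Ts a (While P a # k)" by auto
  then show ?case
  proof cases
    case 1 then show ?thesis by (simp add: conts_start)
  next
    case 2 then show ?thesis using While.IH[OF 2] by auto
  qed
next
  case (Halt b)
  then show ?case by (cases b) auto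
qed (use assms(1) in auto)

text \<open>Only the cells from the head rightwards count. Popping moves the head and leaves garbage
  on its left, which a later push overwrites.\<close>

definition rep :: "nat list \<Rightarrow> tape \<Rightarrow> bool" where
  "rep l T \<longleftrightarrow> (\<forall>i. fst T (snd T + int i) = (if i < length l then l ! i else 0))"

lemma rep_read: "rep l T \<Longrightarrow> read T = top0 l"
  by (cases T; cases l) (auto simp: rep_def dest: spec[of _ 0])

lemma rep_stay: "rep l T \<Longrightarrow> rep l (act (read T, Stay) T)"
  by (cases T) (simp add: rep_def)

lemma rep_act:
  assumes "rep l T"
  shows "rep (do_act a l) (act (tape_act2 a (read (act (tape_act1 a (read T)) T))) (act (tape_act1 a (read T)) T))"
proof (cases T)
  case (Pair c h)
  have c: "c (h + int i) = (if i < length l then l ! i else 0)" for i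
    using assms by (simp add: rep_def Pair)
  show ?thesis
  proof (cases a)
    case Keep then show ?thesis using assms by (simp add: Pair)
  next
    case Pop
    have "c (h + 1 + int i) = (if i < length (tl l) then tl l ! i else 0)" for i
      using c[of "Suc i"] by (auto simp: nth_tl algebra_simps)
    then show ?thesis by (simp add: Pop Pair rep_def)
  next
    case (Push b)
    have "(c(h - 1 := b)) (h - 1 + int i) = (if i < length (b # l) then (b # l) ! i else 0)" for i
      using c[of "i - 1"] by (cases i) auto
    then show ?thesis by (simp add: Push Pair rep_def)
  next
    case (Repl b)
    have "(c(h := b)) (h + int i) = (if i < length (b # tl l) then (b # tl l) ! i else 0)" for i
      using c[of i] by (cases i) (auto simp: nth_tl)
    then show ?thesis by (simp add: Repl Pair rep_def)
  qed
qed

lemma rep_word_tape: "rep (map bit_sym w) (word_tape w)"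
  by (auto simp: rep_def word_tape_def bit_sym_def)

locale compile =
  fixes K S :: nat and c :: com and Q :: "com list set" and e :: "com list \<Rightarrow> nat"
  assumes K: "2 \<le> K" and S: "3 \<le> S" and ok: "ok_com K S c"
    and Q_def: "Q = conts (top_funs K S) c [] \<union> {[], [Halt True], [Halt False]}"
    and e: "bij_betw e Q {0..<card Q}"
begin

definition M :: tm where
  "M = \<lparr>num_tapes = K, num_symbols = S, num_states = card Q, start = e [c],
     accept = e [Halt True], reject = e [Halt False],
     delta = \<lambda>q ss. let (k, as) = control (the_inv_into Q e q) (tops_of_list ss)
       in (e k, map (\<lambda>r. as r (ss ! r)) [0..<K])\<rparr>"

lemma e_less: "k \<in> Q \<Longrightarrow> e k < card Q"
  using bij_betwE[OF e] by force

lemma e_inj: "k \<in> Q \<Longrightarrow> k' \<in> Q \<Longrightarrow> e k = e k' \<longleftrightarrow> k = k'"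
  using e by (auto simp: bij_betw_def inj_on_def)

lemma inv_e: "k \<in> Q \<Longrightarrow> the_inv_into Q e (e k) = k"
  using e by (intro the_inv_into_f_f) (auto simp: bij_betw_def)

lemma control_in_Q:
  assumes "k \<in> Q" "t \<in> top_funs K S"
  shows "fst (control k t) \<in> Q"
proof -
  consider "k \<in> conts (top_funs K S) c []" | "k = []" | b where "k = [Halt b]"
    using assms(1) by (auto simp: Q_def)
  then show ?thesis
  proof cases
    case 1
    from conts_control[OF assms(2) this] show ?thesis by (auto simp: Q_def)
  next
    case (3 b) then show ?thesis by (cases b) (auto simp: Q_def)
  qed (auto simp: Q_def)
qed

text \<open>\<open>ok_com\<close> rejects \<open>Put\<close>, yet \<open>Put\<close> occurs in the
  machine's states, and machine well-formedness quantifies over every state.\<close>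

primrec ok_state :: "com \<Rightarrow> bool" where
  "ok_state (Upd f) = ok_com K S (Upd f)"
| "ok_state (Put as) = (\<forall>r. act_sym (as r) < S)"
| "ok_state (Seq a b) = ok_com K S (Seq a b)"
| "ok_state (Cond P a b) = ok_com K S (Cond P a b)"
| "ok_state (While P a) = ok_com K S (While P a)"
| "ok_state (Halt b) = True"

lemma ok_com_state: "ok_com K S a \<Longrightarrow> ok_state a"
  by (cases a) auto

lemma top_funs_less: "t \<in> top_funs K S \<Longrightarrow> t r < S"
proof -
  assume "t \<in> top_funs K S"
  then obtain ss where ss: "set ss \<subseteq> {..<S}" "t = tops_of_list ss" by (auto simp: top_funs_def)
  then have "\<forall>a\<in>set ss. a < S" by auto
  then show ?thesis using S ss by (simp add: tops_of_list_def)
qed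

lemma ok_conts:
  "ok_com K S a \<Longrightarrow> k' \<in> conts (top_funs K S) a k \<Longrightarrow> \<forall>a\<in>set k. ok_state a \<Longrightarrow> \<forall>a\<in>set k'. ok_state a"
proof (induction a arbitrary: k)
  case (Upd f)
  from Upd.prems(2) consider "k' = Upd f # k" | t where "t \<in> top_funs K S" "k' = Put (f t) # k" by auto
  then show ?case
  proof cases
    case 1 then show ?thesis using Upd.prems(1,3) by simp
  next
    case (2 t)
    then have "\<forall>r. t r < S" using top_funs_less by blast
    then show ?thesis using Upd.prems(1,3) 2 by simp
  qed
next
  case (Seq a b)
  have w: "\<forall>x\<in>set (b # k). ok_state x"
    using Seq.prems ok_com_state[of b] by simp
  from Seq.prems(2) consider "k' = (a ;; b) # k" | "k' \<in> conts (top_funs K S) a (b # k)"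
    | "k' \<in> conts (top_funs K S) b k" by auto
  then show ?case
  proof cases
    case 1 then show ?thesis using Seq.prems by simp
  next
    case 2 then show ?thesis using Seq.IH(1)[OF _ 2 w] Seq.prems(1) by simp
  next
    case 3 then show ?thesis using Seq.IH(2)[OF _ 3 Seq.prems(3)] Seq.prems(1) by simp
  qed
next
  case (Cond P a b)
  from Cond.prems(2) consider "k' = Cond P a b # k" | "k' \<in> conts (top_funs K S) a k"
    | "k' \<in> conts (top_funs K S) b k" by auto
  then show ?case
  proof cases
    case 1 then show ?thesis using Cond.prems by simp
  next
    case 2 then show ?thesis using Cond.IH(1)[OF _ 2 Cond.prems(3)] Cond.prems(1) by simp
  next
    case 3 then show ?thesis using Cond.IH(2)[OF _ 3 Cond.prems(3)] Cond.prems(1) by simp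
  qed
next
  case (While P a)
  have w: "\<forall>x\<in>set (While P a # k). ok_state x"
    using While.prems ok_com_state[of "While P a"] by auto
  from While.prems(2) consider "k' = While P a # k" | "k' \<in> conts (top_funs K S) a (While P a # k)" by auto
  then show ?case
  proof cases
    case 1 then show ?thesis using w by simp
  next
    case 2 then show ?thesis using While.IH[OF _ 2 w] While.prems(1) by simp
  qed
qed auto

lemma ok_Q: "k \<in> Q \<Longrightarrow> \<forall>a\<in>set k. ok_state a"
  using ok_conts[OF ok, of k "[]"] by (auto simp: Q_def)

lemma wf_M: "wf_tm M"
proof -
  have inQ: "[c] \<in> Q" "[Halt True] \<in> Q" "[Halt False] \<in> Q"
    by (auto simp: Q_def conts_start)
  have "fst (delta M q ss) < num_states M \<and> length (snd (delta M q ss)) = num_tapes M \<and>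
        fst ` set (snd (delta M q ss)) \<subseteq> {..<num_symbols M}"
    if q: "q < num_states M" and ss: "length ss = num_tapes M" "set ss \<subseteq> {..<num_symbols M}" for q ss
  proof -
    define k where "k = the_inv_into Q e q"
    have "q \<in> e ` Q" using q e by (simp add: M_def bij_betw_def)
    then have k: "k \<in> Q" unfolding k_def
      using the_inv_into_into[of e Q q Q] e by (simp add: bij_betw_def)
    have t: "tops_of_list ss \<in> top_funs K S" using ss by (auto simp: top_funs_def M_def)
    have "e (fst (control k (tops_of_list ss))) < card Q"
      by (intro e_less control_in_Q k t)
    moreover have "fst (snd (control k (tops_of_list ss)) r (ss ! r)) < S" if "r < K" for r
    proof -
      have "\<forall>a\<in>set ss. a < S" using ss by (auto simp: M_def)
      then have r: "ss ! r < S" using that ss by (simp add: M_def)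
      show ?thesis
      proof (cases k)
        case Nil then show ?thesis using r by simp
      next
        case (Cons a k')
        then have "ok_state a" using ok_Q[OF k] by simp
        then show ?thesis using r Cons top_funs_less[OF t]
        proof (cases a)
          case (Upd f)
          then have "act_sym (f (tops_of_list ss) r) < S"
            using \<open>ok_state a\<close> top_funs_less[OF t] by auto
          then show ?thesis using r Cons Upd by (cases "f (tops_of_list ss) r") auto
        next
          case (Put as)
          then have "act_sym (as r) < S" using \<open>ok_state a\<close> by auto
          then show ?thesis using r Cons Put by (cases "as r") auto
        qed auto
      qed
    qed
    ultimately show ?thesis
      by (auto simp: M_def k_def[symmetric] Let_def split: prod.splits)
  qed
  then show ?thesis
    using K S inQ e_less e_inj unfolding wf_tm_def by (auto simp: M_def)
qed

section \<open>Simulation of program steps by machine steps\<close>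

definition good :: "store \<Rightarrow> bool" where
  "good s \<longleftrightarrow> (\<forall>r. set (s r) \<subseteq> {..<S} \<and> (r \<ge> K \<longrightarrow> s r = []))"

definition sim :: "com list \<times> store \<Rightarrow> config \<Rightarrow> bool" where
  "sim ks C \<longleftrightarrow> fst ks \<in> Q \<and> (\<forall>a\<in>set (fst ks). ok_com K S a) \<and> good (snd ks) \<and> fst C = e (fst ks) \<and> length (snd C) = K \<and>
     (\<forall>r<K. rep (snd ks r) (snd C ! r))"

lemma good_tops: "good s \<Longrightarrow> tops s r < S"
proof -
  assume "good s"
  then have "set (s r) \<subseteq> {..<S}" by (simp add: good_def)
  then show ?thesis using S by (cases "s r") (auto simp: tops_def)
qed

lemma tops_of_tapes:
  assumes "good s" "length Ts = K" "\<And>r. r < K \<Longrightarrow> rep (s r) (Ts ! r)"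
  shows "tops_of_list (map read Ts) = tops s"
proof
  fix r
  show "tops_of_list (map read Ts) r = tops s r"
    using assms by (cases "r < K") (auto simp: tops_of_list_def tops_def rep_read good_def)
qed

lemma tops_in: "good s \<Longrightarrow> tops s \<in> top_funs K S"
  unfolding top_funs_def
proof (rule image_eqI)
  assume "good s"
  then show "tops s = tops_of_list (map (tops s) [0..<K])"
    by (auto simp: tops_of_list_def fun_eq_iff tops_def good_def)
  show "map (tops s) [0..<K] \<in> {ss. set ss \<subseteq> {..<S} \<and> length ss = K}"
    using good_tops[OF \<open>good s\<close>] by auto
qed

lemma good_do_acts:
  assumes "good s" "\<And>r. act_sym (as r) < S" "\<And>r. r \<ge> K \<Longrightarrow> as r = Keep"
  shows "good (do_acts as s)"
  unfolding good_def
proof (intro allI conjI impI)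
  fix r
  have "set (s r) \<subseteq> {..<S}" using assms(1) by (simp add: good_def)
  moreover have "set (tl (s r)) \<subseteq> set (s r)" by (cases "s r") auto
  ultimately show "set (do_acts as s r) \<subseteq> {..<S}"
    using assms(2)[of r] by (cases "as r") (auto simp: do_acts_def)
  show "do_acts as s r = []" if "r \<ge> K"
    using that assms(1,3) by (simp add: do_acts_def good_def)
qed

lemma step_control:
  assumes "k \<in> Q" "length Ts = K" "\<not> halted M (e k, Ts)" "t = tops_of_list (map read Ts)"
    "control k t = (k', as)"
  shows "step M (e k, Ts) = (e k', map (\<lambda>r. act (as r (read (Ts ! r))) (Ts ! r)) [0..<K])"
proof -
  have "step M (e k, Ts) = (e k', map2 act (map (\<lambda>r. as r (map read Ts ! r)) [0..<K]) Ts)"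
    using assms by (simp add: step_def M_def inv_e)
  also have "map2 act (map (\<lambda>r. as r (map read Ts ! r)) [0..<K]) Ts =
      map (\<lambda>r. act (as r (read (Ts ! r))) (Ts ! r)) [0..<K]"
    using assms(2) by (intro nth_equalityI) auto
  finally show ?thesis .
qed

text \<open>\<open>Upd\<close> costs two machine steps, every other command one, and a halted state
  none, since \<open>cstep\<close> idles there as well.\<close>

lemma sim_step:
  assumes "sim ks C"
  shows "\<exists>m\<le>2. sim (cstep ks) ((step M ^^ m) C)"
proof -
  obtain k s where ks: "ks = (k, s)" by (cases ks)
  obtain q Ts where C: "C = (q, Ts)" by (cases C)
  have k: "k \<in> Q" and okk: "\<forall>a\<in>set k. ok_com K S a" and s: "good s" and q: "q = e k" and len: "length Ts = K"
    and rep: "\<And>r. r < K \<Longrightarrow> rep (s r) (Ts ! r)"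
    using assms by (auto simp: sim_def ks C)
  have tops: "tops s = tops_of_list (map read Ts)" using tops_of_tapes[OF s len rep] by simp
  have H: "[Halt True] \<in> Q" "[Halt False] \<in> Q" by (auto simp: Q_def)
  show ?thesis
  proof (cases "\<exists>b. k = [Halt b]")
    case True
    then show ?thesis using assms unfolding ks by (intro exI[of _ 0]) auto
  next
    case False
    then have nh: "\<not> halted M (e k, Ts')" for Ts'
      using e_inj[OF k] H by (auto simp: halted_def M_def)
    have fst_step: "step M C = (e (fst (control k (tops s))),
        map (\<lambda>r. act (snd (control k (tops s)) r (read (Ts ! r))) (Ts ! r)) [0..<K])"
      unfolding C q by (rule step_control[OF k len nh tops]) simp
    have k': "fst (control k (tops s)) \<in> Q" by (intro control_in_Q k tops_in s)
    show ?thesis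
    proof (cases "\<exists>f k1. k = Upd f # k1")
      case True
      then obtain f k1 where kf: "k = Upd f # k1" by blast
      define as where "as = f (tops s)"
      define Ts' where "Ts' = map (\<lambda>r. act (tape_act1 (as r) (read (Ts ! r))) (Ts ! r)) [0..<K]"
      have step1: "step M C = (e (Put as # k1), Ts')"
        using fst_step by (simp add: kf Ts'_def as_def)
      have kp: "Put as # k1 \<in> Q" using k' by (simp add: kf as_def)
      have "\<not> halted M (e (Put as # k1), Ts')" using e_inj[OF kp] H by (auto simp: halted_def M_def)
      then have "step M (e (Put as # k1), Ts') =
          (e k1, map (\<lambda>r. act (tape_act2 (as r) (read (Ts' ! r))) (Ts' ! r)) [0..<K])"
        by (intro step_control[OF kp]) (auto simp: Ts'_def)
      then have two: "(step M ^^ 2) C = (e k1, map (\<lambda>r. act (tape_act2 (as r) (read (Ts' ! r))) (Ts' ! r)) [0..<K])"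
        by (simp add: numeral_2_eq_2 step1)
      have "ok_com K S (Upd f)" using okk by (simp add: kf)
      then have "good (do_acts as s)"
        using good_tops[OF s] by (intro good_do_acts s) (auto simp: as_def)
      moreover have "k1 \<in> Q" using control_in_Q[OF kp tops_in[OF s]] by simp
      ultimately have "sim (cstep ks) ((step M ^^ 2) C)"
        unfolding two using okk by (auto simp: sim_def ks kf Ts'_def as_def[symmetric] do_acts_def intro!: rep_act rep)
      then show ?thesis by blast
    next
      case False
      then have "control k (tops s) = (fst (cstep ks), \<lambda>_ a. (a, Stay)) \<and> snd (cstep ks) = s \<and>
          (\<forall>a\<in>set (fst (cstep ks)). ok_com K S a)"
        using okk unfolding ks by (cases "(k, s)" rule: cstep.cases) auto
      then have "sim (cstep ks) ((step M ^^ 1) C)"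
        using k' s rep fst_step by (auto simp: sim_def intro: rep_stay)
      then show ?thesis by (intro exI[of _ 1]) simp
    qed
  qed
qed

lemma sim_steps: "sim ks C \<Longrightarrow> \<exists>m\<le>2 * n. sim ((cstep ^^ n) ks) ((step M ^^ m) C)"
proof (induction n)
  case (Suc n)
  then obtain m where m: "m \<le> 2 * n" "sim ((cstep ^^ n) ks) ((step M ^^ m) C)" by blast
  from sim_step[OF m(2)] obtain i where i: "i \<le> 2" "sim (cstep ((cstep ^^ n) ks)) ((step M ^^ i) ((step M ^^ m) C))"
    by blast
  then show ?case using m(1) by (intro exI[of _ "i + m"]) (simp add: funpow_add)
qed (auto intro: exI[of _ 0])

lemma sim_init: "sim ([c], init_store x u) (init M x u)"
proof -
  have "rep (init_store x u r) ((word_tape x # word_tape u # replicate (K - 2) (word_tape [])) ! r)" if "r < K" for r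
    using that rep_word_tape[of "[]"] rep_word_tape K
    by (auto simp: init_store_def nth_Cons split: nat.splits)
  moreover have "[c] \<in> Q" by (simp add: Q_def conts_start)
  moreover have "good (init_store x u)"
    using K S by (auto simp: good_def init_store_def bit_sym_def)
  ultimately show ?thesis using K ok by (simp add: sim_def init_def M_def)
qed

theorem exec_run:
  assumes "exec c (init_store x u) n (Inr b)"
  shows "\<exists>m\<le>2 * n. fst (run M m x u) = (if b then accept M else reject M)"
proof -
  obtain i s' where i: "i \<le> n" "(cstep ^^ i) ([c], init_store x u) = ([Halt b], s')"
    using assms unfolding exec_def by (auto dest: spec[of _ "[]"])
  obtain m where m: "m \<le> 2 * i" "sim ([Halt b], s') ((step M ^^ m) (init M x u))"
    using sim_steps[OF sim_init, of i x u] i(2) by auto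
  then have "fst (run M m x u) = e [Halt b]" by (simp add: sim_def run_def)
  then show ?thesis using m(1) i(1) by (intro exI[of _ m]) (auto simp: M_def)
qed

end

lemma run_halted: "halted M (run M m x u) \<Longrightarrow> m \<le> n \<Longrightarrow> run M n x u = run M m x u"
proof (induction n)
  case (Suc n)
  then show ?case by (cases "m = Suc n") (auto simp: run_def step_def)
qed simp

theorem ex_machine:
  assumes "2 \<le> K" "3 \<le> S" "ok_com K S c"
  shows "\<exists>M. wf_tm M \<and> (\<forall>x u n b. exec c (init_store x u) n (Inr b) \<longrightarrow>
    halted M (run M (2 * n) x u) \<and> (accepts M x u \<longleftrightarrow> b))"
proof -
  define Q where "Q = conts (top_funs K S) c [] \<union> {[], [Halt True], [Halt False]}"
  have "finite (top_funs K S)"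
    unfolding top_funs_def by (intro finite_imageI finite_lists_length_eq) simp
  then have "finite Q" by (simp add: Q_def finite_conts)
  then obtain e where "bij_betw e Q {0..<card Q}" using ex_bij_betw_finite_nat by blast
  then interpret compile K S c Q e using assms by unfold_locales (auto simp: Q_def)
  have ne: "accept M \<noteq> reject M" using wf_M by (simp add: wf_tm_def)
  have "halted M (run M (2 * n) x u) \<and> (accepts M x u \<longleftrightarrow> b)"
    if ex: "exec c (init_store x u) n (Inr b)" for x u n b
  proof -
    obtain m where m: "m \<le> 2 * n" "fst (run M m x u) = (if b then accept M else reject M)"
      using exec_run[OF ex] by blast
    then have h: "halted M (run M m x u)" by (auto simp: halted_def)
    \<comment> \<open>A halted configuration never changes, so an accepting time and the time given
      by \<open>exec_run\<close> show the same final state.\<close>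
    have "b" if acc: "accepts M x u"
    proof -
      obtain n' where n': "fst (run M n' x u) = accept M" using acc by (auto simp: accepts_def)
      then have "halted M (run M n' x u)" by (simp add: halted_def)
      then have "run M n' x u = run M m x u"
        using run_halted[OF h] run_halted[of M n' x u m] by (metis nat_le_linear)
      then show b using n' m(2) ne by (auto split: if_splits)
    qed
    moreover have "accepts M x u" if b using that m(2) by (auto simp: accepts_def)
    ultimately show ?thesis using run_halted[OF h m(1)] h by auto
  qed
  with wf_M show ?thesis by blast
qed

section \<open>Moving stacks\<close>

abbreviation no_act :: "nat \<Rightarrow> stack_act" where
  "no_act \<equiv> \<lambda>_. Keep"

abbreviation empty_store :: store where
  "empty_store \<equiv> \<lambda>_. []"

lemma do_acts_upd [simp]: "do_acts (as(r := a)) s = (do_acts as s)(r := do_act a (s r))"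
  by (auto simp: do_acts_def)

lemma do_acts_no_act [simp]: "do_acts no_act s = s"
  by (auto simp: do_acts_def)

lemma tops_apply [simp]: "tops s r = top0 (s r)"
  by (simp add: tops_def)

lemma top0_append: "top0 (a @ b) = (if a = [] then top0 b else top0 a)"
  by (cases a) auto

lemma exec_Seq': "exec a s n (Inl s') \<Longrightarrow> exec b s' m r \<Longrightarrow> n + m + 1 \<le> l \<Longrightarrow> exec (a ;; b) s l r"
  using exec_mono[OF exec_Seq] by blast

lemma exec_Cond_True: "P (tops s) \<Longrightarrow> exec a s n r \<Longrightarrow> n + 1 \<le> l \<Longrightarrow> exec (Cond P a b) s l r"
  using exec_mono[OF exec_Cond] by simp

lemma exec_Cond_False: "\<not> P (tops s) \<Longrightarrow> exec b s n r \<Longrightarrow> n + 1 \<le> l \<Longrightarrow> exec (Cond P a b) s l r"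
  using exec_mono[OF exec_Cond] by simp

lemma exec_While_end': "\<not> P (tops s) \<Longrightarrow> s' = s \<Longrightarrow> 1 \<le> n \<Longrightarrow> exec (While P a) s n (Inl s')"
  using exec_mono[OF exec_While_end] by blast

lemma exec_While_step':
  "exec a s n (Inl s') \<Longrightarrow> P (tops s) \<Longrightarrow> exec (While P a) s' m r \<Longrightarrow> n + m + 1 \<le> l \<Longrightarrow> exec (While P a) s l r"
  using exec_mono[OF exec_While_step] by blast

text \<open>A transfer reverses the order of the symbols, so which end of a number is on top
  alternates from one transfer to the next. Each symbol costs two steps, one for the test and one
  for the update.\<close>

definition move :: "(nat \<Rightarrow> bool) \<Rightarrow> (nat \<Rightarrow> nat) \<Rightarrow> nat \<Rightarrow> nat \<Rightarrow> com" where
  "move P h a b = While (\<lambda>t. P (t a)) (Upd (\<lambda>t. no_act(a := Pop, b := Push (h (t a)))))"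

lemma exec_move:
  assumes "a \<noteq> b" "s a = l @ l'" "\<forall>x\<in>set l. P x" "\<not> P (top0 l')"
    "s' = s(a := l', b := rev (map h l) @ s b)" "2 * length l + 1 \<le> n"
  shows "exec (move P h a b) s n (Inl s')"
proof -
  have "exec (move P h a b) s (2 * length l + 1) (Inl (s(a := l', b := rev (map h l) @ s b)))"
    using assms(2,3)
  proof (induction l arbitrary: s)
    case Nil
    then have "s(a := l', b := rev (map h []) @ s b) = s" by (simp add: fun_eq_iff)
    then show ?case unfolding move_def using Nil assms(4) by (intro exec_While_end') auto
  next
    case (Cons x l)
    let ?s = "s(a := l @ l', b := h x # s b)"
    have 1: "exec (Upd (\<lambda>t. no_act(a := Pop, b := Push (h (t a))))) s 1 (Inl ?s)"
      using Cons.prems assms(1) by (intro exec_Upd) (simp add: fun_eq_iff)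
    have "?s a = l @ l'" using assms(1) by simp
    then have 2: "exec (move P h a b) ?s (2 * length l + 1) (Inl (?s(a := l', b := rev (map h l) @ ?s b)))"
      using Cons.prems by (intro Cons.IH) auto
    have eq: "?s(a := l', b := rev (map h l) @ ?s b) = s(a := l', b := rev (map h (x # l)) @ s b)"
      using assms(1) by (simp add: fun_eq_iff)
    show ?case unfolding move_def eq[symmetric]
      by (rule exec_While_step'[OF 1 _ 2[unfolded move_def]]) (use Cons.prems in auto)
  qed
  then show ?thesis unfolding assms(5) using assms(6) by (rule exec_mono)
qed

definition drop_all :: "nat \<Rightarrow> com" where
  "drop_all a = While (\<lambda>t. t a \<noteq> 0) (Upd (\<lambda>t. no_act(a := Pop)))"

lemma exec_drop_all:
  assumes "0 \<notin> set (s a)" "s' = s(a := [])" "2 * length (s a) + 1 \<le> n"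
  shows "exec (drop_all a) s n (Inl s')"
proof -
  have "exec (drop_all a) s (2 * length l + 1) (Inl (s(a := [])))" if "s a = l" "0 \<notin> set l" for l
    using that
  proof (induction l arbitrary: s)
    case Nil
    then have "s(a := []) = s" by (simp add: fun_eq_iff)
    then show ?case unfolding drop_all_def using Nil by (intro exec_While_end') auto
  next
    case (Cons x l)
    have 1: "exec (Upd (\<lambda>t. no_act(a := Pop))) s 1 (Inl (s(a := l)))"
      using Cons.prems by (intro exec_Upd) simp
    have 2: "exec (drop_all a) (s(a := l)) (2 * length l + 1) (Inl ((s(a := l))(a := [])))"
      using Cons.prems by (intro Cons.IH) auto
    have eq: "(s(a := l))(a := []) = s(a := [])" by simp
    show ?case unfolding drop_all_def
      by (rule exec_While_step'[OF 1 _ 2[unfolded drop_all_def eq]]) (use Cons.prems in auto)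
  qed
  then show ?thesis unfolding assms(2) using exec_mono assms(1,3) by blast
qed

section \<open>Numbers on stacks\<close>

text \<open>The \<open>n\<close> low digits of \<open>z\<close>, that is, \<open>z\<close> modulo
  \<open>2 ^ n\<close>. The digits are \<open>1\<close> and \<open>2\<close> because
  \<open>0\<close> is the blank.\<close>

primrec bits :: "nat \<Rightarrow> int \<Rightarrow> nat list" where
  "bits 0 z = []"
| "bits (Suc n) z = bit_sym (odd z) # bits n (z div 2)"

lemma length_bits [simp]: "length (bits n z) = n"
  by (induction n arbitrary: z) auto

lemma set_bits: "set (bits n z) \<subseteq> {1, 2}"
  by (induction n arbitrary: z) (auto simp: bit_sym_def)

text \<open>Two's complement, least significant digit first; the last digit is the sign.\<close>

fun sval :: "nat list \<Rightarrow> int" where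
  "sval [] = 0"
| "sval [a] = (if a = 2 then -1 else 0)"
| "sval (a # b # l) = (if a = 2 then 1 else 0) + 2 * sval (b # l)"

lemma bits_0: "bits n 0 = replicate n 1"
  by (induction n) (auto simp: bit_sym_def)

lemma bits_minus1: "bits n (-1) = replicate n 2"
  by (induction n) (auto simp: bit_sym_def)

text \<open>Sign extension: repeating the last digit preserves the value in two's complement. The
  empty word has value \<open>0\<close> and is padded with zero digits.\<close>

lemma bits_sval:
  assumes "set l \<subseteq> {1, 2}" "length l \<le> n"
  shows "l @ replicate (n - length l) (if top0 (rev l) = 2 then 2 else 1) = bits n (sval l)"
  using assms
proof (induction l arbitrary: n rule: sval.induct)
  case 1 then show ?case by (simp add: bits_0)
next
  case (2 a)
  then obtain m where "n = Suc m" by (cases n) auto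
  with 2 show ?case using bits_0[of n] bits_minus1[of n] by auto
next
  case (3 a b l)
  then obtain m where m: "n = Suc m" by (cases n) auto
  have "(b # l) @ replicate (m - length (b # l)) (if top0 (rev (b # l)) = 2 then 2 else 1) = bits m (sval (b # l))"
    using 3 m by (intro "3.IH") auto
  then show ?case using 3 m by (auto simp: bit_sym_def top0_append)
qed

lemma sval_bound: "- (2 ^ length l) \<le> sval l \<and> sval l < 2 ^ length l"
  by (induction l rule: sval.induct) auto

text \<open>A number between \<open>- (2 ^ n)\<close> and \<open>2 ^ n\<close> needs
  \<open>n\<close> digits and one more for the sign.\<close>

lemma sval_bits:
  assumes "- (2 ^ n) \<le> z" "z < 2 ^ n"
  shows "sval (bits (Suc n) z) = z"
  using assms
proof (induction n arbitrary: z)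
  case 0
  then have "z = -1 \<or> z = 0" by auto
  then show ?case by (auto simp: bit_sym_def)
next
  case (Suc n)
  have "sval (bits (Suc n) (z div 2)) = z div 2" using Suc.prems by (intro Suc.IH) auto
  moreover have "of_bool (odd z) + 2 * (z div 2) = z" by (cases "odd z") (auto elim: oddE)
  ultimately show ?case by (auto simp: bit_sym_def)
qed

lemma last_bits:
  assumes "- (2 ^ n) \<le> z" "z < 2 ^ n"
  shows "last (bits (Suc n) z) = bit_sym (z < 0)"
  using assms
proof (induction n arbitrary: z)
  case 0
  then have "z = -1 \<or> z = 0" by auto
  then show ?case by (auto simp: bit_sym_def)
next
  case (Suc n)
  have "last (bits (Suc n) (z div 2)) = bit_sym (z div 2 < 0)" using Suc.prems by (intro Suc.IH) auto
  then show ?case by (auto simp: pos_imp_zdiv_neg_iff)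
qed

text \<open>One's complement on digits; together with an initial carry it yields the
  negative.\<close>

definition flip :: "bool \<Rightarrow> int \<Rightarrow> int" where
  "flip f a = (if f then - a - 1 else a)"

lemma flip_odd: "odd (flip f a) \<longleftrightarrow> odd a \<noteq> f" and flip_div: "flip f a div 2 = flip f (a div 2)"
proof -
  show "odd (flip f a) \<longleftrightarrow> odd a \<noteq> f" by (auto simp: flip_def)
  have "(- a - 1) div 2 = - (a div 2) - 1" by presburger
  then show "flip f a div 2 = flip f (a div 2)" by (simp add: flip_def)
qed

lemma full_adder:
  fixes x y :: int
  shows "odd (x + y + of_bool c) \<longleftrightarrow> ((odd x \<noteq> odd y) \<noteq> c)"
    "(x + y + of_bool c) div 2 = x div 2 + y div 2 + of_bool (odd x \<and> odd y \<or> c \<and> (odd x \<or> odd y))"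
proof -
  show "odd (x + y + of_bool c) \<longleftrightarrow> ((odd x \<noteq> odd y) \<noteq> c)" by auto
  have "x = 2 * (x div 2) + of_bool (odd x)" "y = 2 * (y div 2) + of_bool (odd y)"     using mult_div_mod_eq[of 2 x] mult_div_mod_eq[of 2 y] by (simp_all add: mod_2_eq_odd)
  then obtain x' y' a b where "x = 2 * x' + of_bool a" "y = 2 * y' + of_bool b" by blast
  then show "(x + y + of_bool c) div 2 = x div 2 + y div 2 + of_bool (odd x \<and> odd y \<or> c \<and> (odd x \<or> odd y))"
    by (cases a; cases b; cases c) auto
qed

section \<open>The program\<close>

text \<open>Stacks: 0 input, 1 certificate, 2 tokens, 3 valuation table, 4 unary word length, 5 values,
  6 variable name, 7 matched part of the name, 8 visited part of the table, 9 used part of the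
  unary length, 10 looked-up digits, 11 and 12 operands, 13 scratch symbol.

  Table symbols: 8 and 9 are digits of a variable, 10 and 11 are digits of its value, and any other symbol
  ends an entry. Tokens: 8 variable (followed by its digits), 9 zero, 10 subtraction,
  11 \<open>+\<close>, 12 \<open>\<rightarrow>\<close>, 13 \<open>\<Rightarrow>\<close>; negation is subtraction from zero.\<close>

definition read_bit :: "nat \<Rightarrow> com" where
  "read_bit a = Upd (\<lambda>t. no_act(a := Pop, 13 := Repl (min 15 (2 * t 13 + (if t a = 2 then 1 else 0)))))"

text \<open>The scratch symbol starts at \<open>1\<close>, so three bits shifted in give a symbol
  from \<open>8\<close> to \<open>15\<close>; bits missing at the end read as \<open>0\<close>. Each
  table symbol lengthens the words on stack 4 by one.\<close>

definition load_table :: com where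
  "load_table = While (\<lambda>t. t 1 \<noteq> 0) (Upd (\<lambda>t. no_act(13 := Push 1)) ;;
     read_bit 1 ;; read_bit 1 ;; read_bit 1 ;;
     Upd (\<lambda>t. no_act(13 := Pop, 3 := Push (t 13), 4 := Push 1)))"

text \<open>Running out of input means acceptance: words that encode no formula belong to the
  complement.\<close>

definition need_bit :: com where
  "need_bit = Cond (\<lambda>t. t 0 = 0) (Halt True) (read_bit 0)"

abbreviation digit_loop :: com where
  "digit_loop \<equiv> While (\<lambda>t. t 0 = 2) (Upd (\<lambda>t. no_act(0 := Pop)) ;;
     Cond (\<lambda>t. t 0 = 0) (Halt True) (Upd (\<lambda>t. no_act(0 := Pop, 2 := Push (t 0)))))"

text \<open>After the loop a \<open>1\<close> on stack 2 is a zero as most significant digit, which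
  the encoding excludes. If no digit was read, stack 2 shows the previous token or is empty, and
  neither gives \<open>1\<close>.\<close>

definition read_var :: com where
  "read_var = digit_loop ;;
     Cond (\<lambda>t. t 0 = 0 \<or> t 2 = 1) (Halt True) (Upd (\<lambda>t. no_act(0 := Pop, 2 := Push 8)))"

text \<open>With the leading \<open>1\<close>, the three-bit tag already is the token. Only negation
  differs: \<open>9\<close> is pushed above \<open>10\<close>, so a zero is produced first and the
  operand is then subtracted from it.\<close>

abbreviation push_token :: com where
  "push_token \<equiv> Cond (\<lambda>t. t 13 = 8) read_var
       (Cond (\<lambda>t. t 13 \<ge> 14) (Halt True)
         (Cond (\<lambda>t. t 13 = 10) (Upd (\<lambda>t. no_act(2 := Push 10)) ;; Upd (\<lambda>t. no_act(2 := Push 9)))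
           (Upd (\<lambda>t. no_act(2 := Push (t 13))))))"

definition read_token :: com where
  "read_token = Upd (\<lambda>t. no_act(13 := Push 1)) ;; need_bit ;; need_bit ;; need_bit ;;
     push_token ;;
     Upd (\<lambda>t. no_act(13 := Pop, 4 := Push 1))"

text \<open>A mismatch sets the flag to \<open>2\<close> until the entry ends; then the name is
  restored from stack 7. Each digit collected moves one unit from stack 4 to stack 9, so what is
  left on 4 counts the digits still missing.\<close>

definition scan_update :: com where
  "scan_update =
     Cond (\<lambda>t. t 3 = 8 \<or> t 3 = 9)
       (Cond (\<lambda>t. t 13 = 1 \<and> t 6 = t 3 - 7)
         (Upd (\<lambda>t. no_act(6 := Pop, 7 := Push (t 6)))) (Upd (\<lambda>t. no_act(13 := Repl 2))))
       (Cond (\<lambda>t. t 3 = 10 \<or> t 3 = 11)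
         (Cond (\<lambda>t. t 13 = 1 \<and> t 6 = 0)
           (Upd (\<lambda>t. no_act(10 := Push (t 3 - 9), 4 := Pop, 9 := Push 1))) (Upd (\<lambda>t. no_act)))
         (move (\<lambda>a. a \<noteq> 0) id 7 6 ;; Upd (\<lambda>t. no_act(13 := Repl 1))))"

definition scan_step :: com where
  "scan_step = scan_update ;; Upd (\<lambda>t. no_act(3 := Pop, 8 := Push (t 3)))"

definition scan_loop :: com where
  "scan_loop = While (\<lambda>t. t 3 \<noteq> 0) scan_step"

abbreviation pad_loop :: com where
  "pad_loop \<equiv> While (\<lambda>t. t 4 \<noteq> 0)
     (Upd (\<lambda>t. no_act(4 := Pop, 9 := Push 1, 10 := Push (if t 10 = 2 then 2 else 1))))"

text \<open>Stack 10 has its most significant digit on top, so repeating the top is sign extension.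
  If it is empty, zero digits are produced.\<close>

definition push_padded :: com where
  "push_padded =
     pad_loop ;;
     Upd (\<lambda>t. no_act(5 := Push 3)) ;; move (\<lambda>a. a \<noteq> 0) id 10 5 ;; move (\<lambda>a. a \<noteq> 0) id 9 4"

definition push_var :: com where
  "push_var = Upd (\<lambda>t. no_act(2 := Pop, 13 := Push 1)) ;; move (\<lambda>a. a = 1 \<or> a = 2) id 2 6 ;;
     scan_loop ;; move (\<lambda>a. a \<noteq> 0) id 8 3 ;; Upd (\<lambda>t. no_act(13 := Pop)) ;; push_padded ;;
     drop_all 6 ;; drop_all 7"

text \<open>One ripple-carry adder serves all operators: the operator on top of stack 2 decides
  which operand is complemented.\<close>

definition add_loop :: com where
  "add_loop = While (\<lambda>t. t 12 \<noteq> 0) (Upd (\<lambda>t.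
     let x = (t 12 = 2) \<noteq> (t 2 = 12 \<or> t 2 = 13); y = (t 5 = 2) \<noteq> (t 2 = 10); c = (t 13 = 2) in
       no_act(12 := Pop, 5 := Pop, 11 := Push (bit_sym ((x \<noteq> y) \<noteq> c)),
         13 := Repl (bit_sym (x \<and> y \<or> c \<and> (x \<or> y))))))"

definition pop_value :: com where
  "pop_value = Cond (\<lambda>t. t 5 = 0) (Halt True) (move (\<lambda>a. a \<noteq> 3) id 5 11 ;; Upd (\<lambda>t. no_act(5 := Pop)))"

text \<open>Only the first operand is popped. The second is consumed in place, and its separator is
  reused for the result. The sum ends up on stack 11 with the sign on top, ready for the test that
  \<open>min\<close> requires.\<close>

definition binary_op :: com where
  "binary_op = pop_value ;; Cond (\<lambda>t. t 5 = 0) (Halt True)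
     (move (\<lambda>a. a \<noteq> 0) id 11 12 ;; Upd (\<lambda>t. no_act(13 := Push (if t 2 = 11 then 1 else 2))) ;;
      add_loop ;; Upd (\<lambda>t. no_act(13 := Pop)) ;;
      Cond (\<lambda>t. t 2 = 13 \<and> t 11 = 1) (move (\<lambda>a. a \<noteq> 0) (\<lambda>_. 1) 11 5) (move (\<lambda>a. a \<noteq> 0) id 11 5) ;;
      Upd (\<lambda>t. no_act(2 := Pop)))"

definition eval_token :: com where
  "eval_token = Cond (\<lambda>t. t 2 = 8) push_var
     (Cond (\<lambda>t. t 2 = 9) (Upd (\<lambda>t. no_act(2 := Pop)) ;; push_padded) binary_op)"

abbreviation read_loop :: com where
  "read_loop \<equiv> While (\<lambda>t. t 0 \<noteq> 0) read_token"

abbreviation eval_loop :: com where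
  "eval_loop \<equiv> While (\<lambda>t. t 2 \<noteq> 0) eval_token"

text \<open>The first unit pushed on stack 4 provides the sign digit. Rejection requires exactly one
  value, with sign digit zero; in all other cases the formula is refuted or the word is
  ill-formed.\<close>

definition program :: com where
  "program = Upd (\<lambda>t. no_act(4 := Push 1)) ;; load_table ;; read_loop ;; eval_loop ;; pop_value ;;
     Cond (\<lambda>t. t 5 = 0 \<and> t 11 = 1) (Halt False) (Halt True)"

lemmas program_defs = program_def eval_token_def binary_op_def pop_value_def add_loop_def push_var_def
  push_padded_def scan_loop_def scan_step_def scan_update_def read_token_def read_var_def need_bit_def load_table_def
  read_bit_def move_def drop_all_def

text \<open>The check ranges over all tops, reachable or not; the cap \<open>min 15\<close> in
  \<open>read_bit\<close> is there to keep symbols below \<open>16\<close>.\<close>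

lemma ok_program: "ok_com 14 16 program"
  by (auto simp: program_defs Let_def bit_sym_def intro: le_less_trans[OF diff_le_self])


text \<open>The induction generalises over the incoming carry. The outgoing carry \<open>x\<close>
  is left unspecified, since \<open>bits n\<close> takes the sum modulo
  \<open>2 ^ n\<close>.\<close>

lemma exec_add_loop:
  assumes "s 12 = bits n a" "s 5 = bits n b @ l" "s 13 = [bit_sym c]"
    "fa \<longleftrightarrow> top0 (s 2) = 12 \<or> top0 (s 2) = 13" "fb \<longleftrightarrow> top0 (s 2) = 10" "2 * n + 1 \<le> m"
  shows "\<exists>x. exec add_loop s m (Inl (s(12 := [], 5 := l,
    11 := rev (bits n (flip fa a + flip fb b + of_bool c)) @ s 11, 13 := [x])))"
  using assms
proof (induction n arbitrary: a b c s m)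
  case 0
  then have "s(12 := [], 5 := l, 11 := rev (bits 0 (flip fa a + flip fb b + of_bool c)) @ s 11, 13 := [bit_sym c]) = s"
    by (auto simp: fun_eq_iff)
  moreover have "exec add_loop s m (Inl s)"
    unfolding add_loop_def using 0 by (intro exec_While_end') auto
  ultimately show ?case by metis
next
  case (Suc n)
  define x where "x \<longleftrightarrow> odd (flip fa a)"
  define y where "y \<longleftrightarrow> odd (flip fb b)"
  define c' where "c' \<longleftrightarrow> x \<and> y \<or> c \<and> (x \<or> y)"
  define t where "t = s(12 := bits n (a div 2), 5 := bits n (b div 2) @ l,
    11 := bit_sym ((x \<noteq> y) \<noteq> c) # s 11, 13 := [bit_sym c'])"
  have sym: "bit_sym b = 2 \<longleftrightarrow> b" for b by (simp add: bit_sym_def)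
  have 1: "exec (Upd (\<lambda>t. let x = (t 12 = 2) \<noteq> (t 2 = 12 \<or> t 2 = 13); y = (t 5 = 2) \<noteq> (t 2 = 10); c = (t 13 = 2) in
       no_act(12 := Pop, 5 := Pop, 11 := Push (bit_sym ((x \<noteq> y) \<noteq> c)),
         13 := Repl (bit_sym (x \<and> y \<or> c \<and> (x \<or> y)))))) s 1 (Inl t)"
    using Suc.prems(1-3) by (intro exec_Upd)
      (simp add: t_def c'_def x_def y_def flip_odd sym Suc.prems(4,5) Let_def fun_eq_iff)
  have "\<exists>z. exec add_loop t (m - 2) (Inl (t(12 := [], 5 := l,
    11 := rev (bits n (flip fa (a div 2) + flip fb (b div 2) + of_bool c')) @ t 11, 13 := [z])))"
    using Suc.prems by (intro Suc.IH) (simp_all add: t_def)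
  then obtain z where 2: "exec add_loop t (m - 2) (Inl (t(12 := [], 5 := l,
    11 := rev (bits n (flip fa (a div 2) + flip fb (b div 2) + of_bool c')) @ t 11, 13 := [z])))" ..
  have eq: "t(12 := [], 5 := l, 11 := rev (bits n (flip fa (a div 2) + flip fb (b div 2) + of_bool c')) @ t 11, 13 := [z])
    = s(12 := [], 5 := l, 11 := rev (bits (Suc n) (flip fa a + flip fb b + of_bool c)) @ s 11, 13 := [z])"
    using full_adder[of "flip fa a" "flip fb b" c]
    by (simp add: t_def fun_eq_iff flip_div x_def y_def c'_def)
  have "exec add_loop s m (Inl (t(12 := [], 5 := l,
    11 := rev (bits n (flip fa (a div 2) + flip fb (b div 2) + of_bool c')) @ t 11, 13 := [z])))"
    unfolding add_loop_def
    by (rule exec_While_step'[OF 1 _ 2[unfolded add_loop_def]]) (use Suc.prems in \<open>auto simp: bit_sym_def\<close>)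
  then show ?case unfolding eq by blast
qed

lemma exec_pad_loop:
  assumes "s 4 = replicate j 1" "s 9 = replicate i 1" "s 10 = rev l" "2 * j + 1 \<le> n"
    "s' = s(4 := [], 9 := replicate (i + j) 1, 10 := rev (l @ replicate j (if top0 (rev l) = 2 then 2 else 1)))"
  shows "exec pad_loop s n (Inl s')"
  using assms
proof (induction j arbitrary: s i l n)
  case 0
  then have "s' = s" by (auto simp: fun_eq_iff)
  with 0 show ?case by (intro exec_While_end') auto
next
  case (Suc j)
  let ?p = "if top0 (rev l) = 2 then 2 else 1"
  define t where "t = s(4 := replicate j 1, 9 := replicate (Suc i) 1, 10 := rev (l @ [?p]))"
  have 1: "exec (Upd (\<lambda>t. no_act(4 := Pop, 9 := Push 1, 10 := Push (if t 10 = 2 then 2 else 1)))) s 1 (Inl t)"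
    using Suc.prems by (intro exec_Upd) (simp add: t_def fun_eq_iff)
  have 2: "exec pad_loop t (2 * j + 1) (Inl s')"
    using Suc.prems by (intro Suc.IH[of _ "Suc i" "l @ [?p]"]) (auto simp: t_def fun_eq_iff)
  show ?case by (rule exec_While_step'[OF 1 _ 2]) (use Suc.prems in simp_all)
qed

lemma exec_push_padded:
  assumes "s 4 = replicate j 1" "s 9 = replicate i 1" "s 10 = rev l" "set l \<subseteq> {1, 2}" "i = length l"
    "s' = s(4 := replicate (i + j) 1, 9 := [], 10 := [], 5 := bits (i + j) (sval l) @ 3 # s 5)"
    "6 * (i + j) + 10 \<le> n"
  shows "exec push_padded s n (Inl s')"
proof -
  define L where "L = l @ replicate j (if top0 (rev l) = 2 then 2 else 1)"
  define s1 where "s1 = s(4 := [], 9 := replicate (i + j) 1, 10 := rev L)"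
  define s2 where "s2 = s1(5 := 3 # s 5)"
  define s3 where "s3 = s2(10 := [], 5 := L @ 3 # s 5)"
  have L: "L = bits (i + j) (sval l)" using bits_sval[OF assms(4), of "i + j"] assms(5) by (simp add: L_def)
  have nz: "\<forall>x\<in>set L. x \<noteq> 0" using set_bits[of "i + j" "sval l"] unfolding L by auto
  have len: "length L = i + j" by (simp add: L)
  have 4: "exec (move (\<lambda>a. a \<noteq> 0) id 9 4) s3 (2 * (i + j) + 1) (Inl s')"
  proof (rule exec_move[where l = "replicate (i + j) 1" and l' = "[]"])
    show "s' = s3(9 := [], 4 := rev (map id (replicate (i + j) 1)) @ s3 4)"
      unfolding s3_def s2_def s1_def assms(6) L[symmetric] by (simp add: fun_eq_iff)
  qed (simp_all add: s3_def s2_def s1_def)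
  have 3: "exec (move (\<lambda>a. a \<noteq> 0) id 10 5) s2 (2 * (i + j) + 1) (Inl s3)"
    by (rule exec_move[where l = "rev L" and l' = "[]"])
      (simp_all add: s3_def s2_def s1_def nz len)
  have 2: "exec (Upd (\<lambda>t. no_act(5 := Push 3))) s1 1 (Inl s2)"
    by (rule exec_Upd) (simp add: s2_def s1_def)
  have 1: "exec pad_loop s (2 * j + 1) (Inl s1)"
    using exec_pad_loop[OF assms(1-3) order_refl s1_def[unfolded L_def]] .
  show ?thesis unfolding push_padded_def
    by (rule exec_Seq'[OF 1 exec_Seq'[OF 2 exec_Seq'[OF 3 4 order_refl] order_refl]]) (use assms(7) in simp)
qed

text \<open>The digits that scanning the table collects for a variable, given whether the current entry has
  matched so far, the remaining and the matched part of the name, and the digits collected so far.\<close>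

fun scan :: "nat list \<Rightarrow> bool \<Rightarrow> nat list \<Rightarrow> nat list \<Rightarrow> nat list \<Rightarrow> nat list" where
  "scan [] ok w w' g = g"
| "scan (a # d) ok w w' g =
    (if a = 8 \<or> a = 9 then
       (if ok \<and> top0 w = a - 7 then scan d True (tl w) ((a - 7) # w') g else scan d False w w' g)
     else if a = 10 \<or> a = 11 then scan d ok w w' (if ok \<and> w = [] then (a - 9) # g else g)
     else scan d True (rev w' @ w) [] g)"

lemma scan_digits: "set g \<subseteq> {1, 2} \<Longrightarrow> set (scan d ok w w' g) \<subseteq> {1, 2}"
  by (induction d ok w w' g rule: scan.induct) auto

definition flag :: "bool \<Rightarrow> nat" where
  "flag ok = (if ok then 1 else 2)"

text \<open>Here \<open>k\<close> counts the digits collected, hence the units moved from stack 4 to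
  stack 9. A round takes at most \<open>2 * Z + 10\<close> steps, mainly to restore a name of length
  at most \<open>Z\<close>.\<close>

lemma exec_scan_loop:
  assumes "s 3 = d" "0 \<notin> set d" "s 13 = [flag ok]" "s 6 = w" "s 7 = w'" "0 \<notin> set w \<union> set w'"
    "s 4 = replicate j 1" "s 9 = replicate i 1" "s 10 = g" "length d \<le> j"
    "length w + length w' \<le> Z" "(2 * Z + 11) * length d + 1 \<le> n"
  shows "\<exists>v v' f k. exec scan_loop s n (Inl (s(3 := [], 8 := rev d @ s 8, 13 := [f], 6 := v, 7 := v',
      4 := replicate (j - k) 1, 9 := replicate (i + k) 1, 10 := scan d ok w w' g))) \<and>
    k \<le> length d \<and> length (scan d ok w w' g) = length g + k \<and> length v + length v' \<le> Z \<and> 0 \<notin> set v \<union> set v'"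
  using assms
proof (induction d ok w w' g arbitrary: s i j n rule: scan.induct)
  case (1 ok w w' g)
  have eq: "s(3 := [], 8 := rev [] @ s 8, 13 := [flag ok], 6 := w, 7 := w',
      4 := replicate (j - 0) 1, 9 := replicate (i + 0) 1, 10 := scan [] ok w w' g) = s"
    using 1 by (auto simp: fun_eq_iff)
  have "exec scan_loop s n (Inl (s(3 := [], 8 := rev [] @ s 8, 13 := [flag ok], 6 := w, 7 := w',
      4 := replicate (j - 0) 1, 9 := replicate (i + 0) 1, 10 := scan [] ok w w' g)))"
    unfolding scan_loop_def using 1 eq by (intro exec_While_end') simp_all
  moreover have "length (scan [] ok w w' g) = length g + 0" "length w + length w' \<le> Z" "0 \<notin> set w \<union> set w'"
    using 1 by simp_all
  ultimately show ?case by blast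
next
  case (2 a d ok w w' g)
  note prems = "2.prems"
  have last: "exec (Upd (\<lambda>t. no_act(3 := Pop, 8 := Push (t 3)))) t 1 (Inl (t(3 := d, 8 := a # s 8)))"
    if "t 3 = a # d" "t 8 = s 8" for t
    using that by (intro exec_Upd) (simp add: fun_eq_iff)
  text \<open>One round changes the state of the scan to \<open>ok'\<close>, \<open>v\<close>, \<open>v'\<close> and \<open>g'\<close>, using up \<open>kk\<close> units of the
    word length.\<close>
  have round: ?case
    if step: "exec scan_update s (2 * Z + 8)
         (Inl (s(13 := [flag ok'], 6 := v, 7 := v', 4 := replicate (j - kk) 1, 9 := replicate (i + kk) 1, 10 := g')))"
    and kk: "kk \<le> 1" "length g' = length g + kk" "scan (a # d) ok w w' g = scan d ok' v v' g'"
    and IH: "\<And>s i j n. s 3 = d \<Longrightarrow> 0 \<notin> set d \<Longrightarrow> s 13 = [flag ok'] \<Longrightarrow> s 6 = v \<Longrightarrow> s 7 = v' \<Longrightarrow>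
      0 \<notin> set v \<union> set v' \<Longrightarrow> s 4 = replicate j 1 \<Longrightarrow> s 9 = replicate i 1 \<Longrightarrow> s 10 = g' \<Longrightarrow> length d \<le> j \<Longrightarrow>
      length v + length v' \<le> Z \<Longrightarrow> (2 * Z + 11) * length d + 1 \<le> n \<Longrightarrow>
      \<exists>u u' f k. exec scan_loop s n (Inl (s(3 := [], 8 := rev d @ s 8, 13 := [f], 6 := u, 7 := u',
        4 := replicate (j - k) 1, 9 := replicate (i + k) 1, 10 := scan d ok' v v' g'))) \<and>
      k \<le> length d \<and> length (scan d ok' v v' g') = length g' + k \<and> length u + length u' \<le> Z \<and> 0 \<notin> set u \<union> set u'"
    and v: "0 \<notin> set v \<union> set v'" "length v + length v' \<le> Z" for ok' v v' g' kk
  proof -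
    define t where "t = s(13 := [flag ok'], 6 := v, 7 := v', 4 := replicate (j - kk) 1, 9 := replicate (i + kk) 1,
      10 := g', 3 := d, 8 := a # s 8)"
    have body: "exec scan_step s (2 * Z + 10) (Inl t)"
      unfolding scan_step_def t_def
      by (rule exec_Seq'[OF step last]) (use prems in simp_all)
    have "\<exists>u u' f k. exec scan_loop t ((2 * Z + 11) * length d + 1) (Inl (t(3 := [], 8 := rev d @ t 8, 13 := [f], 6 := u, 7 := u',
        4 := replicate (j - kk - k) 1, 9 := replicate (i + kk + k) 1, 10 := scan d ok' v v' g'))) \<and>
      k \<le> length d \<and> length (scan d ok' v v' g') = length g' + k \<and> length u + length u' \<le> Z \<and> 0 \<notin> set u \<union> set u'"
      by (rule IH) (use prems kk v in \<open>auto simp: t_def\<close>)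
    then obtain u u' f k where u: "exec scan_loop t ((2 * Z + 11) * length d + 1) (Inl (t(3 := [], 8 := rev d @ t 8, 13 := [f],
        6 := u, 7 := u', 4 := replicate (j - kk - k) 1, 9 := replicate (i + kk + k) 1, 10 := scan d ok' v v' g')))"
      "k \<le> length d" "length (scan d ok' v v' g') = length g' + k" "length u + length u' \<le> Z" "0 \<notin> set u \<union> set u'"
      by blast
    have eq: "t(3 := [], 8 := rev d @ t 8, 13 := [f],
        6 := u, 7 := u', 4 := replicate (j - kk - k) 1, 9 := replicate (i + kk + k) 1, 10 := scan d ok' v v' g')
      = s(3 := [], 8 := rev (a # d) @ s 8, 13 := [f], 6 := u, 7 := u',
        4 := replicate (j - (kk + k)) 1, 9 := replicate (i + (kk + k)) 1, 10 := scan (a # d) ok w w' g)"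
      unfolding kk(3) by (simp add: t_def fun_eq_iff add.assoc)
    have "exec scan_loop s n (Inl (s(3 := [], 8 := rev (a # d) @ s 8, 13 := [f], 6 := u, 7 := u',
        4 := replicate (j - (kk + k)) 1, 9 := replicate (i + (kk + k)) 1, 10 := scan (a # d) ok w w' g)))"
      unfolding eq[symmetric] unfolding scan_loop_def
      by (rule exec_While_step'[OF body _ u(1)[unfolded scan_loop_def]]) (use prems in auto)
    moreover have "kk + k \<le> length (a # d)" using kk(1) u(2) by simp
    moreover have "length (scan (a # d) ok w w' g) = length g + (kk + k)"
      unfolding kk(3) using kk(2) u(3) by simp
    ultimately show ?thesis using u(4,5) by blast
  qed
  show ?case
  proof (cases "a = 8 \<or> a = 9")
    case name: True
    show ?thesis
    proof (cases "ok \<and> top0 w = a - 7")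
      case True
      then obtain w0 where w: "w = (a - 7) # w0" using name by (cases w) auto
      show ?thesis
      proof (rule round[where kk = 0, OF _ _ _ _ "2.IH"(1)[OF name True]])
        show "exec scan_update s (2 * Z + 8)
           (Inl (s(13 := [flag True], 6 := tl w, 7 := (a - 7) # w', 4 := replicate (j - 0) 1,
             9 := replicate (i + 0) 1, 10 := g)))"
          unfolding scan_update_def by (rule exec_Cond_True[OF _ exec_Cond_True[OF _ exec_Upd order_refl]])
            (use prems name True in \<open>auto simp: w flag_def fun_eq_iff\<close>)
      qed (use prems name True in \<open>auto simp: w\<close>)
    next
      case False
      show ?thesis
      proof (rule round[where kk = 0, OF _ _ _ _ "2.IH"(2)[OF name False]])
        show "exec scan_update s (2 * Z + 8)
           (Inl (s(13 := [flag False], 6 := w, 7 := w', 4 := replicate (j - 0) 1,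
             9 := replicate (i + 0) 1, 10 := g)))"
          unfolding scan_update_def by (rule exec_Cond_True[OF _ exec_Cond_False[OF _ exec_Upd order_refl]])
            (use prems name False in \<open>auto simp: flag_def fun_eq_iff split: if_splits\<close>)
      qed (use prems name False in auto)
    qed
  next
    case not_name: False
    show ?thesis
    proof (cases "a = 10 \<or> a = 11")
      case digit: True
      show ?thesis
      proof (rule round[where kk = "if ok \<and> w = [] then 1 else 0", OF _ _ _ _ "2.IH"(3)[OF not_name digit]])
        show "exec scan_update s (2 * Z + 8)
           (Inl (s(13 := [flag ok], 6 := w, 7 := w', 4 := replicate (j - (if ok \<and> w = [] then 1 else 0)) 1,
             9 := replicate (i + (if ok \<and> w = [] then 1 else 0)) 1, 10 := if ok \<and> w = [] then (a - 9) # g else g)))"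
        proof (cases "ok \<and> w = []")
          case True
          have "tl (replicate j (1::nat)) = replicate (j - 1) 1" by (cases j) auto
          then show ?thesis unfolding scan_update_def
            by (intro exec_Cond_False[OF _ exec_Cond_True[OF _ exec_Cond_True[OF _ exec_Upd order_refl] order_refl]])
              (use prems not_name digit True in \<open>auto simp: flag_def fun_eq_iff\<close>)
        next
          case False
          then have "\<not> (top0 (s 13) = 1 \<and> top0 (s 6) = 0)"
            using prems by (cases w) (auto simp: flag_def)
          then show ?thesis unfolding scan_update_def
            by (intro exec_Cond_False[OF _ exec_Cond_True[OF _ exec_Cond_False[OF _ exec_Upd order_refl] order_refl]])
              (use prems not_name digit False in \<open>auto simp: flag_def fun_eq_iff\<close>)
        qed
      qed (use prems not_name digit in auto)
    next
      case False
      show ?thesis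
      proof (rule round[where kk = 0, OF _ _ _ _ "2.IH"(4)[OF not_name False]])
        have m: "exec (move (\<lambda>a. a \<noteq> 0) id 7 6) s (2 * Z + 1) (Inl (s(7 := [], 6 := rev w' @ w)))"
          by (rule exec_move[where l = w' and l' = "[]"]) (use prems in \<open>auto intro: ccontr\<close>)
        show "exec scan_update s (2 * Z + 8)
           (Inl (s(13 := [flag True], 6 := rev w' @ w, 7 := [], 4 := replicate (j - 0) 1,
             9 := replicate (i + 0) 1, 10 := g)))"
          unfolding scan_update_def by (rule exec_Cond_False[OF _ exec_Cond_False[OF _ exec_Seq'[OF m exec_Upd order_refl] order_refl]])
            (use prems not_name False in \<open>auto simp: flag_def fun_eq_iff\<close>)
      qed (use prems not_name False in auto)
    qed
  qed
qed

section \<open>Operations on the stack of values\<close>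

definition value_stack :: "nat \<Rightarrow> int list \<Rightarrow> nat list" where
  "value_stack N vs = concat (map (\<lambda>z. bits N z @ [3]) vs)"

lemma value_stack_simps [simp]:
  "value_stack N [] = []" "value_stack N (z # vs) = bits N z @ 3 # value_stack N vs"
  by (auto simp: value_stack_def)

definition eval_store :: "nat list \<Rightarrow> nat list \<Rightarrow> nat \<Rightarrow> int list \<Rightarrow> store" where
  "eval_store ts d N vs = empty_store(2 := ts, 3 := d, 4 := replicate N 1, 5 := value_stack N vs)"

definition lookup :: "nat list \<Rightarrow> nat list \<Rightarrow> int" where
  "lookup d w = sval (rev (scan d True w [] []))"

text \<open>The conditions on \<open>top0 ts\<close> stop the transfer of the name at the next
  token. Afterwards stacks 4 and 9 together again hold \<open>N\<close> units, as only
  \<open>k\<close> of them were moved.\<close>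

lemma exec_push_var:
  assumes "top0 ts \<noteq> 1" "top0 ts \<noteq> 2" "set w \<subseteq> {1, 2}" "0 \<notin> set d" "length d \<le> N" "N \<le> Z" "length w \<le> Z"
  shows "exec push_var (eval_store (8 # rev w @ ts) d N vs) ((2 * Z + 11) * Z + 14 * Z + 30)
    (Inl (eval_store ts d N (lookup d w # vs)))"
proof -
  define s0 where "s0 = eval_store (8 # rev w @ ts) d N vs"
  define s1 where "s1 = s0(2 := rev w @ ts, 13 := [1])"
  define s2 where "s2 = s1(2 := ts, 6 := w)"
  have w0: "0 \<notin> set w \<union> set []" using assms(3) by auto
  obtain v v' f k where scan: "exec scan_loop s2 ((2 * Z + 11) * length d + 1) (Inl (s2(3 := [], 8 := rev d @ s2 8, 13 := [f],
      6 := v, 7 := v', 4 := replicate (N - k) 1, 9 := replicate (0 + k) 1, 10 := scan d True w [] [])))"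
    and k: "k \<le> length d" "length (scan d True w [] []) = length [] + k" "length v + length v' \<le> Z" "0 \<notin> set v \<union> set v'"
    using exec_scan_loop[of s2 d True w "[]" N 0 "[]" Z, OF _ assms(4) _ _ _ w0 _ _ _ assms(5) _ order_refl] assms(7)
    by (auto simp: s2_def s1_def s0_def eval_store_def flag_def)
  define G where "G = scan d True w [] []"
  define s3 where "s3 = s2(3 := [], 8 := rev d @ s2 8, 13 := [f],
      6 := v, 7 := v', 4 := replicate (N - k) 1, 9 := replicate (0 + k) 1, 10 := G)"
  define s4 where "s4 = s3(8 := [], 3 := d)"
  define s5 where "s5 = s4(13 := [])"
  define s6 where "s6 = s5(4 := replicate (k + (N - k)) 1, 9 := [], 10 := [], 5 := bits (k + (N - k)) (sval (rev G)) @ 3 # s5 5)"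
  define s7 where "s7 = s6(6 := [])"
  have G: "set (rev G) \<subseteq> {1, 2}" unfolding G_def using scan_digits[of "[]"] by simp
  have 1: "exec (Upd (\<lambda>t. no_act(2 := Pop, 13 := Push 1))) s0 1 (Inl s1)"
    by (rule exec_Upd) (simp add: s1_def s0_def eval_store_def fun_eq_iff)
  have 2: "exec (move (\<lambda>a. a = 1 \<or> a = 2) id 2 6) s1 (2 * Z + 1) (Inl s2)"
    by (rule exec_move[where l = "rev w" and l' = ts])
      (use assms in \<open>auto simp: s2_def s1_def s0_def eval_store_def\<close>)
  have 3: "exec scan_loop s2 ((2 * Z + 11) * Z + 1) (Inl s3)"
    unfolding s3_def G_def by (rule exec_mono[OF scan]) (use assms(5,6) in simp)
  have 4: "exec (move (\<lambda>a. a \<noteq> 0) id 8 3) s3 (2 * Z + 1) (Inl s4)"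
    by (rule exec_move[where l = "rev d" and l' = "[]"])
      (use assms in \<open>auto simp: s4_def s3_def s2_def s1_def s0_def eval_store_def intro: ccontr\<close>)
  have 5: "exec (Upd (\<lambda>t. no_act(13 := Pop))) s4 1 (Inl s5)"
    by (rule exec_Upd) (simp add: s5_def s4_def s3_def)
  have 6: "exec push_padded s5 (6 * Z + 10) (Inl s6)"
    by (rule exec_push_padded[OF _ _ _ G _ s6_def])
      (use k assms in \<open>simp_all add: s5_def s4_def s3_def G_def\<close>)
  have 7: "exec (drop_all 6) s6 (2 * Z + 1) (Inl s7)"
    by (rule exec_drop_all[OF _ s7_def]) (use k in \<open>simp_all add: s6_def s5_def s4_def s3_def\<close>)
  have 8: "exec (drop_all 7) s7 (2 * Z + 1) (Inl (eval_store ts d N (lookup d w # vs)))"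
  proof (rule exec_drop_all)
    have "k + (N - k) = N" using k(1) assms(5) by simp
    then show "eval_store ts d N (lookup d w # vs) = s7(7 := [])"
      by (simp add: s7_def s6_def s5_def s4_def s3_def s2_def s1_def s0_def eval_store_def lookup_def G_def fun_eq_iff)
  qed (use k in \<open>simp_all add: s7_def s6_def s5_def s4_def s3_def\<close>)
  show ?thesis unfolding push_var_def s0_def[symmetric]
    by (rule exec_mono[OF exec_Seq[OF 1 exec_Seq[OF 2 exec_Seq[OF 3 exec_Seq[OF 4 exec_Seq[OF 5
      exec_Seq[OF 6 exec_Seq[OF 7 8]]]]]]]]) simp
qed

lemma exec_pop_value:
  assumes "s 5 = bits N z @ 3 # l" "s 11 = []" "1 \<le> N" "s' = s(5 := l, 11 := rev (bits N z))"
  shows "exec pop_value s (2 * N + 5) (Inl s')"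
proof -
  define s1 where "s1 = s(5 := 3 # l, 11 := rev (bits N z))"
  have b: "\<forall>x\<in>set (bits N z). x \<noteq> 3" using set_bits[of N z] by auto
  have "top0 (bits N z) \<noteq> 0" using assms(3) by (cases N) (simp_all add: bit_sym_def)
  then have "top0 (s 5) \<noteq> 0" using assms(1,3) by (auto simp: top0_append)
  moreover have 1: "exec (move (\<lambda>a. a \<noteq> 3) id 5 11) s (2 * N + 1) (Inl s1)"
    by (rule exec_move[where l = "bits N z" and l' = "3 # l"]) (use assms b in \<open>simp_all add: s1_def\<close>)
  moreover have 2: "exec (Upd (\<lambda>t. no_act(5 := Pop))) s1 1 (Inl s')"
    by (rule exec_Upd) (simp add: s1_def assms(4) fun_eq_iff)
  ultimately show ?thesis unfolding pop_value_def
    by (intro exec_Cond_False[OF _ exec_Seq[OF 1 2]]) simp_all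
qed

lemma exec_pop_value_exit: "s 5 = [] \<Longrightarrow> exec pop_value s (2 * N + 5) (Inr True)"
  unfolding pop_value_def by (rule exec_Cond_True[OF _ exec_Halt]) simp_all

definition binop :: "nat \<Rightarrow> int \<Rightarrow> int \<Rightarrow> int" where
  "binop t a b = (if t = 10 then a - b else if t = 11 then a + b else if t = 12 then b - a else min 0 (b - a))"

lemma top0_rev: "l \<noteq> [] \<Longrightarrow> top0 (rev l) = last l"
  by (cases l rule: rev_cases) auto

text \<open>The adder yields \<open>bits N\<close> of the exact result. The range condition ensures
  that the last digit of \<open>b - a\<close> is its sign, on which the operator \<open>13\<close>
  branches.\<close>

lemma exec_binary_op:
  assumes t: "t \<in> {10, 11, 12, 13}" and N: "N = Suc n" and b: "- (2 ^ n) \<le> b - a" "b - a < 2 ^ n"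
  shows "exec binary_op (eval_store (t # ts) d N (a # b # vs)) (8 * N + 30)
    (Inl (eval_store ts d N (binop t a b # vs)))"
proof -
  define V where "V = value_stack N vs"
  define s0 where "s0 = eval_store (t # ts) d N (a # b # vs)"
  define s1 where "s1 = s0(5 := bits N b @ 3 # V, 11 := rev (bits N a))"
  define s2 where "s2 = s1(11 := [], 12 := bits N a)"
  define s3 where "s3 = s2(13 := [bit_sym (t \<noteq> 11)])"
  define r where "r = flip (top0 (s3 2) = 12 \<or> top0 (s3 2) = 13) a + flip (top0 (s3 2) = 10) b + of_bool (t \<noteq> 11)"
  have s: "s0 2 = t # ts" "s0 3 = d" "s0 4 = replicate N 1" "s0 5 = bits N a @ 3 # bits N b @ 3 # V" "s0 11 = []" "s0 12 = []" "s0 13 = []"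
    by (simp_all add: s0_def eval_store_def V_def)
  have r: "r = (if t = 10 then a - b else if t = 11 then a + b else b - a)"
    using t by (auto simp: r_def s3_def s2_def s1_def s flip_def)
  obtain x where x: "exec add_loop s3 (2 * N + 1) (Inl (s3(12 := [], 5 := 3 # V,
      11 := rev (bits N r) @ s3 11, 13 := [x])))"
    using exec_add_loop[of s3 N a b "3 # V" "t \<noteq> 11", OF _ _ _ refl refl order_refl]
    unfolding r_def[symmetric] by (auto simp: s3_def s2_def s1_def s)
  define s4 where "s4 = s3(12 := [], 5 := 3 # V, 11 := rev (bits N r) @ s3 11, 13 := [x])"
  define s5 where "s5 = s4(13 := [])"
  define s6 where "s6 = s5(11 := [], 5 := bits N (binop t a b) @ 3 # V)"
  have nz: "\<forall>x\<in>set (bits N z). x \<noteq> 0" for z using set_bits[of N z] by auto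
  have s5: "s5 11 = rev (bits N r)" "s5 5 = 3 # V" "s5 2 = t # ts"
    by (simp_all add: s5_def s4_def s3_def s2_def s1_def s)
  have 1: "exec pop_value s0 (2 * N + 5) (Inl s1)"
    by (rule exec_pop_value) (simp_all add: s N s1_def)
  have 2: "exec (move (\<lambda>a. a \<noteq> 0) id 11 12) s1 (2 * N + 1) (Inl s2)"
    by (rule exec_move[where l = "rev (bits N a)" and l' = "[]"]) (use nz in \<open>simp_all add: s2_def s1_def s\<close>)
  have 3: "exec (Upd (\<lambda>t. no_act(13 := Push (if t 2 = 11 then 1 else 2)))) s2 1 (Inl s3)"
    by (rule exec_Upd) (simp add: s3_def s2_def s1_def s bit_sym_def)
  have 4: "exec add_loop s3 (2 * N + 1) (Inl s4)" using x unfolding s4_def .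
  have 5: "exec (Upd (\<lambda>t. no_act(13 := Pop))) s4 1 (Inl s5)"
    by (rule exec_Upd) (simp add: s5_def s4_def)
  have 6: "exec (Cond (\<lambda>t. t 2 = 13 \<and> t 11 = 1) (move (\<lambda>a. a \<noteq> 0) (\<lambda>_. 1) 11 5) (move (\<lambda>a. a \<noteq> 0) id 11 5))
      s5 (2 * N + 2) (Inl s6)"
  proof (cases "t = 13 \<and> 0 \<le> r")
    case True
    then have r0: "r = b - a" "0 \<le> r" by (auto simp: r)
    then have "last (bits N r) = 1"
      using b last_bits[of n r] by (simp add: N bit_sym_def del: bits.simps)
    then have c: "top0 (s5 2) = 13 \<and> top0 (s5 11) = 1"
      using True unfolding s5 by (subst top0_rev) (simp_all add: N)
    have "binop t a b = 0" using conjunct1[OF True] r0 by (simp add: binop_def)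
    then have e: "bits N (binop t a b) = replicate N 1" by (simp add: bits_0)
    have 1: "exec (move (\<lambda>a. a \<noteq> 0) (\<lambda>_. 1) 11 5) s5 (2 * N + 1) (Inl s6)"
      by (rule exec_move[where l = "rev (bits N r)" and l' = "[]"])
        (use nz in \<open>simp_all add: s6_def s5 e map_replicate_const\<close>)
    show ?thesis by (rule exec_Cond_True[OF _ 1]) (use c in simp_all)
  next
    case False
    have c: "\<not> (top0 (s5 2) = 13 \<and> top0 (s5 11) = 1)"
    proof
      assume c: "top0 (s5 2) = 13 \<and> top0 (s5 11) = 1"
      then have "t = 13" "last (bits N r) = 1"
        using top0_rev[of "bits N r"] unfolding s5 by (simp_all add: N)
      moreover from this have "r = b - a" "r < 0" using False by (auto simp: r)
      ultimately show False using b last_bits[of n r] by (simp add: N bit_sym_def del: bits.simps)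
    qed
    have e: "binop t a b = r" using False r t by (auto simp: binop_def)
    have 1: "exec (move (\<lambda>a. a \<noteq> 0) id 11 5) s5 (2 * N + 1) (Inl s6)"
      by (rule exec_move[where l = "rev (bits N r)" and l' = "[]"])
        (use nz in \<open>simp_all add: s6_def s5 e\<close>)
    show ?thesis by (rule exec_Cond_False[OF _ 1]) (use c in simp_all)
  qed
  have 7: "exec (Upd (\<lambda>t. no_act(2 := Pop))) s6 1 (Inl (eval_store ts d N (binop t a b # vs)))"
    by (rule exec_Upd)
      (simp add: s6_def s5_def s4_def s3_def s2_def s1_def s0_def eval_store_def V_def fun_eq_iff)
  have c: "top0 (s1 5) \<noteq> 0" by (simp add: s1_def N bit_sym_def)
  note rest = exec_Seq[OF 2 exec_Seq[OF 3 exec_Seq[OF 4 exec_Seq[OF 5 exec_Seq[OF 6 7]]]]]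
  show ?thesis unfolding binary_op_def s0_def[symmetric]
    by (rule exec_Seq'[OF 1 exec_Cond_False[OF _ rest order_refl]]) (use c in simp_all)
qed

lemma exec_binary_op_exit:
  assumes "length vs < 2" "1 \<le> N"
  shows "exec binary_op (eval_store ts d N vs) (8 * N + 30) (Inr True)"
proof (cases vs)
  case Nil
  have 1: "exec pop_value (eval_store ts d N vs) (2 * N + 5) (Inr True)"
    by (rule exec_pop_value_exit) (simp add: eval_store_def Nil)
  show ?thesis unfolding binary_op_def by (rule exec_mono[OF exec_Seq_exit[OF 1]]) simp
next
  case (Cons z vs')
  with assms have vs: "vs = [z]" by simp
  have 1: "exec pop_value (eval_store ts d N vs) (2 * N + 5)
      (Inl ((eval_store ts d N vs)(5 := [], 11 := rev (bits N z))))"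
    by (rule exec_pop_value) (use assms in \<open>simp_all add: eval_store_def vs\<close>)
  show ?thesis unfolding binary_op_def
    by (rule exec_Seq'[OF 1 exec_Cond_True[OF _ exec_Halt order_refl]]) simp_all
qed

section \<open>Tokens\<close>

datatype token = TVar nat | TConst | TNeg | TPlus | TImp | TRImp

primrec encode_token :: "token \<Rightarrow> bool list" where
  "encode_token (TVar p) = [False, False, False] @ encode_nat p"
| "encode_token TConst = [False, False, True]"
| "encode_token TNeg = [False, True, False]"
| "encode_token TPlus = [False, True, True]"
| "encode_token TImp = [True, False, False]"
| "encode_token TRImp = [True, False, True]"

fun digits :: "nat \<Rightarrow> bool list" where
  "digits n = (if n = 0 then [] else odd n # digits (n div 2))"

declare digits.simps [simp del]

definition pairs :: "bool list \<Rightarrow> bool list" where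
  "pairs ds = concat (map (\<lambda>d. [True, d]) ds)"

lemma pairs_simps [simp]: "pairs [] = []" "pairs (d # ds) = True # d # pairs ds"
  by (auto simp: pairs_def)

lemma length_pairs: "length ds \<le> length (pairs ds)"
  by (induction ds) auto

lemma encode_nat_digits: "encode_nat p = pairs (digits p) @ [False]"
proof (induction p rule: digits.induct)
  case (1 n)
  show ?case
  proof (cases "n = 0")
    case True
    then show ?thesis by (simp add: encode_nat.simps[of 0] digits.simps[of 0])
  next
    case False
    then show ?thesis using 1 by (simp add: encode_nat.simps[of n] digits.simps[of n])
  qed
qed

text \<open>Digits are listed least significant first, so a nonempty list is canonical when its last
  digit is one. This is the condition that \<open>read_var\<close> tests.\<close>

lemma range_digits: "(\<exists>p. digits p = ds) \<longleftrightarrow> ds = [] \<or> last ds"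
proof
  assume "\<exists>p. digits p = ds"
  then obtain p where p: "digits p = ds" ..
  have "digits p = [] \<or> last (digits p)"
  proof (induction p rule: digits.induct)
    case (1 n)
    show ?case
    proof (cases "n div 2 = 0")
      case True
      then have "n = 0 \<or> n = 1" by auto
      then show ?thesis by (auto simp: digits.simps[of 0] digits.simps[of 1] digits.simps[of "Suc 0"])
    next
      case False
      moreover from this have "digits (n div 2) \<noteq> []" by (simp add: digits.simps[of "n div 2"])
      ultimately show ?thesis using 1 by (cases "n = 0") (simp_all add: digits.simps[of n])
    qed
  qed
  then show "ds = [] \<or> last ds" using p by simp
next
  assume "ds = [] \<or> last ds"
  then show "\<exists>p. digits p = ds"
  proof (induction ds)
    case Nil
    have "digits 0 = []" by (simp add: digits.simps)
    then show ?case ..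
  next
    case (Cons d ds)
    then obtain p where p: "digits p = ds" by (auto split: if_splits)
    define n where "n = 2 * p + of_bool d"
    have "p \<noteq> 0" if "\<not> d"
    proof
      assume "p = 0"
      then have "ds = []" using p by (simp add: digits.simps[of 0])
      with that Cons.prems show False by simp
    qed
    then have "n \<noteq> 0" by (cases d) (simp_all add: n_def)
    moreover have "n div 2 = p" "odd n = d" by (cases d; simp add: n_def)+
    ultimately have "digits n = d # ds" using p digits.simps[of n] by simp
    then show ?case ..
  qed
qed

primrec token_syms :: "token \<Rightarrow> nat list" where
  "token_syms (TVar p) = 8 # rev (map bit_sym (digits p))"
| "token_syms TConst = [9]"
| "token_syms TNeg = [9, 10]"
| "token_syms TPlus = [11]"
| "token_syms TImp = [12]"
| "token_syms TRImp = [13]"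

definition tokens_stack :: "token list \<Rightarrow> nat list" where
  "tokens_stack ts = concat (map token_syms (rev ts))"

lemma tokens_stack_simps [simp]:
  "tokens_stack [] = []" "tokens_stack (ts @ [t]) = token_syms t @ tokens_stack ts"
  by (auto simp: tokens_stack_def)

lemma tokens_stack_top: "top0 (tokens_stack ts) \<noteq> 1" "top0 (tokens_stack ts) \<noteq> 2"
proof -
  have "top0 (tokens_stack ts) \<noteq> 1 \<and> top0 (tokens_stack ts) \<noteq> 2"
  proof (cases ts rule: rev_cases)
    case (snoc ts' t)
    then show ?thesis by (cases t) auto
  qed simp
  then show "top0 (tokens_stack ts) \<noteq> 1" "top0 (tokens_stack ts) \<noteq> 2" by auto
qed

fun token_apply :: "token \<Rightarrow> fm list \<Rightarrow> fm list option" where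
  "token_apply (TVar p) As = Some (Var p # As)"
| "token_apply TConst As = Some (Const_t # As)"
| "token_apply TNeg (A # As) = Some (Neg A # As)"
| "token_apply TPlus (A # B # As) = Some (Plus A B # As)"
| "token_apply TImp (A # B # As) = Some (Imp A B # As)"
| "token_apply TRImp (A # B # As) = Some (RImp A B # As)"
| "token_apply _ _ = None"

text \<open>Polish notation is processed from right to left: when an operator is met its operands
  are complete, the first one on top. The value stack of the program evolves in the same
  way.\<close>

primrec parse :: "token list \<Rightarrow> fm list option" where
  "parse [] = Some []"
| "parse (t # ts) = Option.bind (parse ts) (token_apply t)"

primrec tokens :: "fm \<Rightarrow> token list" where
  "tokens (Var p) = [TVar p]"
| "tokens Const_t = [TConst]"
| "tokens (Neg A) = TNeg # tokens A"
| "tokens (Plus A B) = TPlus # tokens A @ tokens B"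
| "tokens (Imp A B) = TImp # tokens A @ tokens B"
| "tokens (RImp A B) = TRImp # tokens A @ tokens B"

lemma encode_tokens: "encode A = concat (map encode_token (tokens A))"
  by (induction A) auto

lemma parse_tokens: "parse (tokens A @ ts) = map_option ((#) A) (parse ts)"
proof (induction A arbitrary: ts)
qed (auto simp: map_option_case split: option.splits)

lemma parse_sound: "parse ts = Some As \<Longrightarrow> ts = concat (map tokens As)"
proof (induction ts arbitrary: As)
  case (Cons t ts)
  then obtain Bs where Bs: "parse ts = Some Bs" "token_apply t Bs = Some As"
    by (auto simp: bind_eq_Some_conv)
  with Cons.IH[OF Bs(1)] show ?case by (cases "(t, Bs)" rule: token_apply.cases) auto
qed simp

lemma encode_token_append_inject:
  "encode_token s @ v = encode_token t @ w \<longleftrightarrow> s = t \<and> v = w"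
  by (cases s; cases t) (auto simp: encode_nat_append_inject)

lemma encode_tokens_inject:
  "concat (map encode_token ss) = concat (map encode_token ts) \<Longrightarrow> ss = ts"
proof (induction ss arbitrary: ts)
  case Nil
  then show ?case by (cases ts; cases "hd ts") auto
next
  case (Cons s ss)
  then show ?case by (cases ts) (cases s, auto simp: encode_token_append_inject)
qed

text \<open>Token codes form a prefix code, so a word determines its token list and failure of the
  parse shows that the word encodes no formula.\<close>

lemma parse_eq_Some_iff: "parse ts = Some [A] \<longleftrightarrow> concat (map encode_token ts) = encode A"
proof
  assume "parse ts = Some [A]"
  from parse_sound[OF this] show "concat (map encode_token ts) = encode A" by (simp add: encode_tokens)
next
  assume "concat (map encode_token ts) = encode A"
  then have "ts = tokens A" by (simp add: encode_tokens encode_tokens_inject)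
  then show "parse ts = Some [A]" using parse_tokens[of A "[]"] by simp
qed


section \<open>Evaluation\<close>

lemma exec_eval_token_binop:
  assumes "t \<in> {10, 11, 12, 13}" "exec binary_op (eval_store (t # ts) d N vs) n r" "n + 2 \<le> m"
  shows "exec eval_token (eval_store (t # ts) d N vs) m r"
  unfolding eval_token_def
  by (rule exec_Cond_False[OF _ exec_Cond_False[OF _ assms(2) order_refl]])
    (use assms(1,3) in \<open>auto simp: eval_store_def\<close>)

lemma exec_eval_token_zero:
  "exec eval_token (eval_store (9 # ts) d N vs) (6 * N + 14) (Inl (eval_store ts d N (0 # vs)))"
proof -
  have 1: "exec (Upd (\<lambda>t. no_act(2 := Pop))) (eval_store (9 # ts) d N vs) 1 (Inl (eval_store ts d N vs))"
    by (rule exec_Upd) (simp add: eval_store_def fun_eq_iff)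
  have 2: "exec push_padded (eval_store ts d N vs) (6 * N + 10) (Inl (eval_store ts d N (0 # vs)))"
    by (rule exec_push_padded[where l = "[]" and i = 0 and j = N]) (simp_all add: eval_store_def fun_eq_iff)
  show ?thesis unfolding eval_token_def
    by (rule exec_Cond_False[OF _ exec_Cond_True[OF _ exec_Seq[OF 1 2] order_refl]])
      (simp_all add: eval_store_def)
qed

text \<open>Dominated by looking up a variable, the only operation that scans the table; the slack
  also covers the other tokens.\<close>

definition eval_cost :: "nat \<Rightarrow> nat" where
  "eval_cost Z = (2 * Z + 11) * Z + 14 * Z + 40"

lemma exec_eval_loop_step:
  assumes "exec eval_token (eval_store (t # ts) d N vs) (eval_cost Z) (Inl (eval_store ts' d N vs'))" "t \<noteq> 0"
    "exec eval_loop (eval_store ts' d N vs') m r"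
  shows "exec eval_loop (eval_store (t # ts) d N vs) (eval_cost Z + 1 + m) r"
  by (rule exec_While_step'[OF assms(1) _ assms(3)]) (use assms(2) in \<open>simp_all add: eval_store_def\<close>)

lemma exec_eval_loop_exit:
  assumes "exec eval_token (eval_store (t # ts) d N vs) (eval_cost Z) (Inr b)" "t \<noteq> 0"
  shows "exec eval_loop (eval_store (t # ts) d N vs) (eval_cost Z + 1) (Inr b)"
  by (rule exec_While_exit[OF _ assms(1)]) (use assms(2) in \<open>simp add: eval_store_def\<close>)

definition valuation :: "nat list \<Rightarrow> nat \<Rightarrow> int" where
  "valuation d p = lookup d (map bit_sym (digits p))"

lemma length_scan_le: "length (scan d ok w w' g) \<le> length d + length g"
  by (induction d ok w w' g rule: scan.induct) auto

lemma abs_lookup_le: "\<bar>lookup d w\<bar> \<le> 2 ^ length d"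
proof -
  let ?l = "rev (scan d True w [] [])"
  have "(2::int) ^ length ?l \<le> 2 ^ length d"
    using length_scan_le[of d True w "[]" "[]"] by (intro power_increasing) auto
  then show ?thesis using sval_bound[of ?l] unfolding lookup_def abs_le_iff by linarith
qed

lemma abs_val_le:
  assumes "\<And>p. \<bar>v p\<bar> \<le> B"
  shows "\<bar>val v A\<bar> \<le> int (leaves A) * B"
proof (induction A)
  case Const_t
  have "0 \<le> B" using assms[of 0] by linarith
  then show ?case by simp
next
  case (RImp A B')
  have "0 \<le> B" using assms[of 0] by linarith
  then have "0 \<le> int (leaves A) * B" "0 \<le> int (leaves B') * B" by simp_all
  then show ?case using RImp by (auto simp: distrib_right)
qed (use assms in \<open>auto simp: distrib_right\<close>)

text \<open>Justifies one digit of word length per token, since the number of leaves controls the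
  size of values.\<close>

lemma parse_leaves: "parse ts = Some As \<Longrightarrow> sum_list (map leaves As) \<le> length ts"
proof (induction ts arbitrary: As)
  case (Cons t ts)
  then obtain Bs where Bs: "parse ts = Some Bs" "token_apply t Bs = Some As"
    by (auto simp: bind_eq_Some_conv)
  with Cons.IH[OF Bs(1)] show ?case by (cases "(t, Bs)" rule: token_apply.cases) auto
qed simp

lemma parse_append_None: "parse us = None \<Longrightarrow> parse (ts @ us) = None"
  by (induction ts) auto

lemma set_map_bit_sym: "set (map bit_sym l) \<subseteq> {1, 2}"
  by (auto simp: bit_sym_def)

lemma abs_val_valuation_le: "\<bar>val (valuation d) A\<bar> \<le> int (leaves A) * 2 ^ length d"
  by (rule abs_val_le) (simp add: valuation_def abs_lookup_le)

text \<open>By \<open>k < 2 ^ k\<close>, a factor \<open>k\<close> costs at most \<open>k\<close>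
  extra digits.\<close>

lemma small_value:
  fixes z :: int
  assumes "\<bar>z\<bar> \<le> int k * 2 ^ l" "k \<le> m" "m + l \<le> n"
  shows "- (2 ^ n) \<le> z" "z < 2 ^ n"
proof -
  have "int k < 2 ^ k" by (rule of_nat_less_two_power)
  then have "int k * 2 ^ l < 2 ^ k * 2 ^ l" by (intro mult_strict_right_mono) simp_all
  also have "\<dots> \<le> (2 :: int) ^ n"
    unfolding power_add[symmetric] using assms(2,3) by (intro power_increasing) auto
  finally show "- (2 ^ n) \<le> z" "z < 2 ^ n" using assms(1) by linarith+
qed

text \<open>Evaluation runs through the tokens from right to left; \<open>us\<close> are the tokens already processed.\<close>

lemma exec_eval_loop:
  assumes "0 \<notin> set d" "N = Suc n" "N \<le> Z" "length ts + length us + length d \<le> n"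
    "parse us = Some As" "\<forall>t\<in>set ts. length (encode_token t) \<le> Z"
  shows "exec eval_loop (eval_store (tokens_stack ts) d N (map (val (valuation d)) As))
    (2 * (eval_cost Z + 1) * length ts + 1)
    (case parse (ts @ us) of None \<Rightarrow> Inr True | Some Bs \<Rightarrow> Inl (eval_store [] d N (map (val (valuation d)) Bs)))"
  using assms(4-)
proof (induction ts arbitrary: us As rule: rev_induct)
  case Nil
  then have eq: "(case parse ([] @ us) of None \<Rightarrow> Inr True
      | Some Bs \<Rightarrow> Inl (eval_store [] d N (map (val (valuation d)) Bs)))
    = Inl (eval_store [] d N (map (val (valuation d)) As))" by simp
  show ?case unfolding eq by (rule exec_While_end') (simp_all add: eval_store_def fun_eq_iff)
next
  case (snoc t ts)
  let ?v = "val (valuation d)"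
  \<comment> \<open>The factor \<open>2\<close> pays for negation, whose token consists of two
    symbols executed in separate rounds.\<close>
  let ?m = "2 * (eval_cost Z + 1) * length ts + 1"
  have cost: "6 * N + 14 \<le> eval_cost Z" "8 * N + 30 + 2 \<le> eval_cost Z"
    "(2 * Z + 11) * Z + 14 * Z + 30 + 1 \<le> eval_cost Z"
    using assms(2,3) by (auto simp: eval_cost_def)
  show ?case
  proof (cases "token_apply t As")
    case None
    then have "parse (t # us) = None" using snoc.prems by simp
    then have p: "parse ((ts @ [t]) @ us) = None" using parse_append_None[of "t # us" ts] by simp
    have exit: "exec eval_loop (eval_store (s # ts') d N vs) (eval_cost Z + 1) (Inr True)"
      if "s \<in> {10, 11, 12, 13}" "length vs < 2" for s ts' vs
      by (rule exec_eval_loop_exit[OF exec_eval_token_binop[OF that(1) exec_binary_op_exit[OF that(2)] cost(2)]])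
        (use that assms(2) in auto)
    have "exec eval_loop (eval_store (token_syms t @ tokens_stack ts) d N (map ?v As)) (2 * (eval_cost Z + 1)) (Inr True)"
    proof (cases "t = TNeg")
      case True
      then have "As = []" using None by (cases As) auto
      then have e: "exec eval_loop (eval_store (10 # tokens_stack ts) d N (0 # map ?v As)) (eval_cost Z + 1) (Inr True)"
        by (intro exit) auto
      from exec_eval_loop_step[OF exec_mono[OF exec_eval_token_zero cost(1)] _ e] True
      show ?thesis by (simp add: mult_2)
    next
      case False
      with None obtain s where s: "token_syms t = [s]" "s \<in> {10, 11, 12, 13}" "length As < 2"
        by (cases "(t, As)" rule: token_apply.cases) auto
      show ?thesis unfolding s(1) append.simps
        by (rule exec_mono[OF exit[OF s(2)]]) (use s(3) in simp_all)
    qed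
    then show ?thesis unfolding p option.case tokens_stack_simps by (rule exec_mono) simp
  next
    case (Some Bs)
    then have us: "parse (t # us) = Some Bs" using snoc.prems by simp
    define r where "r = (case parse (ts @ t # us) of None \<Rightarrow> Inr True | Some Bs \<Rightarrow> Inl (eval_store [] d N (map ?v Bs)))"
    have IH: "exec eval_loop (eval_store (tokens_stack ts) d N (map ?v Bs)) ?m r"
      unfolding r_def using snoc.prems us by (intro snoc.IH) auto
    have ml: "length us + length d \<le> n" using snoc.prems by simp
    have small: "- (2 ^ n) \<le> ?v B - ?v A" "?v B - ?v A < 2 ^ n" if "As = A # B # As'" for A B As'
    proof -
      have "\<bar>?v B - ?v A\<bar> \<le> \<bar>?v A\<bar> + \<bar>?v B\<bar>" by linarith
      then have "\<bar>?v B - ?v A\<bar> \<le> int (leaves A + leaves B) * 2 ^ length d"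
        using abs_val_valuation_le[of d A] abs_val_valuation_le[of d B] by (simp add: distrib_right)
      moreover have "leaves A + leaves B \<le> length us"
        using parse_leaves[OF snoc.prems(2)] that by simp
      ultimately show "- (2 ^ n) \<le> ?v B - ?v A" "?v B - ?v A < 2 ^ n"
        using small_value ml by blast+
    qed
    have "exec eval_loop (eval_store (token_syms t @ tokens_stack ts) d N (map ?v As)) (2 * (eval_cost Z + 1) + ?m) r"
    proof (cases "t = TNeg")
      case True
      then obtain A As' where As: "As = A # As'" "Bs = Neg A # As'" using Some by (cases As) auto
      have "leaves A \<le> length us" using parse_leaves[OF snoc.prems(2)] As by simp
      then have bound: "- (2 ^ n) \<le> ?v A" "?v A < 2 ^ n"
        using small_value[OF abs_val_valuation_le _ ml] by blast+
      have "exec binary_op (eval_store (10 # tokens_stack ts) d N (0 # ?v A # map ?v As')) (8 * N + 30)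
          (Inl (eval_store (tokens_stack ts) d N (binop 10 0 (?v A) # map ?v As')))"
        by (rule exec_binary_op[OF _ assms(2)]) (use bound in auto)
      then have "exec eval_token (eval_store (10 # tokens_stack ts) d N (0 # ?v A # map ?v As')) (eval_cost Z)
          (Inl (eval_store (tokens_stack ts) d N (map ?v Bs)))"
        by (intro exec_eval_token_binop[OF _ _ cost(2)]) (simp_all add: As binop_def)
      from exec_eval_loop_step[OF exec_mono[OF exec_eval_token_zero cost(1)] _ exec_eval_loop_step[OF this _ IH]]
      show ?thesis using True As by (simp add: algebra_simps)
    next
      case notNeg: False
      obtain s l where s: "token_syms t = s # l" "s \<noteq> 0" by (cases t) auto
      have "exec eval_token (eval_store (token_syms t @ tokens_stack ts) d N (map ?v As)) (eval_cost Z)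
          (Inl (eval_store (tokens_stack ts) d N (map ?v Bs)))"
      proof (cases "\<exists>p. t = TVar p")
        case True
        then obtain p where p: "t = TVar p" ..
        have len: "length (encode_token t) \<le> Z" using snoc.prems by simp
        then have "length (digits p) \<le> Z"
          unfolding p encode_token.simps encode_nat_digits using length_pairs[of "digits p"] by simp
        have 1: "exec push_var (eval_store (8 # rev (map bit_sym (digits p)) @ tokens_stack ts) d N (map ?v As))
            ((2 * Z + 11) * Z + 14 * Z + 30)
            (Inl (eval_store (tokens_stack ts) d N (lookup d (map bit_sym (digits p)) # map ?v As)))"
          by (rule exec_push_var[OF tokens_stack_top set_map_bit_sym assms(1) _ assms(3)])
            (use snoc.prems assms(2) \<open>length (digits p) \<le> Z\<close> in simp_all)
        have "exec eval_token (eval_store (8 # rev (map bit_sym (digits p)) @ tokens_stack ts) d N (map ?v As))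
            (eval_cost Z) (Inl (eval_store (tokens_stack ts) d N (lookup d (map bit_sym (digits p)) # map ?v As)))"
          unfolding eval_token_def
          by (rule exec_Cond_True[OF _ 1 cost(3)]) (simp add: eval_store_def)
        then show ?thesis using Some by (simp add: p valuation_def[symmetric]) (auto simp: valuation_def)
      next
        case False
        show ?thesis
        proof (cases "t = TConst")
          case True
          then show ?thesis using Some exec_mono[OF exec_eval_token_zero cost(1)] by auto
        next
          case False
          with notNeg \<open>\<nexists>p. t = TVar p\<close> Some obtain A B As' where As: "As = A # B # As'"
            by (cases "(t, As)" rule: token_apply.cases) auto
          obtain s where s: "token_syms t = [s]" "s \<in> {10, 11, 12, 13}" "map ?v Bs = binop s (?v A) (?v B) # map ?v As'"
            using notNeg \<open>\<nexists>p. t = TVar p\<close> False Some As by (cases t) (auto simp: binop_def)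
          have "exec binary_op (eval_store (s # tokens_stack ts) d N (?v A # ?v B # map ?v As')) (8 * N + 30)
            (Inl (eval_store (tokens_stack ts) d N (binop s (?v A) (?v B) # map ?v As')))"
            by (rule exec_binary_op[OF s(2) assms(2)]) (use small As in auto)
          from exec_eval_token_binop[OF s(2) this cost(2)] show ?thesis
            unfolding s(1,3) by (simp add: As)
        qed
      qed
      then have "exec eval_loop (eval_store (token_syms t @ tokens_stack ts) d N (map ?v As)) (eval_cost Z + 1 + ?m) r"
        unfolding s(1) append.simps by (rule exec_eval_loop_step[OF _ s(2) IH])
      then show ?thesis by (rule exec_mono) simp
    qed
    then show ?thesis unfolding r_def by (simp add: algebra_simps)
  qed
qed

section \<open>Reading the input\<close>

text \<open>Each digit is announced by \<open>True\<close>, so the first \<open>False\<close> in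
  announcing position marks the end of the number.\<close>

lemma pairs_inject:
  "pairs ds @ zs = pairs ds' @ False # ys \<Longrightarrow> zs = [] \<or> \<not> hd zs \<Longrightarrow> ds = ds' \<and> zs = False # ys"
proof (induction ds arbitrary: ds')
  case Nil
  then show ?case by (cases ds') auto
next
  case (Cons d ds)
  then show ?case by (cases ds') auto
qed

lemma bit_sym_simps [simp]: "bit_sym True = 2" "bit_sym False = 1"
  by (auto simp: bit_sym_def)

lemma bit_sym_neq_0 [simp]: "bit_sym b \<noteq> 0"
  by (simp add: bit_sym_def)

text \<open>The loop aborts only if the input ends between a continuation bit and its digit. A
  missing end marker is left for \<open>read_var\<close> to detect, as the case
  \<open>zs = []\<close>.\<close>

lemma exec_digit_loop:
  assumes "s 0 = map bit_sym xs" "s 2 = ts"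
  shows "(exec digit_loop s (3 * length xs + 3) (Inr True) \<and> (\<forall>ds ys. xs \<noteq> pairs ds @ False # ys)) \<or>
    (\<exists>ds zs. exec digit_loop s (3 * length xs + 3) (Inl (s(0 := map bit_sym zs, 2 := rev (map bit_sym ds) @ ts))) \<and>
      xs = pairs ds @ zs \<and> (zs = [] \<or> \<not> hd zs))"
  using assms
proof (induction xs arbitrary: s ts rule: length_induct)
  case (1 xs)
  show ?case
  proof (cases "xs = [] \<or> \<not> hd xs")
    case True
    then have "top0 (s 0) \<noteq> 2" using 1 by (cases xs) auto
    then have "exec digit_loop s (3 * length xs + 3) (Inl (s(0 := map bit_sym xs, 2 := rev (map bit_sym []) @ ts)))"
      using 1 by (intro exec_While_end') (auto simp: fun_eq_iff)
    then show ?thesis using True pairs_simps(1) append_Nil by metis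
  next
    case False
    then obtain ys where xs: "xs = True # ys" by (cases xs) auto
    define s1 where "s1 = s(0 := map bit_sym ys)"
    have 1: "exec (Upd (\<lambda>t. no_act(0 := Pop))) s 1 (Inl s1)"
      using "1.prems" by (intro exec_Upd) (simp add: s1_def xs)
    show ?thesis
    proof (cases ys)
      case Nil
      have 2: "exec (Cond (\<lambda>t. t 0 = 0) (Halt True) (Upd (\<lambda>t. no_act(0 := Pop, 2 := Push (t 0))))) s1 2 (Inr True)"
        by (rule exec_Cond_True[OF _ exec_Halt]) (simp_all add: s1_def Nil)
      have "exec digit_loop s (3 * length xs + 3) (Inr True)"
        by (rule exec_mono[OF exec_While_exit[OF _ exec_Seq[OF 1 2]]]) (simp_all add: "1.prems" xs)
      moreover have "xs \<noteq> pairs ds @ False # ys" for ds ys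
        unfolding xs Nil by (cases ds) auto
      ultimately show ?thesis by blast
    next
      case (Cons d zs)
      define s2 where "s2 = s(0 := map bit_sym zs, 2 := bit_sym d # ts)"
      have 2: "exec (Cond (\<lambda>t. t 0 = 0) (Halt True) (Upd (\<lambda>t. no_act(0 := Pop, 2 := Push (t 0))))) s1 2 (Inl s2)"
        by (rule exec_Cond_False[OF _ exec_Upd]) (simp_all add: s1_def s2_def Cons "1.prems" fun_eq_iff)
      have step: "exec digit_loop s (3 * length xs + 3) r" if "exec digit_loop s2 (3 * length zs + 3) r" for r
        by (rule exec_While_step'[OF exec_Seq[OF 1 2] _ that]) (simp_all add: "1.prems" xs Cons)
      have eq: "s2(0 := a, 2 := b) = s(0 := a, 2 := b)" for a b by (simp add: s2_def fun_eq_iff)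
      have zs: "length zs < length xs" "s2 0 = map bit_sym zs" "s2 2 = bit_sym d # ts"
        by (simp_all add: s2_def xs Cons)
      from "1.IH"[rule_format, OF zs] consider
        "exec digit_loop s2 (3 * length zs + 3) (Inr True)" "\<forall>ds ys. zs \<noteq> pairs ds @ False # ys"
        | ds zs' where "exec digit_loop s2 (3 * length zs + 3) (Inl (s2(0 := map bit_sym zs', 2 := rev (map bit_sym ds) @ bit_sym d # ts)))"
          "zs = pairs ds @ zs'" "zs' = [] \<or> \<not> hd zs'"
        by blast
      then show ?thesis
      proof cases
        case 1
        have "xs \<noteq> pairs ds @ False # ys" for ds ys
          using 1(2) unfolding xs Cons by (cases ds) auto
        then show ?thesis using step[OF 1(1)] by blast
      next
        case (2 ds zs')
        from step[OF 2(1)] have "exec digit_loop s (3 * length xs + 3)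
          (Inl (s(0 := map bit_sym zs', 2 := rev (map bit_sym (d # ds)) @ ts)))" unfolding eq by simp
        moreover have "xs = pairs (d # ds) @ zs'" using 2(2) by (simp add: xs Cons)
        ultimately show ?thesis using 2(3) by blast
      qed
    qed
  qed
qed

lemma exec_read_var:
  assumes "s 0 = map bit_sym xs" "s 2 = ts" "top0 ts \<noteq> 1"
  shows "(exec read_var s (3 * length xs + 6) (Inr True) \<and> (\<forall>p ys. xs \<noteq> encode_nat p @ ys)) \<or>
    (\<exists>p ys. exec read_var s (3 * length xs + 6)
        (Inl (s(0 := map bit_sym ys, 2 := 8 # rev (map bit_sym (digits p)) @ ts))) \<and>
      xs = encode_nat p @ ys)"
proof -
  from exec_digit_loop[OF assms(1,2)] consider
    "exec digit_loop s (3 * length xs + 3) (Inr True)" "\<forall>ds ys. xs \<noteq> pairs ds @ False # ys"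
    | ds zs where "exec digit_loop s (3 * length xs + 3) (Inl (s(0 := map bit_sym zs, 2 := rev (map bit_sym ds) @ ts)))"
      "xs = pairs ds @ zs" "zs = [] \<or> \<not> hd zs"
    by blast
  then show ?thesis
  proof cases
    case 1
    have "exec read_var s (3 * length xs + 6) (Inr True)"
      unfolding read_var_def by (rule exec_mono[OF exec_Seq_exit[OF 1(1)]]) simp
    moreover have "xs \<noteq> encode_nat p @ ys" for p ys
      using 1(2) by (simp add: encode_nat_digits)
    ultimately show ?thesis by blast
  next
    case (2 ds zs)
    define s1 where "s1 = s(0 := map bit_sym zs, 2 := rev (map bit_sym ds) @ ts)"
    have top: "top0 (s1 2) = 1 \<longleftrightarrow> ds \<noteq> [] \<and> \<not> last ds"
      using assms(3) by (cases ds rule: rev_cases) (auto simp: s1_def bit_sym_def)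
    show ?thesis
    proof (cases "zs = [] \<or> (ds \<noteq> [] \<and> \<not> last ds)")
      case True
      then have "top0 (s1 0) = 0 \<or> top0 (s1 2) = 1" unfolding top by (auto simp: s1_def)
      then have c: "exec (Cond (\<lambda>t. t 0 = 0 \<or> t 2 = 1) (Halt True) (Upd (\<lambda>t. no_act(0 := Pop, 2 := Push 8)))) s1 2 (Inr True)"
        by (intro exec_Cond_True[OF _ exec_Halt]) simp_all
      have "exec read_var s (3 * length xs + 6) (Inr True)"
        unfolding read_var_def by (rule exec_Seq'[OF 2(1)[folded s1_def] c]) simp
      moreover have "xs \<noteq> encode_nat p @ ys" for p ys
      proof
        assume "xs = encode_nat p @ ys"
        then have "ds = digits p \<and> zs = False # ys"
          using 2(2,3) pairs_inject[of ds zs "digits p" ys] by (simp add: encode_nat_digits)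
        with True range_digits[of ds] show False by auto
      qed
      ultimately show ?thesis by blast
    next
      case False
      then obtain p where p: "digits p = ds" using range_digits[of ds] by auto
      obtain ys where ys: "zs = False # ys" using False 2(3) by (cases zs) auto
      have "\<not> (top0 (s1 0) = 0 \<or> top0 (s1 2) = 1)" using False ys unfolding top by (auto simp: s1_def)
      then have c: "exec (Cond (\<lambda>t. t 0 = 0 \<or> t 2 = 1) (Halt True) (Upd (\<lambda>t. no_act(0 := Pop, 2 := Push 8)))) s1 2
          (Inl (s(0 := map bit_sym ys, 2 := 8 # rev (map bit_sym (digits p)) @ ts)))"
        by (intro exec_Cond_False[OF _ exec_Upd]) (simp_all add: s1_def ys p fun_eq_iff)
      have "exec read_var s (3 * length xs + 6) (Inl (s(0 := map bit_sym ys, 2 := 8 # rev (map bit_sym (digits p)) @ ts)))"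
        unfolding read_var_def by (rule exec_Seq'[OF 2(1)[folded s1_def] c]) simp
      moreover have "xs = encode_nat p @ ys" using 2(2) by (simp add: encode_nat_digits p ys)
      ultimately show ?thesis by blast
    qed
  qed
qed

definition read_store :: "bool list \<Rightarrow> token list \<Rightarrow> nat list \<Rightarrow> nat \<Rightarrow> store" where
  "read_store xs ts d k = empty_store(0 := map bit_sym xs, 2 := tokens_stack ts, 3 := d, 4 := replicate k 1)"

lemma exec_read_bit:
  assumes "a \<noteq> 13" "s 13 = [f]" "f \<le> 7" "s' = s(a := tl (s a), 13 := [2 * f + (if top0 (s a) = 2 then 1 else 0)])"
  shows "exec (read_bit a) s 1 (Inl s')"
  unfolding read_bit_def by (rule exec_Upd) (use assms in \<open>auto simp: fun_eq_iff\<close>)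

lemma exec_need_bit:
  assumes "s 0 = bit_sym b # l" "s 13 = [f]" "f \<le> 7" "s' = s(0 := l, 13 := [2 * f + of_bool b])"
  shows "exec need_bit s 2 (Inl s')"
  unfolding need_bit_def by (rule exec_Cond_False[OF _ exec_read_bit]) (use assms in \<open>auto simp: bit_sym_def\<close>)

lemma exec_need_bit_exit: "s 0 = [] \<Longrightarrow> exec need_bit s 2 (Inr True)"
  unfolding need_bit_def by (rule exec_Cond_True[OF _ exec_Halt]) simp_all

lemma exec_read_token:
  assumes "xs \<noteq> []"
  shows "(exec read_token (read_store xs ts d k) (3 * length xs + 30) (Inr True) \<and> (\<forall>t ys. xs \<noteq> encode_token t @ ys)) \<or>
    (\<exists>t ys. exec read_token (read_store xs ts d k) (3 * length xs + 30) (Inl (read_store ys (ts @ [t]) d (Suc k))) \<and>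
      xs = encode_token t @ ys)"
proof -
  obtain a xs1 where xs: "xs = a # xs1" using assms by (cases xs) auto
  define s0 where "s0 = read_store xs ts d k"
  define s1 where "s1 = s0(13 := [1])"
  define s2 where "s2 = s1(0 := map bit_sym xs1, 13 := [2 + of_bool a])"
  have s0: "s0 0 = map bit_sym xs" "s0 13 = []" "s0 2 = tokens_stack ts" by (simp_all add: s0_def read_store_def)
  have 1: "exec (Upd (\<lambda>t. no_act(13 := Push 1))) s0 1 (Inl s1)"
    by (rule exec_Upd) (simp add: s1_def s0)
  have 2: "exec need_bit s1 2 (Inl s2)"
    by (rule exec_need_bit[where b = a and f = 1 and l = "map bit_sym xs1"]) (simp_all add: s2_def s1_def s0 xs)
  show ?thesis
  proof (cases "length xs1 < 2")
    case True
    have no: "xs \<noteq> encode_token t @ ys" for t ys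
    proof
      assume *: "xs = encode_token t @ ys"
      have "3 \<le> length (encode_token t)" by (cases t) auto
      then have "3 \<le> length xs" unfolding * by simp
      then show False using True xs by simp
    qed
    have ex: "exec read_token s0 (3 * length xs + 30) (Inr True)"
    proof (cases xs1)
      case Nil
      have 3: "exec need_bit s2 2 (Inr True)" by (rule exec_need_bit_exit) (simp add: s2_def Nil)
      show ?thesis unfolding read_token_def
        by (rule exec_mono[OF exec_Seq[OF 1 exec_Seq[OF 2 exec_Seq_exit[OF 3]]]]) simp
    next
      case (Cons b xs2)
      define s3 where "s3 = s2(0 := [], 13 := [2 * (2 + of_bool a) + of_bool b])"
      have 3: "exec need_bit s2 2 (Inl s3)"
        by (rule exec_need_bit[where b = b and f = "2 + of_bool a" and l = "[]"]) (use True Cons in \<open>simp_all add: s3_def s2_def\<close>)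
      have 4: "exec need_bit s3 2 (Inr True)" by (rule exec_need_bit_exit) (simp add: s3_def)
      show ?thesis unfolding read_token_def
        by (rule exec_mono[OF exec_Seq[OF 1 exec_Seq[OF 2 exec_Seq[OF 3 exec_Seq_exit[OF 4]]]]]) simp
    qed
    show ?thesis using ex no unfolding s0_def by blast
  next
    case False
    then obtain b c zs where xs1: "xs1 = b # c # zs" by (cases xs1; cases "tl xs1") auto
    \<comment> \<open>A leading one followed by the tag bits, so \<open>f\<close> runs from
      \<open>8\<close> to \<open>15\<close>; the values \<open>14\<close> and \<open>15\<close> are
      no tags.\<close>
    define f :: nat where "f = 2 * (2 * (2 + of_bool a) + of_bool b) + of_bool c"
    define s3 where "s3 = s2(0 := map bit_sym (c # zs), 13 := [2 * (2 + of_bool a) + of_bool b])"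
    define s4 where "s4 = s0(0 := map bit_sym zs, 13 := [f])"
    have 3: "exec need_bit s2 2 (Inl s3)"
      by (rule exec_need_bit[where b = b and f = "2 + of_bool a" and l = "map bit_sym (c # zs)"])
        (simp_all add: s3_def s2_def xs1)
    have 4: "exec need_bit s3 2 (Inl s4)"
      by (rule exec_need_bit[where b = c and f = "2 * (2 + of_bool a) + of_bool b" and l = "map bit_sym zs"])
        (cases a; cases b; simp add: s4_def f_def s3_def s2_def s1_def fun_eq_iff)+
    have len: "length xs = length zs + 3" by (simp add: xs xs1)
    have token: "exec read_token s0 (3 * length xs + 30) (Inl (read_store ys (ts @ [t]) d (Suc k)))"
      if "exec push_token s4 (3 * length xs + 10) (Inl (s4(0 := map bit_sym ys, 2 := token_syms t @ tokens_stack ts)))" for t ys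
    proof -
      have 5: "exec (Upd (\<lambda>t. no_act(13 := Pop, 4 := Push 1))) (s4(0 := map bit_sym ys, 2 := token_syms t @ tokens_stack ts)) 1
          (Inl (read_store ys (ts @ [t]) d (Suc k)))"
        by (rule exec_Upd) (simp add: s4_def s0_def read_store_def fun_eq_iff)
      show ?thesis unfolding read_token_def
        by (rule exec_mono[OF exec_Seq[OF 1 exec_Seq[OF 2 exec_Seq[OF 3 exec_Seq[OF 4 exec_Seq[OF that 5]]]]]]) simp
    qed
    have exit: "exec read_token s0 (3 * length xs + 30) (Inr True)"
      if "exec push_token s4 (3 * length xs + 10) (Inr True)"
      unfolding read_token_def
      by (rule exec_mono[OF exec_Seq[OF 1 exec_Seq[OF 2 exec_Seq[OF 3 exec_Seq[OF 4 exec_Seq_exit[OF that]]]]]]) simp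
    have simple: ?thesis if "f \<in> {9, 11, 12, 13}" "token_syms t = [f]" "encode_token t = [a, b, c]" for t
    proof -
      have "exec push_token s4 4 (Inl (s4(0 := map bit_sym zs, 2 := token_syms t @ tokens_stack ts)))"
        by (rule exec_Cond_False[OF _ exec_Cond_False[OF _ exec_Cond_False[OF _ exec_Upd order_refl] order_refl]])
          (use that in \<open>auto simp: s4_def s0 fun_eq_iff\<close>)
      then have "exec push_token s4 (3 * length xs + 10) (Inl (s4(0 := map bit_sym zs, 2 := token_syms t @ tokens_stack ts)))"
        by (rule exec_mono) simp
      from token[OF this] have "exec read_token s0 (3 * length xs + 30) (Inl (read_store zs (ts @ [t]) d (Suc k)))" .
      moreover have "xs = encode_token t @ zs" by (simp add: that(3) xs xs1)
      ultimately show ?thesis unfolding s0_def by blast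
    qed
    consider "f = 8" "[a, b, c] = [False, False, False]" | "f = 10" "[a, b, c] = [False, True, False]"
      | t where "f \<in> {9, 11, 12, 13}" "token_syms t = [f]" "encode_token t = [a, b, c]"
      | "f \<ge> 14" "[a, b] = [True, True]"
    proof -
      have *: "thesis" if "t \<in> {TConst, TPlus, TImp, TRImp}" "f \<in> {9, 11, 12, 13}" "token_syms t = [f]" "encode_token t = [a, b, c]" for t
        using that \<open>\<And>t. f \<in> {9, 11, 12, 13} \<Longrightarrow> token_syms t = [f] \<Longrightarrow> encode_token t = [a, b, c] \<Longrightarrow> thesis\<close> by blast
      show thesis
        using that(1,2,4) *[of TConst] *[of TPlus] *[of TImp] *[of TRImp]
        by (cases a; cases b; cases c) (simp_all add: f_def)
    qed
    then show ?thesis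
    proof cases
      case 1
      have top: "top0 (s4 13) = 8" using 1 by (simp add: s4_def)
      have "top0 (tokens_stack ts) \<noteq> 1" by (rule tokens_stack_top)
      then consider "exec read_var s4 (3 * length zs + 6) (Inr True)" "\<forall>p ys. zs \<noteq> encode_nat p @ ys"
        | p ys where "exec read_var s4 (3 * length zs + 6)
            (Inl (s4(0 := map bit_sym ys, 2 := 8 # rev (map bit_sym (digits p)) @ tokens_stack ts)))"
          "zs = encode_nat p @ ys"
        using exec_read_var[of s4 zs "tokens_stack ts"] by (auto simp: s4_def s0)
      then show ?thesis
      proof cases
        case A: 1
        have "exec push_token s4 (3 * length xs + 10) (Inr True)"
          by (rule exec_Cond_True[OF _ A(1)]) (use top len in simp_all)
        from exit[OF this] have "exec read_token s0 (3 * length xs + 30) (Inr True)" .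
        moreover have "xs \<noteq> encode_token t @ ys" for t ys
          using A(2) 1 by (cases t) (auto simp: xs xs1)
        ultimately show ?thesis unfolding s0_def by blast
      next
        case (2 p ys)
        from 2(1) have var: "exec read_var s4 (3 * length zs + 6)
            (Inl (s4(0 := map bit_sym ys, 2 := token_syms (TVar p) @ tokens_stack ts)))" by simp
        have "exec push_token s4 (3 * length xs + 10) (Inl (s4(0 := map bit_sym ys, 2 := token_syms (TVar p) @ tokens_stack ts)))"
          by (rule exec_Cond_True[OF _ var]) (use top len in simp_all)
        from token[OF this] show ?thesis
          using 2(2) 1 unfolding s0_def by (intro disjI2 exI[of _ "TVar p"] exI[of _ ys]) (auto simp: xs xs1)
      qed
    next
      case 2
      have u: "exec (Upd (\<lambda>t. no_act(2 := Push 10))) s4 1 (Inl (s4(2 := 10 # tokens_stack ts)))"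
        by (rule exec_Upd) (simp add: s4_def s0 fun_eq_iff)
      have v: "exec (Upd (\<lambda>t. no_act(2 := Push 9))) (s4(2 := 10 # tokens_stack ts)) 1
          (Inl (s4(0 := map bit_sym zs, 2 := token_syms TNeg @ tokens_stack ts)))"
        by (rule exec_Upd) (simp add: s4_def s0 fun_eq_iff)
      have "exec push_token s4 (3 * length xs + 10) (Inl (s4(0 := map bit_sym zs, 2 := token_syms TNeg @ tokens_stack ts)))"
        by (rule exec_Cond_False[OF _ exec_Cond_False[OF _ exec_Cond_True[OF _ exec_Seq[OF u v] order_refl] order_refl]])
          (use 2 in \<open>simp_all add: s4_def\<close>)
      from token[OF this] show ?thesis
        using 2 unfolding s0_def by (intro disjI2 exI[of _ TNeg] exI[of _ zs]) (auto simp: xs xs1)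
    next
      case (3 t)
      then show ?thesis by (rule simple)
    next
      case 4
      have "exec push_token s4 (3 * length xs + 10) (Inr True)"
        by (rule exec_Cond_False[OF _ exec_Cond_True[OF _ exec_Halt order_refl]])
          (use 4 in \<open>simp_all add: s4_def\<close>)
      from exit[OF this] have "exec read_token s0 (3 * length xs + 30) (Inr True)" .
      moreover have "xs \<noteq> encode_token t @ ys" for t ys
        using 4 by (cases t) (auto simp: xs xs1)
      ultimately show ?thesis unfolding s0_def by blast
    qed
  qed
qed


text \<open>Every token consumes input, so there are at most \<open>length xs\<close> rounds. A
  round costs at most \<open>3 * length xs + 30\<close> steps for the token and two for the
  loop.\<close>

lemma exec_read_loop:
  "(exec read_loop (read_store xs ts d k) ((3 * length xs + 32) * length xs + 1) (Inr True) \<and>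
      (\<forall>us. xs \<noteq> concat (map encode_token us))) \<or>
   (\<exists>us. exec read_loop (read_store xs ts d k) ((3 * length xs + 32) * length xs + 1)
      (Inl (read_store [] (ts @ us) d (k + length us))) \<and> xs = concat (map encode_token us))"
proof (induction xs arbitrary: ts k rule: length_induct)
  case (1 xs)
  show ?case
  proof (cases "xs = []")
    case True
    have "exec read_loop (read_store xs ts d k) ((3 * length xs + 32) * length xs + 1)
        (Inl (read_store [] (ts @ []) d (k + length [])))"
      by (rule exec_While_end') (simp_all add: True read_store_def)
    moreover have "xs = concat (map encode_token [])" using True by simp
    ultimately show ?thesis by blast
  next
    case False
    then have top: "top0 (read_store xs ts d k 0) \<noteq> 0"
      by (cases xs) (simp_all add: read_store_def)
    from exec_read_token[OF False, of ts d k] consider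
      "exec read_token (read_store xs ts d k) (3 * length xs + 30) (Inr True)" "\<forall>t ys. xs \<noteq> encode_token t @ ys"
      | t ys where "exec read_token (read_store xs ts d k) (3 * length xs + 30) (Inl (read_store ys (ts @ [t]) d (Suc k)))"
        "xs = encode_token t @ ys"
      by blast
    then show ?thesis
    proof cases
      case 1
      obtain l where l: "length xs = Suc l" using False by (cases xs) auto
      have "exec read_loop (read_store xs ts d k) ((3 * length xs + 32) * length xs + 1) (Inr True)"
        by (rule exec_mono[OF exec_While_exit[OF _ 1(1)]]) (use top in \<open>simp_all add: l\<close>)
      moreover have "xs \<noteq> concat (map encode_token us)" for us
        using 1(2) False by (cases us) auto
      ultimately show ?thesis by blast
    next
      case (2 t ys)
      have len: "length ys < length xs" using 2(2) by (cases t) auto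
      then obtain l where l: "length xs = Suc l" "length ys \<le> l" by (cases "length xs") auto
      have mono: "(3 * length ys + 32) * length ys \<le> (3 * length xs + 32) * l"
        using l by (intro mult_le_mono) auto
      have step: "exec read_loop (read_store xs ts d k) ((3 * length xs + 32) * length xs + 1) r"
        if "exec read_loop (read_store ys (ts @ [t]) d (Suc k)) ((3 * length ys + 32) * length ys + 1) r" for r
        by (rule exec_While_step'[OF 2(1) _ that]) (use top mono l in simp_all)
      from "1.IH"[rule_format, OF len, of "ts @ [t]" "Suc k"] consider
        "exec read_loop (read_store ys (ts @ [t]) d (Suc k)) ((3 * length ys + 32) * length ys + 1) (Inr True)"
          "\<forall>us. ys \<noteq> concat (map encode_token us)"
        | us where "exec read_loop (read_store ys (ts @ [t]) d (Suc k)) ((3 * length ys + 32) * length ys + 1)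
            (Inl (read_store [] ((ts @ [t]) @ us) d (Suc k + length us)))" "ys = concat (map encode_token us)"
        by blast
      then show ?thesis
      proof cases
        case A: 1
        have "xs \<noteq> concat (map encode_token us)" for us
        proof
          assume us: "xs = concat (map encode_token us)"
          then obtain s us' where "us = s # us'" using False by (cases us) auto
          with us 2(2) have "ys = concat (map encode_token us')" by (simp add: encode_token_append_inject)
          with A(2) show False by blast
        qed
        then show ?thesis using step[OF A(1)] by blast
      next
        case B: (2 us)
        have "exec read_loop (read_store xs ts d k) ((3 * length xs + 32) * length xs + 1)
            (Inl (read_store [] (ts @ t # us) d (k + length (t # us))))"
          using step[OF B(1)] by simp
        moreover have "xs = concat (map encode_token (t # us))" using 2(2) B(2) by simp
        ultimately show ?thesis by blast
      qed
    qed
  qed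
qed

text \<open>The first three bits give the last symbol, because the table is built on a stack.
  Missing bits count as \<open>False\<close>, which makes every bit string a table.\<close>

function table :: "bool list \<Rightarrow> nat list" where
  "table [] = []"
| "table (a # u) = table (drop 2 u) @ [8 + 4 * of_bool a + 2 * of_bool (u \<noteq> [] \<and> hd u) + of_bool (tl u \<noteq> [] \<and> hd (tl u))]"
  by pat_completeness auto
termination by (relation "measure length") auto

lemma length_table: "length (table u) \<le> length u"
proof (induction u rule: table.induct)
  case (2 a u)
  moreover have "length (drop 2 u) \<le> length u" by simp
  ultimately show ?case unfolding table.simps by (simp del: length_drop)
qed simp

lemma table_nonzero: "0 \<notin> set (table u)"
  by (induction u rule: table.induct) auto

lemma top0_map_bit_sym: "top0 (map bit_sym u) = 2 \<longleftrightarrow> u \<noteq> [] \<and> hd u"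
  by (cases u) (auto simp: bit_sym_def)

lemma exec_load_table:
  assumes "s 1 = map bit_sym u" "s 13 = []" "s 3 = d" "s 4 = replicate k 1"
  shows "exec load_table s (10 * length u + 1)
    (Inl (s(1 := [], 3 := table u @ d, 4 := replicate (k + length (table u)) 1)))"
  using assms
proof (induction u arbitrary: s d k rule: table.induct)
  case 1
  have eq: "s(1 := [], 3 := table [] @ d, 4 := replicate (k + length (table [])) 1) = s"
    using 1 by (auto simp: fun_eq_iff)
  show ?case unfolding load_table_def by (rule exec_While_end'[OF _ eq]) (use 1 in simp_all)
next
  case (2 a u)
  note prems = "2.prems"
  define b where "b \<longleftrightarrow> u \<noteq> [] \<and> hd u"
  define c where "c \<longleftrightarrow> tl u \<noteq> [] \<and> hd (tl u)"
  define f where "f = 8 + 4 * of_bool a + 2 * of_bool b + (of_bool c :: nat)"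
  define s1 where "s1 = s(13 := [1])"
  define s2 where "s2 = s1(1 := map bit_sym u, 13 := [2 + of_bool a])"
  define s3 where "s3 = s2(1 := map bit_sym (tl u), 13 := [4 + 2 * of_bool a + of_bool b])"
  define s4 where "s4 = s3(1 := map bit_sym (drop 2 u), 13 := [f])"
  define s5 where "s5 = s4(13 := [], 3 := f # d, 4 := replicate (Suc k) 1)"
  have 1: "exec (Upd (\<lambda>t. no_act(13 := Push 1))) s 1 (Inl s1)"
    by (rule exec_Upd) (simp add: s1_def prems)
  have 2: "exec (read_bit 1) s1 1 (Inl s2)"
    by (rule exec_read_bit[where f = 1]) (use prems in \<open>cases a; simp add: s2_def s1_def\<close>)+
  have 3: "exec (read_bit 1) s2 1 (Inl s3)"
    by (rule exec_read_bit[where f = "2 + of_bool a"])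
      (simp_all add: s3_def s2_def top0_map_bit_sym b_def map_tl fun_eq_iff)
  have d2: "tl (tl u) = drop 2 u" by (simp add: drop_Suc numeral_2_eq_2)
  have 4: "exec (read_bit 1) s3 1 (Inl s4)"
    by (rule exec_read_bit[where f = "4 + 2 * of_bool a + of_bool b"])
      (simp_all add: s4_def s3_def top0_map_bit_sym c_def f_def map_tl[symmetric] d2 fun_eq_iff)
  have 5: "exec (Upd (\<lambda>t. no_act(13 := Pop, 3 := Push (t 13), 4 := Push 1))) s4 1 (Inl s5)"
    by (rule exec_Upd) (simp add: s5_def s4_def s3_def s2_def s1_def prems fun_eq_iff)
  note body = exec_Seq[OF 1 exec_Seq[OF 2 exec_Seq[OF 3 exec_Seq[OF 4 5]]]]
  have rest: "exec load_table s5 (10 * length (drop 2 u) + 1)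
    (Inl (s5(1 := [], 3 := table (drop 2 u) @ f # d, 4 := replicate (Suc k + length (table (drop 2 u))) 1)))"
    by (rule "2.IH") (simp_all add: s5_def s4_def)
  have eq: "s5(1 := [], 3 := table (drop 2 u) @ f # d, 4 := replicate (Suc k + length (table (drop 2 u))) 1)
    = s(1 := [], 3 := table (a # u) @ d, 4 := replicate (k + length (table (a # u))) 1)"
    using prems by (simp add: s5_def s4_def s3_def s2_def s1_def f_def b_def c_def fun_eq_iff)
  show ?case unfolding eq[symmetric] unfolding load_table_def
    by (rule exec_While_step'[OF body _ rest[unfolded load_table_def]]) (use prems in simp_all)
qed

text \<open>The cubic term comes from evaluating at most \<open>Z\<close> tokens at cost
  \<open>eval_cost Z\<close> each, which is quadratic.\<close>

definition total_cost :: "nat \<Rightarrow> nat" where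
  "total_cost Z = 20 + 131 * Z + 53 * Z * Z + 4 * Z * Z * Z"

theorem exec_program:
  assumes "Z = length x + length u + 2"
  shows "\<exists>b. exec program (init_store x u) (total_cost Z) (Inr b) \<and>
    (b \<longleftrightarrow> (\<forall>A. x = encode A \<longrightarrow> val (valuation (table u)) A < 0))"
proof -
  let ?d = "table u"
  define s1 where "s1 = (init_store x u)(4 := [1])"
  have 1: "exec (Upd (\<lambda>t. no_act(4 := Push 1))) (init_store x u) 1 (Inl s1)"
    by (rule exec_Upd) (simp add: s1_def init_store_def)
  have "exec load_table s1 (10 * length u + 1)
      (Inl (s1(1 := [], 3 := ?d @ [], 4 := replicate (1 + length ?d) 1)))"
    by (rule exec_load_table) (simp_all add: s1_def init_store_def)
  moreover have "s1(1 := [], 3 := ?d @ [], 4 := replicate (1 + length ?d) 1) = read_store x [] ?d (1 + length ?d)"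
    by (simp add: s1_def init_store_def read_store_def fun_eq_iff)
  ultimately have 2: "exec load_table s1 (10 * Z + 1) (Inl (read_store x [] ?d (1 + length ?d)))"
    using assms by (auto elim!: exec_mono)
  have len: "(3 * length x + 32) * length x + 1 \<le> (3 * Z + 32) * Z + 1"
    using assms by (intro add_right_mono mult_le_mono) auto
  have cost: "1 + ((10 * Z + 1) + ((3 * Z + 32) * Z + 1 + (2 * (eval_cost Z + 1) * Z + 1 + (2 * Z + 5 + 2 + 1) + 1) + 1) + 1) + 1 \<le> total_cost Z"
    by (simp add: total_cost_def eval_cost_def algebra_simps)
  from exec_read_loop[of x "[]" ?d "1 + length ?d"] consider
    "exec read_loop (read_store x [] ?d (1 + length ?d)) ((3 * length x + 32) * length x + 1) (Inr True)"
      "\<forall>ts. x \<noteq> concat (map encode_token ts)"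
    | ts where "exec read_loop (read_store x [] ?d (1 + length ?d)) ((3 * length x + 32) * length x + 1)
        (Inl (read_store [] ([] @ ts) ?d (1 + length ?d + length ts)))" "x = concat (map encode_token ts)"
    by blast
  then show ?thesis
  proof cases
    case A: 1
    have 3: "exec read_loop (read_store x [] ?d (1 + length ?d)) ((3 * Z + 32) * Z + 1) (Inr True)"
      by (rule exec_mono[OF A(1) len])
    have "exec program (init_store x u) (total_cost Z) (Inr True)"
      unfolding program_def
      by (rule exec_mono[OF exec_Seq[OF 1 exec_Seq[OF 2 exec_Seq_exit[OF 3]]]]) (use cost in simp)
    moreover have "x \<noteq> encode A" for A using A(2) by (simp add: encode_tokens)
    ultimately show ?thesis by blast
  next
    case B: (2 ts)
    \<comment> \<open>The number of units on stack 4 after reading: the sign digit, one per table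
      symbol and one per token.\<close>
    define N where "N = 1 + length ?d + length ts"
    define r :: "store + bool" where "r = (case parse (ts @ []) of None \<Rightarrow> Inr True
      | Some Bs \<Rightarrow> Inl (eval_store [] ?d N (map (val (valuation ?d)) Bs)))"
    have 3: "exec read_loop (read_store x [] ?d (1 + length ?d)) ((3 * Z + 32) * Z + 1)
        (Inl (eval_store (tokens_stack ts) ?d N (map (val (valuation ?d)) [])))"
      using exec_mono[OF B(1) len] by (simp add: read_store_def eval_store_def N_def fun_upd_twist fun_upd_idem)
    have enc_len: "length (encode_token t) \<le> length x" if "t \<in> set ts" for t
      using split_list[OF that] unfolding B(2) by auto
    have "length ts \<le> length (concat (map encode_token ts))"
    proof (induction ts)
      case (Cons t ts)
      moreover have "1 \<le> length (encode_token t)" by (cases t) auto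
      ultimately show ?case by simp
    qed simp
    then have ts_len: "length ts \<le> length x" by (simp add: B(2))
    have NZ: "N \<le> Z" using length_table[of u] ts_len assms by (simp add: N_def)
    have "exec eval_loop (eval_store (tokens_stack ts) ?d N (map (val (valuation ?d)) []))
        (2 * (eval_cost Z + 1) * length ts + 1) r"
      unfolding r_def
    proof (rule exec_eval_loop[OF table_nonzero _ NZ])
      show "N = Suc (length ?d + length ts)" by (simp add: N_def)
      show "\<forall>t\<in>set ts. length (encode_token t) \<le> Z" using enc_len assms by fastforce
    qed simp_all
    then have 4: "exec eval_loop (eval_store (tokens_stack ts) ?d N (map (val (valuation ?d)) []))
        (2 * (eval_cost Z + 1) * Z + 1) r"
      by (rule exec_mono) (intro add_right_mono mult_le_mono2, use ts_len assms in simp)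
    show ?thesis
    proof (cases "parse ts")
      case None
      have "exec program (init_store x u) (total_cost Z) (Inr True)"
        unfolding program_def
        by (rule exec_mono[OF exec_Seq[OF 1 exec_Seq[OF 2 exec_Seq[OF 3 exec_Seq_exit[OF 4[unfolded r_def append_Nil2 None option.case]]]]]])
          (use cost in simp)
      moreover have "x \<noteq> encode A" for A
        using None parse_eq_Some_iff[of ts A] B(2) by auto
      ultimately show ?thesis by blast
    next
      case (Some As)
      note 4 = 4[unfolded r_def append_Nil2 Some option.case]
      let ?s = "eval_store [] ?d N (map (val (valuation ?d)) As)"
      show ?thesis
      proof (cases As)
        case Nil
        have 5: "exec pop_value ?s (2 * N + 5) (Inr True)"
          by (rule exec_pop_value_exit) (simp add: eval_store_def Nil)
        have "exec program (init_store x u) (total_cost Z) (Inr True)"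
          unfolding program_def
          by (rule exec_mono[OF exec_Seq[OF 1 exec_Seq[OF 2 exec_Seq[OF 3 exec_Seq[OF 4 exec_Seq_exit[OF 5]]]]]])
            (use cost NZ in simp)
        moreover have "x \<noteq> encode A" for A
          using Some Nil parse_eq_Some_iff[of ts A] B(2) by auto
        ultimately show ?thesis by blast
      next
        case (Cons A As')
        let ?z = "val (valuation ?d) A"
        define s2 where "s2 = ?s(5 := value_stack N (map (val (valuation ?d)) As'), 11 := rev (bits N ?z))"
        have 5: "exec pop_value ?s (2 * N + 5) (Inl s2)"
          by (rule exec_pop_value) (simp_all add: s2_def eval_store_def Cons N_def)
        have "\<bar>?z\<bar> \<le> int (leaves A) * 2 ^ length ?d" by (rule abs_val_valuation_le)
        moreover have "leaves A \<le> length ts" using parse_leaves[OF Some] Cons by simp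
        ultimately have "- (2 ^ (length ts + length ?d)) \<le> ?z" "?z < 2 ^ (length ts + length ?d)"
          using small_value[OF _ _ order_refl] by blast+
        then have "last (bits (Suc (length ts + length ?d)) ?z) = bit_sym (?z < 0)" by (rule last_bits)
        moreover have N: "N = Suc (length ts + length ?d)" by (simp add: N_def)
        moreover have "top0 (rev (bits N ?z)) = last (bits N ?z)" by (rule top0_rev) (simp add: N)
        ultimately have sign: "top0 (s2 11) = bit_sym (?z < 0)"
          by (simp add: s2_def del: bits.simps)
        have single: "top0 (s2 5) = 0 \<longleftrightarrow> As' = []"
          by (cases As') (simp_all add: s2_def N_def)
        define b where "b \<longleftrightarrow> \<not> (As' = [] \<and> 0 \<le> ?z)"
        have 6: "exec (Cond (\<lambda>t. t 5 = 0 \<and> t 11 = 1) (Halt False) (Halt True)) s2 2 (Inr b)"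
        proof (cases b)
          case True
          then have "\<not> (top0 (s2 5) = 0 \<and> top0 (s2 11) = 1)"
            unfolding sign single by (auto simp: b_def bit_sym_def)
          then have "exec (Cond (\<lambda>t. t 5 = 0 \<and> t 11 = 1) (Halt False) (Halt True)) s2 2 (Inr True)"
            by (intro exec_Cond_False[OF _ exec_Halt]) simp_all
          then show ?thesis using True by simp
        next
          case False
          then have "top0 (s2 5) = 0 \<and> top0 (s2 11) = 1"
            unfolding sign single by (auto simp: b_def bit_sym_def)
          then have "exec (Cond (\<lambda>t. t 5 = 0 \<and> t 11 = 1) (Halt False) (Halt True)) s2 2 (Inr False)"
            by (intro exec_Cond_True[OF _ exec_Halt]) simp_all
          then show ?thesis using False by simp
        qed
        have "exec program (init_store x u) (total_cost Z) (Inr b)"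
          unfolding program_def
          by (rule exec_mono[OF exec_Seq[OF 1 exec_Seq[OF 2 exec_Seq[OF 3 exec_Seq[OF 4 exec_Seq[OF 5 6]]]]]])
            (use cost NZ in simp)
        moreover have "b \<longleftrightarrow> (\<forall>A. x = encode A \<longrightarrow> val (valuation ?d) A < 0)"
        proof -
          have "x = encode A' \<longleftrightarrow> As' = [] \<and> A' = A" for A'
            using parse_eq_Some_iff[of ts A'] B(2) by (auto simp: Some Cons)
          then show ?thesis by (auto simp: b_def)
        qed
        ultimately show ?thesis by blast
      qed
    qed
  qed
qed


section \<open>Certificates\<close>

definition names :: "nat list \<Rightarrow> nat list" where
  "names = map (\<lambda>a. a + 7)"

definition vals :: "nat list \<Rightarrow> nat list" where
  "vals = map (\<lambda>a. a + 9)"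

text \<open>The matched and the unmatched part always recombine to the whole name. That is why the
  end of an entry can restore it, whatever the outcome of the comparison.\<close>

lemma scan_names:
  "set q \<subseteq> {1, 2} \<Longrightarrow> 0 \<notin> set w \<Longrightarrow> \<exists>ok' v v'. scan (names q @ d) ok w w' g = scan d ok' v v' g \<and> rev v' @ v = rev w' @ w \<and>
    (ok' \<and> v = [] \<longleftrightarrow> ok \<and> q = w)"
proof (induction q arbitrary: ok w w')
  case Nil
  then show ?case by (rule_tac x = ok in exI, rule_tac x = w in exI, rule_tac x = w' in exI) (auto simp: names_def)
next
  case (Cons a q)
  show ?case
  proof (cases "ok \<and> top0 w = a")
    case True
    then obtain w0 where w: "w = a # w0" using Cons.prems by (cases w) auto
    have eq: "scan (names (a # q) @ d) ok w w' g = scan (names q @ d) True w0 (a # w') g"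
      using True Cons.prems by (auto simp: names_def w)
    show ?thesis unfolding eq using Cons.IH[of w0 True "a # w'"] Cons.prems True by (simp add: w)
  next
    case False
    then have eq: "scan (names (a # q) @ d) ok w w' g = scan (names q @ d) False w w' g"
      using Cons.prems by (auto simp: names_def)
    have "\<not> (ok \<and> a # q = w)" using False by auto
    moreover obtain ok' v v' where "scan (names q @ d) False w w' g = scan d ok' v v' g"
      "rev v' @ v = rev w' @ w" "\<not> (ok' \<and> v = [])"
      using Cons.IH[of w False w'] Cons.prems by auto
    ultimately show ?thesis unfolding eq by blast
  qed
qed

lemma scan_vals:
  "set z \<subseteq> {1, 2} \<Longrightarrow> scan (vals z @ d) ok w w' g = scan d ok w w' (if ok \<and> w = [] then rev z @ g else g)"
  by (induction z arbitrary: g) (auto simp: vals_def)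

text \<open>\<open>12\<close> is one of the symbols that end an entry.\<close>

definition entry :: "nat list \<Rightarrow> nat list \<Rightarrow> nat list" where
  "entry q z = names q @ vals z @ [12]"

lemma scan_entry:
  assumes "set q \<subseteq> {1, 2}" "set z \<subseteq> {1, 2}" "0 \<notin> set w"
  shows "scan (entry q z @ d) True w [] g = scan d True w [] (if q = w then rev z @ g else g)"
proof -
  obtain ok v v' where *: "scan (names q @ (vals z @ 12 # d)) True w [] g = scan (vals z @ 12 # d) ok v v' g"
    "rev v' @ v = w" "ok \<and> v = [] \<longleftrightarrow> q = w"
    using scan_names[OF assms(1,3), of "vals z @ 12 # d" True "[]" g] by auto
  then show ?thesis using scan_vals[OF assms(2), of "12 # d" ok v v' g] by (simp add: entry_def)
qed

lemma digits_inject: "digits p = digits q \<longleftrightarrow> p = q"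
  using encode_nat_append_inject[of p "[]" q "[]"] by (auto simp: encode_nat_digits)

definition table_for :: "nat \<Rightarrow> (nat \<Rightarrow> int) \<Rightarrow> nat list \<Rightarrow> nat list" where
  "table_for k v ps = concat (map (\<lambda>p. entry (map bit_sym (digits p)) (bits k (v p))) ps)"

lemma map_bit_sym_inject: "map bit_sym a = map bit_sym b \<longleftrightarrow> a = b"
proof
  have "inj bit_sym" by (auto simp: inj_def bit_sym_def split: if_splits)
  then show "map bit_sym a = map bit_sym b \<Longrightarrow> a = b" by (simp add: inj_map_eq_map)
qed simp

text \<open>A second entry for the same variable would append its digits to those of the first;
  distinctness of \<open>ps\<close> excludes this.\<close>

lemma scan_table_for:
  assumes "distinct ps"
  shows "scan (table_for k v ps) True (map bit_sym (digits p)) [] g =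
    (if p \<in> set ps then rev (bits k (v p)) @ g else g)"
  using assms
proof (induction ps arbitrary: g)
  case Nil
  then show ?case by (simp add: table_for_def)
next
  case (Cons q ps)
  have nz: "0 \<notin> set (map bit_sym (digits p))" by (auto simp: bit_sym_def)
  have "scan (table_for k v (q # ps)) True (map bit_sym (digits p)) [] g =
    scan (table_for k v ps) True (map bit_sym (digits p)) [] (if q = p then rev (bits k (v q)) @ g else g)"
    using scan_entry[OF set_map_bit_sym set_bits nz, of "digits q" k "v q" "table_for k v ps" g]
    by (auto simp: table_for_def map_bit_sym_inject digits_inject)
  with Cons show ?case by auto
qed

lemma valuation_table_for:
  assumes "distinct ps" "p \<in> set ps" "- (2 ^ n) \<le> v p" "v p < 2 ^ n"
  shows "valuation (table_for (Suc n) v ps) p = v p"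
  unfolding valuation_def lookup_def scan_table_for[OF assms(1)]
  using assms(2) sval_bits[OF assms(3,4)] by simp

lemma set_table_for: "set (table_for k v ps) \<subseteq> {8..15}"
proof -
  have "set (entry (map bit_sym ds) (bits k z)) \<subseteq> {8..15}" for ds z
  proof -
    have "\<forall>x\<in>set (bits k z). x \<le> 6" using set_bits[of k z] by auto
    then show ?thesis by (auto simp: entry_def names_def vals_def bit_sym_def)
  qed
  then show ?thesis unfolding table_for_def set_concat set_map by blast
qed

text \<open>The three low bits of each symbol from \<open>8\<close> to \<open>15\<close>, in reverse
  order since loading reverses the table.\<close>

definition certificate :: "nat list \<Rightarrow> bool list" where
  "certificate d = concat (map (\<lambda>x. [12 \<le> x, odd (x div 2), odd x]) (rev d))"

lemma table_certificate:
  assumes "set d \<subseteq> {8..15}"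
  shows "table (certificate d) = d"
proof -
  have "table (concat (map (\<lambda>x. [12 \<le> x, odd (x div 2), odd x]) l)) = rev l" if "set l \<subseteq> {8..15}" for l
    using that
  proof (induction l)
    case (Cons x l)
    then have "x \<in> {8, 9, 10, 11, 12, 13, 14, 15}" by auto
    then have "8 + 4 * of_bool (12 \<le> x) + 2 * of_bool (odd (x div 2)) + of_bool (odd x) = x" by auto
    with Cons show ?case by simp
  qed simp
  from this[of "rev d"] assms show ?thesis by (simp add: certificate_def)
qed

lemma length_certificate: "length (certificate d) = 3 * length d"
  by (simp add: certificate_def length_concat comp_def sum_list_triv)

lemma leaves_le_encode: "leaves A \<le> length (encode A)"
  by (induction A) auto

lemma digits_le_encode: "p \<in> vars A \<Longrightarrow> length (digits p) \<le> length (encode A)"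
proof (induction A)
  case (Var q)
  then show ?case using length_pairs[of "digits p"] by (simp add: encode_nat_digits)
qed auto

text \<open>Turns the bound of \<open>small_countermodel\<close> into a digit count, using
  \<open>2 * l + 1 \<le> 2 ^ (l + 1)\<close>.\<close>

lemma small_power:
  fixes l :: nat
  shows "(2 * int l + 1) ^ l \<le> 2 ^ ((l + 1) * l)"
proof -
  have "l < 2 ^ l" by (rule less_exp)
  moreover have "(2::nat) ^ (l + 1) = 2 * 2 ^ l" by simp
  ultimately have "2 * l + 1 \<le> 2 ^ (l + 1)" by linarith
  then have "int (2 * l + 1) \<le> int (2 ^ (l + 1))" by (simp only: of_nat_le_iff)
  then have "(2 * int l + 1) ^ l \<le> (2 ^ (l + 1)) ^ l" by (intro power_mono) simp_all
  then show ?thesis by (simp only: power_mult)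
qed

lemma length_concat_map_le:
  "(\<And>x. x \<in> set l \<Longrightarrow> length (f x) \<le> c) \<Longrightarrow> length (concat (map f l)) \<le> length l * c"
  by (induction l) (auto intro: add_mono)

theorem small_certificate:
  assumes "val v0 A < 0" "n = length (encode A)"
  shows "\<exists>u. length u \<le> 3 * n * (n + (n * n + n + 2) + 1) \<and> val (valuation (table u)) A < 0"
proof -
  obtain v where v: "val v A < 0" "\<And>p. p \<in> vars A \<Longrightarrow> \<bar>v p\<bar> \<le> (2 * int (leaves A) + 1) ^ leaves A"
    using small_countermodel[OF assms(1)] by blast
  \<comment> \<open>The added \<open>1\<close> makes the upper bound strict; the sign digit comes on
    top, as \<open>Suc m\<close>.\<close>
  define m where "m = (leaves A + 1) * leaves A + 1"
  define ps where "ps = sorted_list_of_set (vars A)"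
  define d where "d = table_for (Suc m) v ps"
  have ps: "distinct ps" "set ps = vars A" by (simp_all add: ps_def)
  have "(2::int) ^ ((leaves A + 1) * leaves A) < 2 ^ m" by (simp add: m_def)
  then have bound: "- (2 ^ m) \<le> v p" "v p < 2 ^ m" if "p \<in> vars A" for p
    using v(2)[OF that] small_power[of "leaves A"] unfolding abs_le_iff by linarith+
  have "valuation d p = v p" if "p \<in> vars A" for p
    unfolding d_def using that ps bound by (intro valuation_table_for) auto
  then have "val (valuation d) A < 0" using v(1) val_cong[of A "valuation d" v] by simp
  \<comment> \<open>At most \<open>n\<close> entries, each with a name of at most \<open>n\<close>
    digits, at most \<open>n * n + n + 2\<close> value digits and one end symbol.\<close>
  moreover have "length d \<le> n * (n + (n * n + n + 2) + 1)"
  proof -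
    have n: "leaves A \<le> n" using leaves_le_encode assms(2) by simp
    have "length (entry (map bit_sym (digits p)) (bits (Suc m) (v p))) \<le> n + (n * n + n + 2) + 1" if "p \<in> vars A" for p
    proof -
      have "(leaves A + 1) * leaves A \<le> (n + 1) * n" using n by (intro mult_le_mono) auto
      then show ?thesis using digits_le_encode[OF that] assms(2)
        by (simp add: entry_def names_def vals_def m_def)
    qed
    then have "length d \<le> length ps * (n + (n * n + n + 2) + 1)"
      unfolding d_def table_for_def using ps(2) by (intro length_concat_map_le) blast
    moreover have "length ps \<le> n" using card_vars_le[of A] n by (simp add: ps_def)
    ultimately show ?thesis by (rule order_trans[OF _ mult_le_mono1])
  qed
  moreover have "table (certificate d) = d" unfolding d_def by (intro table_certificate set_table_for)
  ultimately show ?thesis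
    by (intro exI[of _ "certificate d"]) (simp add: length_certificate algebra_simps)
qed

theorem mainTheorem15: "{encode A | A. {#} \<turnstile>\<^sub>l {#(Unit, A)#}} \<in> co_NP"
proof -
  define L where "L = {encode A | A. {#} \<turnstile>\<^sub>l {#(Unit, A)#}}"
  have "\<exists>M. wf_tm M \<and> (\<forall>x u n b. exec program (init_store x u) n (Inr b) \<longrightarrow>
      halted M (run M (2 * n) x u) \<and> (accepts M x u \<longleftrightarrow> b))"
    by (rule ex_machine[OF _ _ ok_program]) simp_all
  then obtain M where *: "wf_tm M \<and> (\<forall>x u n b. exec program (init_store x u) n (Inr b) \<longrightarrow>
      halted M (run M (2 * n) x u) \<and> (accepts M x u \<longleftrightarrow> b))" ..
  note wf = *[THEN conjunct1] and decides = *[THEN conjunct2, rule_format]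
  \<comment> \<open>The polynomial \<open>p\<close> expands the bound of
    \<open>small_certificate\<close>. The polynomial \<open>q\<close> is twice
    \<open>total_cost\<close>, as a program step takes up to two machine steps, evaluated at
    \<open>n + poly p n + 2\<close>.\<close>
  define p :: "nat poly" where "p = [:0, 9, 6, 3:]"
  define q :: "nat poly" where "q = pcompose [:40, 262, 106, 8:] ([:2, 1:] + p)"
  have p: "poly p n = 3 * n * (n + (n * n + n + 2) + 1)" for n
    by (simp add: p_def algebra_simps)
  have q: "poly q n = 2 * total_cost (n + poly p n + 2)" for n
  proof -
    have "poly [:40, 262, 106, 8:] Z = 2 * total_cost Z" for Z
      by (simp add: total_cost_def algebra_simps)
    moreover have "poly ([:2, 1:] + p) n = n + poly p n + 2" by simp
    ultimately show ?thesis unfolding q_def poly_pcompose by (simp only:)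
  qed
  \<comment> \<open>As \<open>encode\<close> is injective, at most one \<open>A\<close> is meant.
    For words that encode no formula the condition is vacuous, so the empty certificate suffices for
    them.\<close>
  have accepts: "accepts M x u \<longleftrightarrow> (\<forall>A. x = encode A \<longrightarrow> val (valuation (table u)) A < 0)" for x u
  proof -
    obtain b where b: "exec program (init_store x u) (total_cost (length x + length u + 2)) (Inr b)"
      "b \<longleftrightarrow> (\<forall>A. x = encode A \<longrightarrow> val (valuation (table u)) A < 0)"
      using exec_program[OF refl, of x u] by (elim exE conjE)
    show ?thesis using decides[OF b(1)] b(2) by simp
  qed
  have "- L \<in> NP"
    unfolding NP_def mem_Collect_eq
  proof (intro exI conjI allI impI)
    show "wf_tm M" by (rule wf)
    fix x u :: "bool list" assume u: "length u \<le> poly p (length x)"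
    obtain b where "exec program (init_store x u) (total_cost (length x + length u + 2)) (Inr b)"
      using exec_program[OF refl, of x u] by (elim exE conjE)
    moreover have "total_cost (length x + length u + 2) \<le> total_cost (length x + poly p (length x) + 2)"
      unfolding total_cost_def using u by (intro add_mono mult_le_mono) auto
    ultimately have "exec program (init_store x u) (total_cost (length x + poly p (length x) + 2)) (Inr b)"
      by (rule exec_mono)
    from decides[OF this] show "halted M (run M (poly q (length x)) x u)" unfolding q by (rule conjunct1)
  next
    fix x
    show "x \<in> - L \<longleftrightarrow> (\<exists>u. length u \<le> poly p (length x) \<and> accepts M x u)"
    proof
      assume x: "x \<in> - L"
      show "\<exists>u. length u \<le> poly p (length x) \<and> accepts M x u"
      proof (cases "\<exists>A. x = encode A")
        case True
        then obtain A where A: "x = encode A" ..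
        with x obtain v0 where "val v0 A < 0" by (auto simp: L_def derivable_iff not_le)
        from small_certificate[OF this refl] obtain u where
          "length u \<le> poly p (length x)" "val (valuation (table u)) A < 0" unfolding p A by blast
        moreover have "accepts M x u"
          unfolding accepts A using calculation(2) by (auto dest: injD[OF inj_encode])
        ultimately show ?thesis by blast
      next
        case False
        then have "accepts M x []" unfolding accepts by blast
        then show ?thesis by (intro exI[of _ "[]"]) simp
      qed
    next
      assume "\<exists>u. length u \<le> poly p (length x) \<and> accepts M x u"
      then obtain u where "accepts M x u" by blast
      then have u: "\<forall>A. x = encode A \<longrightarrow> val (valuation (table u)) A < 0" unfolding accepts .
      show "x \<in> - L"
      proof (rule ComplI)
        assume "x \<in> L"
        then obtain A where A: "x = encode A" "\<forall>v. 0 \<le> val v A" by (auto simp: L_def derivable_iff)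
        with u have "val (valuation (table u)) A < 0" by simp
        moreover have "0 \<le> val (valuation (table u)) A" using A(2) by (rule spec)
        ultimately show False by simp
      qed
    qed
  qed
  then show ?thesis by (simp add: co_NP_def L_def)
qed

end
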